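(* Let $a>b>0$ be real, let $\mathcal{E}\subset\mathbb{CP}^2$ be the complex conic $\frac{x^2}{a^2}+\frac{y^2}{b^2}=1$, and for $\lambda\in\mathbb{C}\setminus\{-a^2,-b^2\}$ let $\mathcal{C}_\lambda$ be the confocal conic $\frac{x^2}{a^2+\lambda}+\frac{y^2}{b^2+\lambda}=1$. Fix $n\ge 3$. There exist $N$ pairwise distinct confocal conics $\gamma^n_1,\ldots,\gamma^n_N$, each of the form $\mathcal{C}_\lambda$ with $\lambda\notin\{0,-a^2,-b^2\}$, satisfying the following properties: 1. any $n$-sided polygon inscribed in $\mathcal{E}$, circumscribed about some $\gamma^n_j$ and having its consecutive vertices distinct, is an $n$-periodic billiard orbit of $\mathcal{E}$ which is non-degenerate, non-isotropic and non-flat; 2. any non-degenerate non-isotropic $n$-periodic billiard orbit of $\mathcal{E}$ none of whose sides passes through a real or complex focus of $\mathcal{E}$ is circumscribed about one of the $\gamma^n_j$; 3. for each point $p\in\mathcal{E}$ and each $j$, there is an $n$-sided polygon inscribed in $\mathcal{E}$ and circumscribed about $\gamma^n_j$ having $p$ as a vertex. Furthermore, $N\le n^2/4$ if $n$ is even, and $N\le (n^2-1)/4$ if $n$ is odd. For $n=3$ one has $N=2$. For $n=4$ one has $N=3$ if $a\ne\sqrt2\,b$ and $N=2$ if $a=\sqrt2\, b$.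
   Context: Conics are considered in $\mathbb{CP}^2=\mathbb{C}^2\sqcup\overline{\mathbb{C}}_\infty$ (projective closures), where $\overline{\mathbb{C}}_\infty$ is the line at infinity. Polygons are in the sense of Poncelet's theorem: an $n$-sided polygon inscribed in $\mathcal{E}$ and circumscribed about a smooth conic $D$ consists of vertices $M_j\in\mathcal{E}$ and sides (lines) $\ell_j$, $j\in\mathbb{Z}/n$, such that for every $j$ the intersection of $\ell_j$ with $\mathcal{E}$, counted with multiplicity, is $\{M_j,M_{j+1}\}$ (so $\ell_j=T_{M_j}\mathcal{E}$ if $M_j=M_{j+1}$), and $\ell_{j-1},\ell_j$ are the two tangent lines to $D$ through $M_j$, counted with multiplicity (they coincide iff $M_j\in D$). Let $q(x,y)=x^2+y^2$ on $\mathbb{C}^2$. A line in $\mathbb{CP}^2$ is isotropic if it contains $(1:i:0)$ or $(1:-i:0)$ (so the line at infinity is isotropic). The symmetry with respect to a non-isotropic line $L$ is the unique non-trivial complex affine involution of $\mathbb{C}^2$ isometric for $q$ and fixing $L$ pointwise, extended to $\mathbb{CP}^2$; it acts on points and lines. A non-degenerate $n$-periodic billiard orbit of $\mathcal{E}$ is a tuple $(M_0,\ldots,M_n)$ of points of $\mathcal{E}$ with $M_n=M_0$ such that, with indices modulo $n$, for all $j$: $M_j\ne M_{j+1}$, the tangent line $T_{M_j}\mathcal{E}$ is non-isotropic, and the lines $M_{j-1}M_j$ and $M_jM_{j+1}$ are symmetric with respect to $T_{M_j}\mathcal{E}$. Its sides are the lines $M_jM_{j+1}$; it is circumscribed about a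 smooth conic $D$ if, for every $j$ modulo $n$, the sides $M_{j-1}M_j$ and $M_jM_{j+1}$ are the two tangent lines to $D$ through $M_j$, counted with multiplicity (they coincide iff $M_j\in D$). It is non-isotropic if none of its sides is isotropic. With $c=\sqrt{a^2-b^2}$, the real foci of $\mathcal{E}$ are $(\pm c,0)$ and the complex foci are $(0,\pm ic)$. The two foci lines are the line through the real foci and the line through the complex foci. An orbit is flat if all its sides coincide with one of the two foci lines. *)

theory Defs
  imports "HOL-Analysis.Analysis" "HOL-Computational_Algebra.Polynomial"
    "HOL-Library.Multiset"
begin

section \<open>The complex projective plane\<close>

definition proportional :: "complex^3 \<Rightarrow> complex^3 \<Rightarrow> bool" where
  "proportional v w \<longleftrightarrow> v \<noteq> 0 \<and> w \<noteq> 0 \<and> (\<exists>k. k \<noteq> 0 \<and> v = k *s w)"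

lemma part_equivp_proportional: "part_equivp proportional"
proof (rule part_equivpI)
  have "proportional (axis 1 1) (axis 1 1)"
    unfolding proportional_def by (auto intro!: exI[of _ 1])
  then show "\<exists>x. proportional x x" ..
  show "symp proportional"
  proof (rule sympI)
    fix v w assume "proportional v w"
    then obtain k where "v \<noteq> 0" "w \<noteq> 0" "k \<noteq> 0" "v = k *s w"
      unfolding proportional_def by auto
    then show "proportional w v"
      unfolding proportional_def by (auto intro!: exI[of _ "1/k"] simp: vec_eq_iff)
  qed
  show "transp proportional"
  proof (rule transpI)
    fix u v w assume "proportional u v" "proportional v w"
    then obtain k l where "u \<noteq> 0" "w \<noteq> 0" "k \<noteq> 0" "u = k *s v" "l \<noteq> 0" "v = l *s w"
      unfolding proportional_def by auto
    then show "proportional u w"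
      unfolding proportional_def by (auto intro!: exI[of _ "k * l"] simp: vec_eq_iff)
  qed
qed

quotient_type cp2 = "complex^3" / partial: proportional
  by (rule part_equivp_proportional)

text \<open>The affine plane of pairs \<open>(x, y)\<close> sits in the projective plane as the points \<open>(x : y : 1)\<close>.
  In what follows \<open>rep_cp2 P\<close> is some vector of homogeneous coordinates of \<open>P\<close>; every
  definition using it is homogeneous, so that the choice is immaterial.\<close>

definition hpoint :: "complex \<Rightarrow> complex \<Rightarrow> complex \<Rightarrow> cp2" where
  "hpoint x y z = abs_cp2 (vector [x, y, z])"

definition affine_point :: "complex^2 \<Rightarrow> cp2" where
  "affine_point v = hpoint (v$1) (v$2) 1"

text \<open>The complex bilinear (not hermitian) pairing.\<close>

definition dot :: "complex^'n \<Rightarrow> complex^'n \<Rightarrow> complex" where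
  "dot u v = (\<Sum>i\<in>UNIV. u$i * v$i)"

definition proj_line :: "complex^3 \<Rightarrow> cp2 set" where
  "proj_line u = {P. dot u (rep_cp2 P) = 0}"

definition lines :: "cp2 set set" where
  "lines = {proj_line u |u. u \<noteq> 0}"

definition line_through :: "cp2 \<Rightarrow> cp2 \<Rightarrow> cp2 set" where
  "line_through P Q = (THE L. L \<in> lines \<and> P \<in> L \<and> Q \<in> L)"


section \<open>Conics\<close>

text \<open>A conic is given by the symmetric matrix \<open>A\<close> of its homogeneous equation; it is smooth iff
  \<open>A\<close> is invertible.\<close>

definition conic_curve :: "complex^3^3 \<Rightarrow> cp2 set" where
  "conic_curve A = {P. dot (rep_cp2 P) (A *v rep_cp2 P) = 0}"

definition tangent_line :: "complex^3^3 \<Rightarrow> cp2 \<Rightarrow> cp2 set" where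
  "tangent_line A P = proj_line (A *v rep_cp2 P)"

definition tangent_lines :: "complex^3^3 \<Rightarrow> cp2 set set" where
  "tangent_lines A = tangent_line A ` conic_curve A"

text \<open>Intersection multiplicity at \<open>P\<close> of the line \<open>L\<close> with the conic: the order of vanishing at
  \<open>t = 0\<close> of the equation of the conic along the parametrization \<open>p + t r\<close> of \<open>L\<close>, where \<open>p\<close>
  represents \<open>P\<close> and \<open>r\<close> represents another point of \<open>L\<close>, whose choice is immaterial.\<close>

definition intersection_mult :: "complex^3^3 \<Rightarrow> cp2 set \<Rightarrow> cp2 \<Rightarrow> nat" where
  "intersection_mult A L P =
    (if P \<in> L then
       let p = rep_cp2 P; r = rep_cp2 (SOME R. R \<in> L \<and> R \<noteq> P)
       in order 0 [: dot p (A *v p), dot p (A *v r) + dot r (A *v p), dot r (A *v r) :]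
     else 0)"

text \<open>Multiplicity of \<open>L\<close> among the two tangent lines through \<open>P\<close> to a smooth conic: these two
  lines merge into one exactly when \<open>P\<close> lies on the conic.\<close>

definition tangent_mult :: "complex^3^3 \<Rightarrow> cp2 \<Rightarrow> cp2 set \<Rightarrow> nat" where
  "tangent_mult D P L =
    (if L \<in> tangent_lines D \<and> P \<in> L then (if P \<in> conic_curve D then 2 else 1) else 0)"

definition diag3 :: "complex \<Rightarrow> complex \<Rightarrow> complex \<Rightarrow> complex^3^3" where
  "diag3 x y z = vector [vector [x, 0, 0], vector [0, y, 0], vector [0, 0, z]]"

definition ellipse :: "real \<Rightarrow> real \<Rightarrow> complex^3^3" where
  "ellipse a b = diag3 (1 / (of_real a)^2) (1 / (of_real b)^2) (-1)"

definition confocal :: "real \<Rightarrow> real \<Rightarrow> complex \<Rightarrow> complex^3^3" where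
  "confocal a b lam = diag3 (1 / ((of_real a)^2 + lam)) (1 / ((of_real b)^2 + lam)) (-1)"


section \<open>Polygons\<close>

text \<open>Families indexed by the integers modulo \<open>n\<close> are \<open>n\<close>-periodic families indexed by the
  integers.\<close>

definition cyclic :: "nat \<Rightarrow> (int \<Rightarrow> 'a) \<Rightarrow> bool" where
  "cyclic n f \<longleftrightarrow> (\<forall>j. f (j + int n) = f j)"

definition circumscribed :: "complex^3^3 \<Rightarrow> (int \<Rightarrow> cp2) \<Rightarrow> (int \<Rightarrow> cp2 set) \<Rightarrow> bool" where
  "circumscribed D M l \<longleftrightarrow>
    (\<forall>j t. tangent_mult D (M j) t = count {# l (j - 1), l j #} t)"

definition poncelet_polygon ::
    "complex^3^3 \<Rightarrow> complex^3^3 \<Rightarrow> nat \<Rightarrow> (int \<Rightarrow> cp2) \<Rightarrow> (int \<Rightarrow> cp2 set) \<Rightarrow> bool" where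
  "poncelet_polygon A D n M l \<longleftrightarrow>
    cyclic n M \<and> cyclic n l \<and>
    (\<forall>j. M j \<in> conic_curve A \<and> l j \<in> lines) \<and>
    (\<forall>j P. intersection_mult A (l j) P = count {# M j, M (j + 1) #} P) \<and>
    circumscribed D M l"


section \<open>Complex reflections\<close>

definition isotropic :: "cp2 set \<Rightarrow> bool" where
  "isotropic L \<longleftrightarrow> hpoint 1 \<i> 0 \<in> L \<or> hpoint 1 (-\<i>) 0 \<in> L"

definition projective_map :: "complex^3^3 \<Rightarrow> cp2 \<Rightarrow> cp2" where
  "projective_map H P = abs_cp2 (H *v rep_cp2 P)"

text \<open>The matrix of the projective extension of the affine map \<open>v \<mapsto> B v + t\<close>.\<close>

definition affine_matrix :: "complex^2^2 \<Rightarrow> complex^2 \<Rightarrow> complex^3^3" where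
  "affine_matrix B t =
    vector [vector [B$1$1, B$1$2, t$1],
            vector [B$2$1, B$2$2, t$2],
            vector [0, 0, 1]]"

text \<open>Here \<open>dot v v\<close> is the quadratic form \<open>q\<close>.\<close>

definition symmetry_wrt :: "cp2 set \<Rightarrow> (cp2 \<Rightarrow> cp2) \<Rightarrow> bool" where
  "symmetry_wrt L s \<longleftrightarrow>
    (\<exists>B t. let f = (\<lambda>v. B *v v + t) in
       f \<circ> f = id \<and> f \<noteq> id \<and>
       (\<forall>v w. dot (f v - f w) (f v - f w) = dot (v - w) (v - w)) \<and>
       (\<forall>v. affine_point v \<in> L \<longrightarrow> f v = v) \<and>
       s = projective_map (affine_matrix B t))"

definition line_symmetry :: "cp2 set \<Rightarrow> cp2 \<Rightarrow> cp2" where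
  "line_symmetry L = (THE s. symmetry_wrt L s)"


section \<open>Billiard orbits\<close>

definition side :: "(int \<Rightarrow> cp2) \<Rightarrow> int \<Rightarrow> cp2 set" where
  "side M j = line_through (M j) (M (j + 1))"

definition nondegenerate_orbit :: "complex^3^3 \<Rightarrow> nat \<Rightarrow> (int \<Rightarrow> cp2) \<Rightarrow> bool" where
  "nondegenerate_orbit A n M \<longleftrightarrow>
    cyclic n M \<and>
    (\<forall>j. M j \<in> conic_curve A \<and> M j \<noteq> M (j + 1) \<and>
         \<not> isotropic (tangent_line A (M j)) \<and>
         line_symmetry (tangent_line A (M j)) ` side M (j - 1) = side M j)"

definition non_isotropic_orbit :: "(int \<Rightarrow> cp2) \<Rightarrow> bool" where
  "non_isotropic_orbit M \<longleftrightarrow> (\<forall>j. \<not> isotropic (side M j))"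

definition focal_distance :: "real \<Rightarrow> real \<Rightarrow> complex" where
  "focal_distance a b = of_real (sqrt (a^2 - b^2))"

definition real_foci :: "real \<Rightarrow> real \<Rightarrow> cp2 set" where
  "real_foci a b = {hpoint (focal_distance a b) 0 1, hpoint (- focal_distance a b) 0 1}"

definition complex_foci :: "real \<Rightarrow> real \<Rightarrow> cp2 set" where
  "complex_foci a b =
    {hpoint 0 (\<i> * focal_distance a b) 1, hpoint 0 (- \<i> * focal_distance a b) 1}"

definition foci_lines :: "real \<Rightarrow> real \<Rightarrow> cp2 set set" where
  "foci_lines a b = {L \<in> lines. real_foci a b \<subseteq> L \<or> complex_foci a b \<subseteq> L}"

definition flat_orbit :: "real \<Rightarrow> real \<Rightarrow> (int \<Rightarrow> cp2) \<Rightarrow> bool" where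
  "flat_orbit a b M \<longleftrightarrow> (\<exists>F\<in>foci_lines a b. \<forall>j. side M j = F)"

end

(*
Parametrize the ellipse by the projective line. A chord with end points v, w is tangent to a confocal
conic iff F(v, w) = 0 for a symmetric biquadratic form F, so polygons circumscribed about the conic
are the sequences in which F(v_i, .) has zeros v_(i-1) and v_(i+1). The tangent line and the normal at
a vertex diagonalize all confocal dual forms simultaneously, hence the reflection permutes the two
tangents to each confocal conic; billiard orbits are therefore exactly such sequences, with the
exceptional parameters 0, -a^2, -b^2 corresponding to degenerate edges and to lines through foci.

Porism: for two sequences v, z the brackets g_ij = [v_i, z_j] satisfy the multiplicative wave equation
g_(i+1)j g_(i-1)j = g_i(j+1) g_i(j-1) up to factors depending on i or on j only, because both sides are
F(v_i, z_j). Periodicity in i then forces periodicity in j.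

Counting: on the elliptic curve y^2 = f(t) = (1 + t)(1 + A t)(1 + B t), with A and B affine in the
parameter, a step of the sequence is the translation by T = (0, 1). Multiplying the lines through
consecutive points yields p, q with p^2 - q^2 f = c t^n for a closed sequence, i.e. p + q sqrt f
vanishes to order n at t = 0. This makes a Toeplitz determinant in the Taylor coefficients of sqrt f
vanish (Cayley's condition). The determinant is a polynomial in the parameter of the required degree;
it is not zero at the parameter 0, where f = (1 + t)^3.
*)

theory Submission
  imports Defs "HOL-Computational_Algebra.Polynomial_FPS" "Jordan_Normal_Form.Determinant"
begin

hide_const (open) Module.smult
no_notation Matrix.vec_index (infixl "$" 100)

section \<open>Orbits of a symmetric biquadratic form\<close>


text \<open>Working with homogeneous pairs and the bracket \<open>br\<close> treats points at
  infinity and tangencies uniformly: multiplicity becomes divisibility of a binary quadratic form.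
  The passage to the cubic, however, needs an affine coordinate that avoids finitely many values,
  and a given closed orbit may hit them (some of the quadrilaterals used below have vertices at
  infinity). The porism removes this obstacle: \<open>closes\<close> asks for a closed orbit through
  every point, so one avoiding the bad points can be chosen. The proof of the porism in turn needs
  two independent points two steps apart, which is lost if an orbit goes back and forth between two
  points; tangency to a smooth conic excludes this. The determinant gives only an upper bound, since
  its vanishing is shown to be necessary for closing. For n = 3 and n = 4 the converse comes from
  explicit symmetric polygons, from which the porism spreads closing to all starting points. The
  parameter 0 is not among those sought; it serves as the one place where the determinant can be
  evaluated against zero.\<close>

definition br :: "complex \<times> complex \<Rightarrow> complex \<times> complex \<Rightarrow> complex" where
  "br x y = fst x * snd y - snd x * fst y"

lemma br_self [simp]: "br x x = 0"
  by (simp add: br_def)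

lemma br_swap: "br y x = - br x y"
  by (simp add: br_def algebra_simps)

lemma br_zero_iff:
  assumes "x \<noteq> 0" "y \<noteq> 0"
  shows "br x y = 0 \<longleftrightarrow> (\<exists>c. c \<noteq> 0 \<and> y = (c * fst x, c * snd x))"
proof
  assume br: "br x y = 0"
  show "\<exists>c. c \<noteq> 0 \<and> y = (c * fst x, c * snd x)"
  proof (cases "fst x = 0")
    case True
    then have "snd x \<noteq> 0" using assms(1) by (simp add: prod_eq_iff)
    with True br have "fst y = 0" by (simp add: br_def)
    then have "snd y \<noteq> 0" using assms(2) by (simp add: prod_eq_iff)
    then show ?thesis using True \<open>fst y = 0\<close> \<open>snd x \<noteq> 0\<close>
      by (intro exI[of _ "snd y / snd x"]) (auto simp: prod_eq_iff)
  next
    case False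
    then have s: "snd y = snd x * fst y / fst x" using br by (simp add: br_def field_simps)
    then have "fst y \<noteq> 0" using assms(2) by (auto simp: prod_eq_iff)
    then show ?thesis using False s
      by (intro exI[of _ "fst y / fst x"]) (auto simp: prod_eq_iff)
  qed
next
  assume "\<exists>c. c \<noteq> 0 \<and> y = (c * fst x, c * snd x)"
  then show "br x y = 0" by (auto simp: br_def)
qed

lemma br_zero_trans:
  assumes "y \<noteq> 0" "br x y = 0" "br y z = 0"
  shows "br x z = 0"
proof -
  have "br x z * fst y = br x y * fst z + br y z * fst x"
       "br x z * snd y = br x y * snd z + br y z * snd x"
    by (simp_all add: br_def algebra_simps)
  then have "br x z * fst y = 0" "br x z * snd y = 0" using assms by simp_all
  moreover have "fst y \<noteq> 0 \<or> snd y \<noteq> 0" using assms(1) by (simp add: prod_eq_iff)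
  ultimately show ?thesis by auto
qed

definition qform :: "(complex \<times> complex \<Rightarrow> complex) \<Rightarrow> bool" where
  "qform f \<longleftrightarrow> (\<exists>a b c. \<forall>y. f y = a * fst y ^ 2 + b * fst y * snd y + c * snd y ^ 2)"

text \<open>The cofactor of the linear factor is linear, hence itself a bracket with some vector
  \<open>m\<close>, which is the other zero unless the whole form vanishes.\<close>

lemma qform_factor:
  assumes "qform f" "x \<noteq> 0" "f x = 0"
  shows "\<exists>m. \<forall>y. f y = br x y * br m y"
proof -
  obtain a b c where f: "\<And>y. f y = a * fst y ^ 2 + b * fst y * snd y + c * snd y ^ 2"
    using assms(1) unfolding qform_def by blast
  have 0: "a * fst x ^ 2 + b * fst x * snd x + c * snd x ^ 2 = 0" using f assms(3) by metis
  show ?thesis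
  proof (cases "fst x = 0")
    case True
    then have "snd x \<noteq> 0" using assms(2) by (simp add: prod_eq_iff)
    then have "c = 0" using 0 True by simp
    then show ?thesis using True \<open>snd x \<noteq> 0\<close> f
      by (intro exI[of _ "(b / - snd x, a / snd x)"]) (auto simp: br_def power2_eq_square field_simps)
  next
    case False
    have "f y = br x y * br (c / fst x, - (b + c * snd x / fst x) / fst x) y" for y
      using False 0 unfolding f br_def
      by (simp add: field_simps power2_eq_square) Groebner_Basis.algebra
    then show ?thesis by blast
  qed
qed

lemma qform_has_root:
  assumes "qform f"
  shows "\<exists>x. x \<noteq> 0 \<and> f x = 0"
proof -
  obtain a b c where f: "\<And>y. f y = a * fst y ^ 2 + b * fst y * snd y + c * snd y ^ 2"
    using assms(1) unfolding qform_def by blast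
  show ?thesis
  proof (cases "a = 0")
    case True
    then show ?thesis using f by (intro exI[of _ "(1, 0)"]) (auto simp: prod_eq_iff)
  next
    case False
    define s where "s = csqrt (b^2 - 4 * a * c)"
    have s: "s ^ 2 = b^2 - 4 * a * c" by (simp add: s_def)
    have "f (s - b, 2 * a) = a * (s^2 - (b^2 - 4 * a * c))"
      unfolding f by (simp add: power2_eq_square algebra_simps)
    then show ?thesis using s False by (intro exI[of _ "(s - b, 2 * a)"]) (auto simp: prod_eq_iff)
  qed
qed

text \<open>Elements of \<open>complex \<times> complex\<close> are homogeneous coordinates of points of a projective line, and
  a biquadratic form \<open>F\<close> relates each point to the two zeros of \<open>F v\<close>.\<close>

definition orbit :: "(complex \<times> complex \<Rightarrow> complex \<times> complex \<Rightarrow> complex) \<Rightarrow> (int \<Rightarrow> complex \<times> complex) \<Rightarrow> bool"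
  where "orbit F v \<longleftrightarrow>
    (\<forall>i. v i \<noteq> 0 \<and> (\<exists>\<kappa>. \<kappa> \<noteq> 0 \<and> (\<forall>y. F (v i) y = \<kappa> * br (v (i + 1)) y * br (v (i - 1)) y)))"

lemma periodic_orbit_intro:
  assumes n: "0 < n" and nz: "\<And>i. i < n \<Longrightarrow> u i \<noteq> 0"
    and F: "\<And>i. i < n \<Longrightarrow> \<exists>\<kappa>. \<kappa> \<noteq> 0 \<and> (\<forall>y. F (u i) y = \<kappa> * br (u (Suc i mod n)) y * br (u ((i + n - 1) mod n)) y)"
  shows "\<exists>v. cyclic n v \<and> orbit F v \<and> (\<forall>i<n. v (int i) = u i)"
proof (intro exI conjI)
  define v where "v = (\<lambda>j. u (nat (j mod int n)))"
  show "cyclic n v" by (simp add: cyclic_def v_def)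
  show "\<forall>i<n. v (int i) = u i" by (simp add: v_def)
  show "orbit F v"
    unfolding orbit_def
  proof (intro allI conjI)
    fix j
    define r where "r = nat (j mod int n)"
    have r: "j mod int n = int r" "r < n" using n by (simp_all add: r_def nat_less_iff)
    have "(j + 1) mod int n = (int r + 1) mod int n" unfolding r(1)[symmetric] by (simp add: mod_add_left_eq)
    also have "\<dots> = int (Suc r mod n)" by (simp add: zmod_int add.commute)
    finally have 1: "v (j + 1) = u (Suc r mod n)" by (simp only: v_def nat_int)
    have "(j - 1) mod int n = (int r - 1) mod int n" unfolding r(1)[symmetric] by (simp add: mod_diff_left_eq)
    also have "\<dots> = (int r - 1 + int n) mod int n" by simp
    also have "int r - 1 + int n = int (r + n - 1)" using n by simp
    also have "int (r + n - 1) mod int n = int ((r + n - 1) mod n)" by (simp only: zmod_int)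
    finally have 2: "v (j - 1) = u ((r + n - 1) mod n)" by (simp only: v_def nat_int)
    have 3: "v j = u r" by (simp add: v_def r)
    show "v j \<noteq> 0" unfolding 3 using nz r by blast
    show "\<exists>\<kappa>. \<kappa> \<noteq> 0 \<and> (\<forall>y. F (v j) y = \<kappa> * br (v (j + 1)) y * br (v (j - 1)) y)"
      unfolding 1 2 3 by (rule F[OF r(2)])
  qed
qed

text \<open>The last assumption excludes points related to everything, so each point has exactly two
  neighbours, counted with multiplicity.\<close>

locale biquadratic =
  fixes F :: "complex \<times> complex \<Rightarrow> complex \<times> complex \<Rightarrow> complex"
  assumes sym: "F x y = F y x"
    and qform: "qform (F x)"
    and nonzero: "x \<noteq> 0 \<Longrightarrow> \<exists>y. F x y \<noteq> 0"
begin

declare split_paired_All [simp del] split_paired_Ex [simp del]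

lemma orbit_root:
  assumes "orbit F v"
  shows "F (v i) y = 0 \<longleftrightarrow> br (v (i + 1)) y = 0 \<or> br (v (i - 1)) y = 0"
  using assms unfolding orbit_def by (metis mult_eq_0_iff)

lemma orbit_adjacent:
  assumes "orbit F v"
  shows "F (v i) (v (i + 1)) = 0" "F (v (i + 1)) (v i) = 0"
  using orbit_root[OF assms, of i "v (i + 1)"] sym by auto

lemma F_homogeneous:
  "F x (c * fst y, c * snd y) = c^2 * F x y"
proof -
  obtain p q r where f: "\<And>y. F x y = p * fst y ^ 2 + q * fst y * snd y + r * snd y ^ 2"
    using qform[of x] unfolding qform_def by blast
  show ?thesis unfolding f by (simp add: power2_eq_square algebra_simps)
qed

lemma F_zero_prop:
  assumes "x \<noteq> 0" "y \<noteq> 0" "br x y = 0"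
  shows "F x z = 0 \<longleftrightarrow> F y z = 0"
proof -
  obtain c where "c \<noteq> 0" "y = (c * fst x, c * snd x)"
    using br_zero_iff[OF assms(1,2)] assms(3) by blast
  then show ?thesis using F_homogeneous[of z c x] by (simp add: sym)
qed

text \<open>An orbit contains both zeros of each of its forms, so a step of the relation cannot
  leave it. By symmetry it cannot be entered from outside either.\<close>

lemma orbit_closed_under_F:
  assumes "orbit F v" "x \<noteq> 0" "y \<noteq> 0" "F x y = 0" "br (v i) x = 0"
  shows "\<exists>j. br (v j) y = 0"
proof -
  have "v i \<noteq> 0" using assms(1) by (auto simp: orbit_def)
  then have "F (v i) y = 0" using F_zero_prop assms by blast
  then show ?thesis using orbit_root[OF assms(1)] by blast
qed

lemma factor_at_root:
  assumes "x \<noteq> 0" "y \<noteq> 0" "F x y = 0"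
  shows "\<exists>m. m \<noteq> 0 \<and> (\<forall>u. F x u = br m u * br y u)"
proof -
  obtain m where m: "\<And>u. F x u = br y u * br m u"
    using qform_factor[OF qform assms(2,3)] by blast
  moreover have "m \<noteq> 0" using m nonzero[OF assms(1)] by (auto simp: br_def)
  ultimately show ?thesis by (metis mult.commute)
qed

lemma forward_orbit:
  assumes "p \<noteq> 0"
  shows "\<exists>z :: nat \<Rightarrow> complex \<times> complex. z 1 = p \<and> (\<forall>j. z j \<noteq> 0) \<and>
    (\<forall>j y. F (z (Suc j)) y = br (z (Suc (Suc j))) y * br (z j) y)"
proof -
  obtain x where x: "x \<noteq> 0" "F p x = 0" using qform_has_root[OF qform] by blast
  \<comment> \<open>The state is the pair (previous, current). The next point is the cofactor left
    after splitting off the previous one, which normalizes the factor \<open>\<kappa>\<close> of an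
    orbit to 1.\<close>
  define step where "step = (\<lambda>(a, b). (b, SOME m. m \<noteq> 0 \<and> (\<forall>u. F b u = br m u * br a u)))"
  define s where "s = (\<lambda>j. (step ^^ j) (x, p))"
  have s0: "s 0 = (x, p)" and sS: "\<And>j. s (Suc j) = step (s j)" by (simp_all add: s_def)
  define good where "good = (\<lambda>(a, b). a \<noteq> 0 \<and> b \<noteq> 0 \<and> F b a = 0)"
  have step: "good (step t) \<and> fst (step t) = snd t \<and>
      (\<forall>u. F (snd t) u = br (snd (step t)) u * br (fst t) u)" if "good t" for t
  proof -
    obtain a b where t: "t = (a, b)" by (cases t)
    define m where "m = (SOME m. m \<noteq> 0 \<and> (\<forall>u. F b u = br m u * br a u))"
    have ab: "a \<noteq> 0" "b \<noteq> 0" "F b a = 0" using that by (simp_all add: t good_def)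
    have m: "m \<noteq> 0 \<and> (\<forall>u. F b u = br m u * br a u)"
      unfolding m_def by (rule someI_ex) (rule factor_at_root[OF ab(2,1,3)])
    then have "F b m = 0" by (metis br_self mult_zero_left)
    then have "F m b = 0" using sym by metis
    moreover have "step t = (b, m)" by (simp add: t step_def m_def)
    ultimately show ?thesis using m ab by (simp add: t good_def)
  qed
  have good: "good (s j)" for j
  proof (induction j)
    case 0
    then show ?case using x assms by (simp add: s0 good_def)
  next
    case (Suc j)
    then show ?case using step sS by simp
  qed
  have nxt: "fst (s (Suc j)) = snd (s j)" for j using step[OF good[of j]] sS by simp
  show ?thesis
  proof (intro exI[of _ "\<lambda>j. fst (s j)"] conjI allI)
    show "fst (s 1) = p" using nxt[of 0] by (simp add: s0)
    show "fst (s j) \<noteq> 0" for j using good[of j] by (auto simp: good_def)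
    show "F (fst (s (Suc j))) y = br (fst (s (Suc (Suc j)))) y * br (fst (s j)) y" for j y
      using step[OF good[of j]] nxt[of "Suc j"] nxt[of j] sS[of j] by simp
  qed
qed


lemma br_proportional:
  assumes "x \<noteq> 0" "y \<noteq> 0" "br x y = 0"
  obtains c where "c \<noteq> 0" "\<And>u. br x u = c * br y u"
proof -
  have "br y x = 0" using assms(3) br_swap[of y x] by simp
  then obtain c where "c \<noteq> 0" "x = (c * fst y, c * snd y)" using br_zero_iff assms(1,2) by blast
  then show thesis using that[of c] by (simp add: br_def algebra_simps)
qed

lemma orbit_of_periodic_sequence:
  fixes z :: "nat \<Rightarrow> complex \<times> complex"
  assumes n: "0 < n" and nz: "\<And>j. z j \<noteq> 0"
    and F: "\<And>j y. F (z (Suc j)) y = br (z (Suc (Suc j))) y * br (z j) y"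
    and per: "\<And>j. br (z (Suc j)) (z (Suc j + n)) = 0"
  shows "\<exists>v. cyclic n v \<and> orbit F v \<and> (\<exists>i. br (v i) (z 1) = 0)"
proof -
  \<comment> \<open>Starting the window at index 2 keeps its two outer neighbours \<open>z 1\<close>
    and \<open>z (2 + n)\<close> within reach of \<open>per\<close>; they match
    \<open>z (1 + n)\<close> and \<open>z 2\<close> up to scalars.\<close>
  define u where "u i = z (2 + i)" for i
  obtain c where c: "c \<noteq> 0" "\<And>y. br (z (2 + n)) y = c * br (z 2) y"
    using br_proportional[of "z (2 + n)" "z 2"] nz per[of 1] br_swap[of "z 2"]
    by (metis Suc_1 neg_equal_0_iff_equal)
  obtain d where d: "d \<noteq> 0" "\<And>y. br (z 1) y = d * br (z (1 + n)) y"
    using br_proportional[of "z 1" "z (1 + n)"] nz per[of 0] by (metis One_nat_def)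
  have step: "\<exists>\<kappa>. \<kappa> \<noteq> 0 \<and> (\<forall>y. F (u i) y = \<kappa> * br (u (Suc i mod n)) y * br (u ((i + n - 1) mod n)) y)"
    if i: "i < n" for i
  proof -
    have "\<exists>e. e \<noteq> 0 \<and> (\<forall>y. br (z (3 + i)) y = e * br (u (Suc i mod n)) y)"
    proof (cases "Suc i = n")
      case True
      then have "3 + i = 2 + n" "u (Suc i mod n) = z 2" by (simp_all add: u_def)
      then show ?thesis using c by metis
    next
      case False
      then show ?thesis using i by (intro exI[of _ 1]) (simp add: u_def numeral_3_eq_3)
    qed
    moreover have "\<exists>e. e \<noteq> 0 \<and> (\<forall>y. br (z (1 + i)) y = e * br (u ((i + n - 1) mod n)) y)"
    proof (cases i)
      case 0
      then have "1 + i = 1" "u ((i + n - 1) mod n) = z (1 + n)" using n by (simp_all add: u_def)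
      then show ?thesis using d by metis
    next
      case (Suc m)
      then show ?thesis using i by (intro exI[of _ 1]) (simp add: u_def)
    qed
    moreover have "F (u i) y = br (z (3 + i)) y * br (z (1 + i)) y" for y
      using F[of "1 + i" y] by (simp add: u_def numeral_3_eq_3)
    ultimately show ?thesis by (elim exE conjE, intro exI[of _ "_ * _"] conjI no_zero_divisors) (assumption, assumption, simp)
  qed
  obtain v where v: "cyclic n v" "orbit F v" "\<forall>i<n. v (int i) = u i"
    using periodic_orbit_intro[OF n _ step] nz unfolding u_def by blast
  have "v (int (n - 1)) = u (n - 1)" using v(3) diff_less[OF _ n, of 1] by (metis less_one)
  also have "\<dots> = z (Suc 0 + n)" using n by (simp add: u_def)
  finally have "br (v (int (n - 1))) (z 1) = 0" using per[of 0] br_swap[of "z 1"] by simp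
  then show ?thesis using v by blast
qed

text \<open>With \<open>g i j = br (v i) (z j)\<close>, evaluating \<open>F (v i) (z j)\<close> along either orbit gives a discrete
  wave equation for \<open>g\<close>, so \<open>g (i + 1) j / g i (j + 1)\<close> and \<open>g (i + 1) j / g i (j - 1)\<close> are
  transported along the two families of diagonals, and periodicity of \<open>g\<close> in \<open>i\<close> yields
  periodicity in \<open>j\<close>.\<close>

lemma porism:
  assumes cyc: "cyclic n v" and orb: "orbit F v" and n: "0 < n"
    and indep: "br (v i0) (v (i0 + 2)) \<noteq> 0" and p: "p \<noteq> 0"
  shows "\<exists>z. cyclic n z \<and> orbit F z \<and> (\<exists>i. br (z i) p = 0)"
proof (cases "\<exists>i. br (v i) p = 0")
  case True
  then show ?thesis using cyc orb by blast
next
  case False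
  obtain z :: "nat \<Rightarrow> complex \<times> complex" where z1: "z 1 = p" and nz: "\<And>j. z j \<noteq> 0"
    and Fz: "\<And>j y. F (z (Suc j)) y = br (z (Suc (Suc j))) y * br (z j) y"
    using forward_orbit[OF p] by blast
  define g where "g = (\<lambda>i j. br (v i) (z j))"
  have Suc0: "F (z (Suc j)) (z j) = 0" "F (z (Suc j)) (z (Suc (Suc j))) = 0" for j
    using Fz by simp_all
  \<comment> \<open>A sequence that starts outside the orbit \<open>v\<close> stays outside, so all
    quotients of values of \<open>g\<close> below make sense.\<close>
  have step: "g i (Suc j) \<noteq> 0" if "\<And>i. g i j \<noteq> 0" for i j
    using orbit_closed_under_F[OF orb nz nz Suc0(1)[of j]] that by (auto simp: g_def)
  have g1: "g i (Suc 0) \<noteq> 0" for i using False z1 by (simp add: g_def)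
  have g0: "g i 0 \<noteq> 0" for i
    using orbit_closed_under_F[OF orb nz nz, of 0 1] Suc0(1)[of 0] g1 sym by (auto simp: g_def)
  have g: "g i j \<noteq> 0" for i j
    by (induction j arbitrary: i) (use g0 step in blast)+
  have g_per: "g (i + int n) j = g i j" for i j
    using cyc by (simp add: g_def cyclic_def)
  \<comment> \<open>The choice depends only on \<open>v (i - 1)\<close>, \<open>v i\<close> and
    \<open>v (i + 1)\<close>, so it inherits the period of \<open>v\<close>.\<close>
  define \<kappa> where "\<kappa> = (\<lambda>i. SOME c. c \<noteq> 0 \<and> (\<forall>y. F (v i) y = c * br (v (i + 1)) y * br (v (i - 1)) y))"
  have \<kappa>: "\<kappa> i \<noteq> 0 \<and> (\<forall>y. F (v i) y = \<kappa> i * br (v (i + 1)) y * br (v (i - 1)) y)" for i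
    unfolding \<kappa>_def by (rule someI_ex) (use orb in \<open>auto simp: orbit_def\<close>)
  have shift: "v (i + int n + 1) = v (i + 1)" "v (i + int n - 1) = v (i - 1)" "v (i + int n) = v i" for i
    using cyc unfolding cyclic_def by (metis add.assoc add.commute, metis diff_add_eq, simp)
  have \<kappa>_per: "\<kappa> (i + int n) = \<kappa> i" for i
    unfolding \<kappa>_def shift ..
  have wave: "\<kappa> i * g (i + 1) (Suc j) * g (i - 1) (Suc j) = g i (Suc (Suc j)) * g i j" for i j
  proof -
    have "\<kappa> i * g (i + 1) (Suc j) * g (i - 1) (Suc j) = F (z (Suc j)) (v i)"
      using \<kappa>[of i] sym[of "z (Suc j)" "v i"] by (simp add: g_def)
    also have "\<dots> = g i (Suc (Suc j)) * g i j"
      unfolding Fz g_def by (simp add: br_swap[of _ "v i"])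
    finally show ?thesis .
  qed
  define P where "P = (\<lambda>i. \<Prod>m<n. \<kappa> (i + int m))"
  have P_Suc: "P (i + 1) = P i" for i
  proof -
    have "P i * \<kappa> (i + int n) = (\<Prod>m<Suc n. \<kappa> (i + int m))" by (simp add: P_def)
    also have "\<dots> = \<kappa> i * P (i + 1)"
      unfolding P_def prod.lessThan_Suc_shift by (simp add: algebra_simps)
    finally show ?thesis using \<kappa>[of i] \<kappa>_per[of i] by simp
  qed
  have P_const: "P i = P 0" for i
  proof (induction i rule: int_induct[where k = 0])
    case base
    show ?case ..
  next
    case (step1 i)
    then show ?case using P_Suc by simp
  next
    case (step2 i)
    then show ?case using P_Suc[of "i - 1"] by simp
  qed
  \<comment> \<open>Each step along a diagonal costs one factor \<open>\<kappa>\<close>. After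
    \<open>n\<close> steps these factors form the product over a full period, which does not depend
    on the starting index.\<close>
  have diag1: "g (i + 1) j / g i (Suc j) =
      (\<Prod>m<l. \<kappa> (i + 1 + int m)) * (g (i + int l + 1) (j + l) / g (i + int l) (Suc (j + l)))" for i j l
  proof (induction l)
    case (Suc l)
    have "g (i + int l + 1) (j + l) / g (i + int l) (Suc (j + l)) =
      \<kappa> (i + 1 + int l) * (g (i + int l + 1 + 1) (Suc (j + l)) / g (i + int l + 1) (Suc (Suc (j + l))))"
      using wave[of "i + int l + 1" "j + l"] g
      by (simp add: field_simps)
    then show ?case using Suc by (simp add: algebra_simps)
  qed simp
  have diag2: "g (i - int l + 1) (Suc j + l) / g (i - int l) (j + l) =
      (\<Prod>m<l. \<kappa> (i - int m)) * (g (i + 1) (Suc j) / g i j)" for i j l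
  proof (induction l)
    case (Suc l)
    have "g (i - int l) (Suc (Suc j + l)) / g (i - int l - 1) (Suc (j + l)) =
      \<kappa> (i - int l) * (g (i - int l + 1) (Suc j + l) / g (i - int l) (j + l))"
      using wave[of "i - int l" "j + l"] g
      by (simp add: field_simps)
    also note Suc
    finally have "g (i - int l) (Suc (Suc j + l)) / g (i - int l - 1) (Suc (j + l)) =
      (\<Prod>m<Suc l. \<kappa> (i - int m)) * (g (i + 1) (Suc j) / g i j)" by simp
    then show ?case by (simp add: diff_diff_eq add.commute)
  qed simp
  have C1: "g i (Suc j + n) / g i (Suc j) = P 0 * (g (i + 1) (j + n) / g (i + 1) j)" for i j
  proof -
    have "(\<Prod>m<n. \<kappa> (i + 1 + int m)) = P 0" using P_const[of "i + 1"] by (simp add: P_def)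
    then show ?thesis using diag1[of i j n] g_per[of "i + 1" "j + n"] g_per[of i "Suc (j + n)"] g
      by (simp add: field_simps)
  qed
  have P_rev: "(\<Prod>m<n. \<kappa> (i - int m)) = P 0" for i
  proof -
    have "(\<Prod>m<n. \<kappa> (i - int m)) = (\<Prod>m<n. \<kappa> (i - int (n - Suc m)))"
      by (rule prod.nat_diff_reindex[symmetric])
    also have "\<dots> = P (i - int n + 1)"
      unfolding P_def by (intro prod.cong) (auto simp: of_nat_diff algebra_simps)
    finally show ?thesis using P_const by simp
  qed
  have C2: "g (i + 1) (Suc j + n) / g (i + 1) (Suc j) = P 0 * (g i (j + n) / g i j)" for i j
    using diag2[of i n j] P_rev[of i] g_per[of "i - int n + 1" "Suc j + n"] g_per[of "i - int n" "j + n"] g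
    by (simp add: field_simps)
  \<comment> \<open>For the quotient rho(i, j) = g i (j + n) / g i j, both rho(i, j + 1) and rho(i +
    2, j + 1) equal P 0 times rho(i + 1, j). The unknown constant cancels.\<close>
  have C: "g (i + 2) (Suc j + n) / g (i + 2) (Suc j) = g i (Suc j + n) / g i (Suc j)" for i j
    using C1[of i j] C2[of "i + 1" j] by (simp add: add.assoc)
  have "br (z (Suc j)) (z (Suc j + n)) = 0" for j
  proof -
    \<comment> \<open>The product rule for 2 by 2 determinants: the two vectors have proportional
      coordinates with respect to the independent points \<open>v i0\<close> and
      \<open>v (i0 + 2)\<close>, so they represent the same point.\<close>
    have "br (v i0) (v (i0 + 2)) * br (z (Suc j)) (z (Suc j + n)) =
       g i0 (Suc j) * g (i0 + 2) (Suc j + n) - g i0 (Suc j + n) * g (i0 + 2) (Suc j)"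
      unfolding g_def br_def by (simp add: algebra_simps)
    also have "\<dots> = 0" using C[of i0 j] g by (simp add: field_simps)
    finally show ?thesis using indep by simp
  qed
  from orbit_of_periodic_sequence[OF n nz Fz this] z1 show ?thesis by simp
qed

end

section \<open>Closed orbits and the Pell equation\<close>

text \<open>On the curve Y^2 = f(t) the equation says that p + q Y has norm c t^n. The condition at
  0 keeps p + q Y from vanishing at (0, -1), so the zero of order n sits at (0, 1). Since t and Y
  have poles of order 2 and 3 at infinity, the degree bounds say that the pole there has order at
  most n.\<close>

definition pell :: "complex poly \<Rightarrow> nat \<Rightarrow> complex poly \<Rightarrow> complex poly \<Rightarrow> bool" where
  "pell f n p q \<longleftrightarrow> (\<exists>c. p^2 - q^2 * f = smult c (monom 1 n)) \<and> poly p 0 \<noteq> poly q 0 \<and>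
     2 * degree p \<le> n \<and> (q \<noteq> 0 \<longrightarrow> 2 * degree q + 3 \<le> n)"

text \<open>This is the product of p + q Y and r + s Y. Norms multiply, and so do the values at (0,
  -1).\<close>

lemma pell_mult:
  assumes f: "degree f \<le> 3" "poly f 0 = 1"
    and 1: "pell f m p q" and 2: "pell f n r s"
  shows "pell f (m + n) (p * r + q * s * f) (p * s + q * r)"
proof -
  obtain c d where c: "p^2 - q^2 * f = smult c (monom 1 m)" and d: "r^2 - s^2 * f = smult d (monom 1 n)"
    using 1 2 by (auto simp: pell_def)
  have "(p * r + q * s * f)^2 - (p * s + q * r)^2 * f = (p^2 - q^2 * f) * (r^2 - s^2 * f)"
    by Groebner_Basis.algebra
  also have "\<dots> = smult (c * d) (monom 1 (m + n))"
    unfolding c d by (simp add: mult_monom mult.commute)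
  finally have norm: "(p * r + q * s * f)^2 - (p * s + q * r)^2 * f = smult (c * d) (monom 1 (m + n))" .
  have "poly (p * r + q * s * f) 0 - poly (p * s + q * r) 0 = (poly p 0 - poly q 0) * (poly r 0 - poly s 0)"
    using f by (simp add: algebra_simps)
  then have nz: "poly (p * r + q * s * f) 0 \<noteq> poly (p * s + q * r) 0"
    using 1 2 by (auto simp: pell_def)
  have dpr: "2 * degree (p * r) \<le> m + n"
    using degree_mult_le[of p r] 1 2 by (simp add: pell_def)
  have dqs: "2 * degree (q * s * f) \<le> m + n"
  proof (cases "q = 0 \<or> s = 0")
    case False
    then have "2 * degree q + 3 \<le> m" "2 * degree s + 3 \<le> n" using 1 2 by (simp_all add: pell_def)
    then show ?thesis using degree_mult_le[of "q * s" f] degree_mult_le[of q s] f(1) by linarith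
  qed auto
  have D: "2 * degree (p * r + q * s * f) \<le> m + n"
    using degree_add_le_max[of "p * r" "q * s * f"] dpr dqs by linarith
  have dps: "2 * degree (p * s) + 3 \<le> m + n" if "s \<noteq> 0"
    using degree_mult_le[of p s] 1 2 that by (simp add: pell_def)
  have dqr: "2 * degree (q * r) + 3 \<le> m + n" if "q \<noteq> 0"
    using degree_mult_le[of q r] 1 2 that by (simp add: pell_def)
  have E: "2 * degree (p * s + q * r) + 3 \<le> m + n" if "p * s + q * r \<noteq> 0"
  proof (cases "q = 0 \<or> s = 0")
    case True
    then show ?thesis using that dps dqr by auto
  next
    case False
    then show ?thesis using dps dqr degree_add_le_max[of "p * s" "q * r"] by linarith
  qed
  show ?thesis unfolding pell_def using norm nz D E by blast
qed

lemma pell_power: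
  assumes f: "degree f \<le> 3" "poly f 0 = 1" and 1: "pell f d p q"
  shows "\<exists>r s. pell f (Suc e * d) r s"
proof (induction e)
  case 0
  then show ?case using 1 by auto
next
  case (Suc e)
  then show ?case using pell_mult[OF f 1] by (metis mult_Suc)
qed

text \<open>\<open>rel\<close> is the biquadratic form in an affine coordinate,
  \<open>next_sum\<close> is Vieta's formula for its two zeros. The condition
  \<open>\<omega> j ^ 2 \<noteq> 1\<close> keeps \<open>t j\<close> away from 0, the next one keeps
  the equation for the neighbours quadratic, and the last two keep consecutive values of
  \<open>t\<close> apart.\<close>

locale poncelet_chain =
  fixes A B h k :: complex and \<omega> :: "nat \<Rightarrow> complex" and n :: nat and f :: "complex poly"
  assumes k_def: "k = A - B" and h_def: "h = A + B - 1"
    and A: "A \<noteq> 0" "A \<noteq> 1" and B: "B \<noteq> 0" "B \<noteq> 1"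
    and f_def: "f = [:1, 1:] * [:1, A:] * [:1, B:]"
    and rel: "1 - \<omega> j ^ 2 - \<omega> (Suc j) ^ 2 + 2 * h * \<omega> j * \<omega> (Suc j) + k^2 * \<omega> j ^ 2 * \<omega> (Suc j) ^ 2 = 0"
    and next_sum: "(\<omega> (Suc (Suc j)) + \<omega> j) * (1 - k^2 * \<omega> (Suc j) ^ 2) = 2 * h * \<omega> (Suc j)"
    and \<omega>: "\<omega> j \<noteq> 0" "\<omega> j ^ 2 \<noteq> 1" "1 - k^2 * \<omega> j ^ 2 \<noteq> 0" "\<omega> (Suc j) \<noteq> \<omega> j" "\<omega> (Suc j) \<noteq> - \<omega> j"
    and period: "\<omega> (j + n) = \<omega> j"
    and n: "0 < n"
begin

text \<open>The points \<open>(\<omega> j, W j)\<close> lie on a Jacobi quartic, on which passing from \<open>j\<close> to \<open>Suc j\<close> is a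
  translation; \<open>(t j, y j)\<close> is the same point on the cubic \<open>Y\<^sup>2 = f(t)\<close>, where the translation is
  by \<open>(0, 1)\<close>.\<close>

definition W where "W j = (1 - k^2 * \<omega> j ^ 2) * \<omega> (Suc j) - h * \<omega> j"
definition U where "U j = (W j + 1) / \<omega> j ^ 2"
definition t where "t j = (U j - h - 1) / (2 * A * B)"
definition y where "y j = \<omega> j * (U j ^ 2 - k^2) / (4 * A * B)"

lemma AB4: "4 * A * B = (h + 1)^2 - k^2"
  unfolding k_def h_def by (simp add: power2_eq_square algebra_simps)

lemma W_Suc: "W (Suc j) = h * \<omega> (Suc j) - (1 - k^2 * \<omega> (Suc j) ^ 2) * \<omega> j"
  using next_sum[of j] unfolding W_def by (simp add: algebra_simps)

text \<open>Read \<open>rel\<close> as a quadratic equation for \<open>\<omega> (Suc j)\<close>: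
  then \<open>W j\<close> is a square root of a quarter of its discriminant, and its sign tells
  which of the two roots comes next.\<close>

lemma W_square: "W j ^ 2 = k^2 * \<omega> j ^ 4 - (k^2 + 1 - h^2) * \<omega> j ^ 2 + 1"
  using rel[of j] unfolding W_def by Groebner_Basis.algebra

lemma U_W: "U j * \<omega> j ^ 2 = W j + 1"
  using \<omega>(1)[of j] by (simp add: U_def)

text \<open>Substituting W = U \<omega>^2 - 1 into the quartic cancels the constant term, after
  which \<omega>^2 can be divided out.\<close>

lemma U_\<omega>: "\<omega> j ^ 2 * (U j ^ 2 - k^2) = 2 * U j - (k^2 + 1 - h^2)"
proof -
  have "\<omega> j ^ 2 * (\<omega> j ^ 2 * (U j ^ 2 - k^2) - (2 * U j - (k^2 + 1 - h^2))) = 0"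
    using U_W[of j] W_square[of j] by Groebner_Basis.algebra
  then show ?thesis using \<omega>(1)[of j] by simp
qed

lemma t_U: "U j = h + 1 + 2 * A * B * t j"
  using A B by (simp add: t_def)

lemma y_U: "4 * A * B * y j = \<omega> j * (U j ^ 2 - k^2)"
  using A B by (simp add: y_def)

text \<open>The cubic in \<open>U\<close> has the zeros k, -k and (k^2 + 1 - h^2) / 2. The affine
  change from \<open>U\<close> to \<open>t\<close> moves them to -1/A, -1/B and -1.\<close>

lemma curve: "y j ^ 2 = poly f (t j)"
proof -
  have "(4 * A * B * y j)^2 = (2 * U j - (k^2 + 1 - h^2)) * (U j ^ 2 - k^2)"
    unfolding y_U U_\<omega>[symmetric] by (simp add: power2_eq_square)
  also have "\<dots> = (4 * A * B)^2 * poly f (t j)"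
  proof -
    have "poly f (t j) = (1 + t j) * (1 + A * t j) * (1 + B * t j)"
      unfolding f_def by (simp add: algebra_simps)
    then show ?thesis using t_U[of j] k_def h_def by Groebner_Basis.algebra
  qed
  finally show ?thesis using A B by (simp add: power_mult_distrib)
qed

lemma t_nonzero: "t j \<noteq> 0"
proof
  assume "t j = 0"
  then have U: "U j = h + 1" using t_U by simp
  have "\<omega> j ^ 2 * (4 * A * B) = 4 * A * B"
    using U_\<omega>[of j] unfolding U AB4 by (simp add: power2_eq_square algebra_simps)
  then show False using \<omega>(2)[of j] A B by simp
qed

text \<open>By \<open>U_\<omega>\<close>, a zero of \<open>y\<close> would be a common zero of U^2 -
  k^2 and 2 U - (k^2 + 1 - h^2), whose resultant is a multiple of A B (1 - A) (1 - B).\<close>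

lemma y_nonzero: "y j \<noteq> 0"
proof
  assume "y j = 0"
  then have 0: "U j ^ 2 - k^2 = 0" using y_U[of j] \<omega>(1)[of j] by simp
  then have "2 * U j = k^2 + 1 - h^2" using U_\<omega>[of j] by simp
  with 0 have "(k^2 + 1 - h^2)^2 = 4 * k^2" by Groebner_Basis.algebra
  moreover have "(k^2 + 1 - h^2)^2 - 4 * k^2 = 16 * A * B * (1 - A) * (1 - B)"
    unfolding k_def h_def by Groebner_Basis.algebra
  ultimately show False using A B by simp
qed

text \<open>The points (0, 1), (t j, y j) and (t (Suc j), - y (Suc j)) lie on one line. This is the
  chord construction for the translation by (0, 1).\<close>

lemma collinear: "(y j - 1) * t (Suc j) + (y (Suc j) + 1) * t j = 0"
proof -
  define a b where "a = \<omega> j" and "b = \<omega> (Suc j)"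
  have ab: "a \<noteq> 0" "b \<noteq> 0" using \<omega>(1) by (simp_all add: a_def b_def)
  have ya: "4 * A * B * y j * a^3 = 2 * W j + 2 - (k^2 + 1 - h^2) * a^2"
    using y_U[of j] U_\<omega>[of j] U_W[of j] unfolding a_def by Groebner_Basis.algebra
  have yb: "4 * A * B * y (Suc j) * b^3 = 2 * W (Suc j) + 2 - (k^2 + 1 - h^2) * b^2"
    using y_U[of "Suc j"] U_\<omega>[of "Suc j"] U_W[of "Suc j"] unfolding b_def by Groebner_Basis.algebra
  have ta: "2 * A * B * t j * a^2 = W j + 1 - (h + 1) * a^2"
    using t_U[of j] U_W[of j] unfolding a_def by Groebner_Basis.algebra
  have tb: "2 * A * B * t (Suc j) * b^2 = W (Suc j) + 1 - (h + 1) * b^2"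
    using t_U[of "Suc j"] U_W[of "Suc j"] unfolding b_def by Groebner_Basis.algebra
  have R: "1 - a^2 - b^2 + 2 * h * a * b + k^2 * a^2 * b^2 = 0"
    using rel[of j] by (simp add: a_def b_def)
  have Wa: "W j = (1 - k^2 * a^2) * b - h * a" by (simp add: W_def a_def b_def)
  have Wb: "W (Suc j) = h * b - (1 - k^2 * b^2) * a" by (simp add: W_Suc a_def b_def)
  \<comment> \<open>With the powers of \<open>a\<close> and \<open>b\<close> in the denominators
    cleared and both values of \<open>W\<close> expressed by \<open>a\<close> and \<open>b\<close>,
    the claim follows from \<open>R\<close> alone.\<close>
  have "b * (2 * W j + 2 - (k^2 + 1 - h^2) * a^2 - ((h + 1)^2 - k^2) * a^3) * (W (Suc j) + 1 - (h + 1) * b^2)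
      + a * (2 * W (Suc j) + 2 - (k^2 + 1 - h^2) * b^2 + ((h + 1)^2 - k^2) * b^3) * (W j + 1 - (h + 1) * a^2) = 0"
    unfolding Wa Wb using R by Groebner_Basis.algebra
  then have "b * (4 * A * B * (y j - 1) * a^3) * (2 * A * B * t (Suc j) * b^2)
     + a * (4 * A * B * (y (Suc j) + 1) * b^3) * (2 * A * B * t j * a^2) = 0"
    unfolding AB4[symmetric] ya[symmetric] yb[symmetric] ta[symmetric] tb[symmetric]
    by (simp add: algebra_simps)
  then have "8 * (A * B)^2 * (a * b)^3 * ((y j - 1) * t (Suc j) + (y (Suc j) + 1) * t j) = 0"
    by Groebner_Basis.algebra
  then show ?thesis using ab A B by simp
qed

text \<open>\<open>t\<close> determines \<open>U\<close>, hence \<omega>^2 and \<open>W\<close>;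
  only a sign of \<open>\<omega>\<close> remains, and it is carried by \<open>y\<close>. So negation
  on the cubic is \<omega> -> -\<omega> with \<open>W\<close> kept.\<close>

lemma t_eq_imp:
  assumes "t i = t j"
  shows "W i = W j \<and> (y i = y j \<and> \<omega> i = \<omega> j \<or> y i = - y j \<and> \<omega> i = - \<omega> j)"
proof -
  have U: "U i = U j" using assms t_U by simp
  have nz: "U j ^ 2 - k^2 \<noteq> 0" using y_nonzero[of j] y_U[of j] A B by auto
  have "\<omega> i ^ 2 * (U j ^ 2 - k^2) = \<omega> j ^ 2 * (U j ^ 2 - k^2)"
    using U_\<omega>[of i] U_\<omega>[of j] U by simp
  then have sq: "\<omega> i ^ 2 = \<omega> j ^ 2" using nz by simp
  then have "W i = W j" using U_W[of i] U_W[of j] U by simp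
  moreover have "\<omega> i = \<omega> j \<or> \<omega> i = - \<omega> j" using sq by (simp add: power2_eq_iff)
  moreover have "\<omega> i = \<omega> j \<Longrightarrow> y i = y j" "\<omega> i = - \<omega> j \<Longrightarrow> y i = - y j"
    using U by (simp_all add: y_def)
  ultimately show ?thesis by blast
qed

lemma t_Suc_neq: "t (Suc j) \<noteq> t j"
  using t_eq_imp[of "Suc j" j] \<omega>(4,5)[of j] by blast

definition line where "line j = [:1, (y j - 1) / t j:]"

lemma line_values:
  "poly (line j) (t j) = y j" "poly (line j) (t (Suc j)) = - y (Suc j)" "poly (line j) 0 = 1"
proof -
  show "poly (line j) (t j) = y j" "poly (line j) 0 = 1" using t_nonzero by (simp_all add: line_def)
  show "poly (line j) (t (Suc j)) = - y (Suc j)"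
    using collinear[of j] t_nonzero[of j] by (simp add: line_def field_simps)
qed

text \<open>The line meets the cubic over 0, \<open>t j\<close> and \<open>t (Suc j)\<close>; as
  these are distinct, they are all the zeros of this polynomial of degree 3.\<close>

lemma f_minus_line:
  "f - (line j)^2 = smult (A * B) ([:0, 1:] * [:- t j, 1:] * [:- t (Suc j), 1:])"
proof -
  define \<mu> where "\<mu> = (y j - 1) / t j"
  define u v where "u = t j" and "v = t (Suc j)"
  define e1 e2 where "e1 = 1 + A + B - 2 * \<mu>" and "e2 = A + B + A * B - \<mu>^2"
  have uv: "u \<noteq> 0" "v \<noteq> 0" "v \<noteq> u" using t_nonzero t_Suc_neq by (simp_all add: u_def v_def)
  have expand: "f - (line j)^2 = [:0, e1, e2, A * B:]"
    by (simp add: f_def line_def \<mu>_def[symmetric] e1_def e2_def power2_eq_square algebra_simps)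
  have "poly (f - (line j)^2) u = 0" "poly (f - (line j)^2) v = 0"
    using line_values(1,2)[of j] curve[of j] curve[of "Suc j"] by (simp_all add: u_def v_def)
  then have "u * (e1 + u * (e2 + u * (A * B))) = 0" "v * (e1 + v * (e2 + v * (A * B))) = 0"
    unfolding expand by simp_all
  then have 1: "e1 + u * (e2 + u * (A * B)) = 0" "e1 + v * (e2 + v * (A * B)) = 0" using uv by simp_all
  then have "(u - v) * (e2 + (u + v) * (A * B)) = 0" by Groebner_Basis.algebra
  then have "e2 + (u + v) * (A * B) = 0" using uv by (metis eq_iff_diff_eq_0 mult_eq_0_iff)
  then have e2: "e2 = - (u + v) * (A * B)" by Groebner_Basis.algebra
  then have e1: "e1 = u * v * (A * B)" using 1(1) by Groebner_Basis.algebra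
  show ?thesis unfolding expand unfolding e1 e2 u_def v_def by (simp add: algebra_simps)
qed

lemma determined:
  assumes "\<omega> i = \<omega> j" "\<omega> (Suc i) = \<omega> (Suc j)"
  shows "\<omega> (i + m) = \<omega> (j + m) \<and> \<omega> (Suc (i + m)) = \<omega> (Suc (j + m))"
proof (induction m)
  case 0
  then show ?case using assms by simp
next
  case (Suc m)
  then show ?case using next_sum[of "i + m"] next_sum[of "j + m"] \<omega>(3)[of "Suc (j + m)"]
    by (metis add_Suc_right add_right_cancel mult_right_cancel)
qed

text \<open>Here P_m = - P_0. As the step is a translation, P_(m-j) = - P_j for all j in range, and
  in the middle either \<open>\<omega> r = 0\<close> or
  \<open>\<omega> (Suc r) = - \<omega> r\<close>; both are excluded.\<close>

lemma reflection_free: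
  assumes "0 < m" "\<omega> m = - \<omega> 0" "W m = W 0"
  shows False
proof -
  obtain l where m: "m = Suc l" using assms(1) by (cases m) auto
  have "(1 - k^2 * \<omega> m ^ 2) * (\<omega> l + \<omega> 1) = 0"
    using W_Suc[of l] W_def[of 0] assms(2,3) unfolding m One_nat_def by Groebner_Basis.algebra
  then have l: "\<omega> l = - \<omega> 1" using \<omega>(3)[of m] by (simp add: add_eq_0_iff2)
  have anti: "Suc j \<le> m \<longrightarrow> \<omega> (m - j) = - \<omega> j \<and> \<omega> (m - Suc j) = - \<omega> (Suc j)" for j
  proof (induction j)
    case 0
    then show ?case using assms l m by simp
  next
    case (Suc j)
    show ?case
    proof
      assume le: "Suc (Suc j) \<le> m"
      define i where "i = m - Suc (Suc j)"
      have i: "m - Suc j = Suc i" "m - j = Suc (Suc i)" using le by (simp_all add: i_def)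
      have IH: "\<omega> (Suc (Suc i)) = - \<omega> j" "\<omega> (Suc i) = - \<omega> (Suc j)" using Suc le i by auto
      have "(\<omega> i + \<omega> (Suc (Suc j))) * (1 - k^2 * \<omega> (Suc j) ^ 2) = 0"
        using next_sum[of i] next_sum[of j] IH by Groebner_Basis.algebra
      then have "\<omega> i = - \<omega> (Suc (Suc j))" using \<omega>(3)[of "Suc j"] by (simp add: add_eq_0_iff2)
      then show "\<omega> (m - Suc j) = - \<omega> (Suc j) \<and> \<omega> (m - Suc (Suc j)) = - \<omega> (Suc (Suc j))"
        using i IH by (simp add: i_def)
    qed
  qed
  show False
  proof (cases "even m")
    case True
    then obtain r where "m = 2 * r" by blast
    then show False using anti[of r] \<omega>(1)[of r] assms(1) by (cases r) auto
  next
    case False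
    then obtain r where r: "m = Suc (2 * r)" by (metis oddE Suc_eq_plus1)
    then have "m - r = Suc r" by simp
    then show False using anti[of r] \<omega>(5)[of r] r by auto
  qed
qed

lemma divide_linear:
  assumes "poly X c = (0::complex)"
  obtains X' where "X = [:- c, 1:] * X'" "X' \<noteq> 0 \<Longrightarrow> degree X = Suc (degree X')"
proof -
  obtain X' where X': "X = [:- c, 1:] * X'" using assms by (metis dvdE poly_eq_0_iff_dvd)
  have "degree X = Suc (degree X')" if "X' \<noteq> 0"
    unfolding X' using degree_mult_eq[of "[:- c, 1:]" X'] that by simp
  with X' that show thesis by blast
qed

text \<open>\<open>p + q Y\<close> on the cubic \<open>Y\<^sup>2 = f(t)\<close> has divisor \<open>P\<^sub>0 + m T + (- P\<^sub>m)\<close> minus a multiple of the point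
  at infinity, where \<open>P\<^sub>j = (t j, y j)\<close> and \<open>T = (0, 1)\<close>.\<close>

definition chain_function :: "nat \<Rightarrow> complex poly \<Rightarrow> complex poly \<Rightarrow> bool" where
  "chain_function m p q \<longleftrightarrow>
    (\<exists>c. p^2 - q^2 * f = smult c (monom 1 m * [:- t 0, 1:] * [:- t m, 1:])) \<and>
    poly p (t m) = poly q (t m) * y m \<and> poly p (t 0) + poly q (t 0) * y 0 = 0 \<and>
    poly p 0 \<noteq> poly q 0 \<and> 2 * degree p \<le> m + 2 \<and> 2 * degree q + 1 \<le> m"

text \<open>Multiply p + q Y by Y - line, which vanishes at P_m, at (0, 1) and at - P_(m+1), and
  divide by t - t_m, which vanishes at P_m and - P_m. The assumption \<open>t m \<noteq> t 0\<close>
  lets the zero at P_0 survive the division.\<close>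

lemma chain_step:
  assumes "chain_function m p q" and t: "t m \<noteq> t 0"
  shows "\<exists>p q. chain_function (Suc m) p q"
proof -
  obtain c where p0: "p^2 - q^2 * f = smult c (monom 1 m * [:- t 0, 1:] * [:- t m, 1:])"
    and pm: "poly p (t m) = poly q (t m) * y m" and pt0: "poly p (t 0) + poly q (t 0) * y 0 = 0"
    and neg: "poly p 0 \<noteq> poly q 0" and dp: "2 * degree p \<le> m + 2" and dq: "2 * degree q + 1 \<le> m"
    using assms(1) by (auto simp: chain_function_def)
  let ?l = "line m"
  have "poly (q * f - p * ?l) (t m) = 0" "poly (p - q * ?l) (t m) = 0"
    using pm line_values(1)[of m] curve[of m, symmetric] by (simp_all add: power2_eq_square)
  then obtain r s where r: "q * f - p * ?l = [:- t m, 1:] * r" "r \<noteq> 0 \<Longrightarrow> degree (q * f - p * ?l) = Suc (degree r)"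
    and s: "p - q * ?l = [:- t m, 1:] * s" "s \<noteq> 0 \<Longrightarrow> degree (p - q * ?l) = Suc (degree s)"
    by (metis divide_linear)
  let ?L = "[:- t m, 1:]"
  have "?L^2 * (r^2 - s^2 * f) = (p^2 - q^2 * f) * (?l^2 - f)"
  proof -
    have "?L^2 * (r^2 - s^2 * f) = (?L * r)^2 - (?L * s)^2 * f" by Groebner_Basis.algebra
    also have "\<dots> = (p^2 - q^2 * f) * (?l^2 - f)" unfolding r(1)[symmetric] s(1)[symmetric] by Groebner_Basis.algebra
    finally show ?thesis .
  qed
  also have "?l^2 - f = - smult (A * B) ([:0, 1:] * ?L * [:- t (Suc m), 1:])"
    using f_minus_line[of m] by (metis minus_diff_eq)
  also have "(p^2 - q^2 * f) * \<dots> = ?L^2 * smult (- c * A * B) ([:0, 1:] * monom 1 m * [:- t 0, 1:] * [:- t (Suc m), 1:])"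
  proof -
    define M N K X where "M = monom (1::complex) m" and "N = [:- t 0, 1:]" and "K = [:- t (Suc m), 1:]" and "X = [:0, 1::complex:]"
    define L where "L = ?L"
    have "smult c (M * N * L) * - smult (A * B) (X * L * K) = L^2 * smult (- c * A * B) (X * M * N * K)"
      by (simp add: power2_eq_square mult_ac)
    then show ?thesis unfolding p0 M_def N_def K_def X_def L_def .
  qed
  finally have "?L^2 * (r^2 - s^2 * f) =
    ?L^2 * smult (- c * A * B) ([:0, 1:] * monom 1 m * [:- t 0, 1:] * [:- t (Suc m), 1:])" .
  moreover have "?L^2 \<noteq> 0" by simp
  ultimately have "r^2 - s^2 * f = smult (- c * A * B) ([:0, 1:] * monom 1 m * [:- t 0, 1:] * [:- t (Suc m), 1:])"
    using mult_left_cancel by blast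
  moreover have "[:0, 1::complex:] * monom 1 m = monom 1 (Suc m)" by (simp add: monom_Suc)
  ultimately have norm: "r^2 - s^2 * f = smult (- c * A * B) (monom 1 (Suc m) * [:- t 0, 1:] * [:- t (Suc m), 1:])"
    by (simp only:)
  have at: "(u - t m) * poly r u = poly q u * poly f u - poly p u * poly ?l u"
      "(u - t m) * poly s u = poly p u - poly q u * poly ?l u" for u
    using arg_cong[OF r(1), of "\<lambda>x. poly x u"] arg_cong[OF s(1), of "\<lambda>x. poly x u"]
    by (simp_all add: algebra_simps)
  have "(t (Suc m) - t m) * (poly r (t (Suc m)) - poly s (t (Suc m)) * y (Suc m)) = 0"
    using at[of "t (Suc m)"] unfolding line_values(2) curve[symmetric] by Groebner_Basis.algebra
  then have 1: "poly r (t (Suc m)) = poly s (t (Suc m)) * y (Suc m)" using t_Suc_neq[of m] by simp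
  have "(t 0 - t m) * (poly r (t 0) + poly s (t 0) * y 0) = 0"
    using at[of "t 0"] pt0 unfolding curve[symmetric] by Groebner_Basis.algebra
  then have 2: "poly r (t 0) + poly s (t 0) * y 0 = 0" using t by simp
  have "poly f 0 = 1" by (simp add: f_def)
  then have "- t m * (poly r 0 - poly s 0) = 2 * (poly q 0 - poly p 0)"
    using at[of 0] line_values(3)[of m] by Groebner_Basis.algebra
  then have 3: "poly r 0 \<noteq> poly s 0" using neg by auto
  have df: "degree f \<le> 3" unfolding f_def by (simp add: degree_mult_eq A B)
  have dl: "degree ?l \<le> 1" by (simp add: line_def)
  have 4: "2 * degree r \<le> Suc m + 2"
  proof (cases "r = 0")
    case False
    then show ?thesis using r(2) degree_diff_le_max[of "q * f" "p * ?l"] degree_mult_le[of q f] degree_mult_le[of p ?l]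
        df dl dp dq by linarith
  qed simp
  have 5: "2 * degree s + 1 \<le> Suc m"
  proof (cases "s = 0")
    case False
    then show ?thesis using s(2) degree_diff_le_max[of p "q * ?l"] degree_mult_le[of q ?l] dl dp dq by linarith
  qed simp
  from norm 1 2 3 4 5 have "chain_function (Suc m) r s" unfolding chain_function_def by blast
  then show ?thesis by blast
qed

lemma chain_pell: "\<exists>p q. pell f n p q"
proof -
  define ret where "ret d \<longleftrightarrow> 0 < d \<and> \<omega> d = \<omega> 0 \<and> \<omega> (Suc d) = \<omega> 1" for d
  have "ret n" using n period[of 0] period[of 1] by (simp add: ret_def)
  \<comment> \<open>Up to the least return time no \<open>t m\<close> repeats \<open>t 0\<close>, as
    \<open>chain_step\<close> requires. The multiple \<open>n\<close> of \<open>d\<close> is reached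
    by taking a power.\<close>
  define d where "d = (LEAST d. ret d)"
  have d: "ret d" and least: "\<And>m. m < d \<Longrightarrow> \<not> ret m"
    unfolding d_def using \<open>ret n\<close> by (auto intro: LeastI dest: not_less_Least)
  have "\<omega> (j + d) = \<omega> j" for j using determined[of d 0 j] d by (simp add: ret_def add.commute)
  then have mult: "\<omega> (j + e * d) = \<omega> j" for j e by (induction e) (simp_all add: add.assoc[symmetric] add.commute[of d])
  have "d dvd n"
  proof (rule ccontr)
    assume "\<not> d dvd n"
    then have "0 < n mod d" by (simp add: dvd_eq_mod_eq_0)
    moreover have "\<omega> (n mod d) = \<omega> 0"
      using mult[of "n mod d" "n div d"] period[of 0] by (simp add: add.commute)
    moreover have "\<omega> (Suc (n mod d)) = \<omega> 1"
      using mult[of "Suc (n mod d)" "n div d"] period[of 1] by (simp add: add.commute)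
    ultimately have "ret (n mod d)" by (simp add: ret_def)
    then show False using least[of "n mod d"] d by (simp add: ret_def)
  qed
  have distinct: "t m \<noteq> t 0" if "0 < m" "m < d" for m
  proof
    assume "t m = t 0"
    then consider "W m = W 0" "\<omega> m = \<omega> 0" | "W m = W 0" "\<omega> m = - \<omega> 0" using t_eq_imp by blast
    then show False
    proof cases
      case 1
      then have "\<omega> (Suc m) = \<omega> 1" using \<omega>(3)[of 0] by (simp add: W_def)
      then show False using least[OF that(2)] that(1) 1 by (simp add: ret_def)
    next
      case 2
      then show False using reflection_free that by blast
    qed
  qed
  have "Suc i \<le> d \<longrightarrow> (\<exists>p q. chain_function (Suc i) p q)" for i
  proof (induction i)
    case 0
    have "(- line 0)^2 - 1^2 * f = - (f - (line 0)^2)" by simp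
    also have "\<dots> = smult (- (A * B)) (monom 1 (Suc 0) * [:- t 0, 1:] * [:- t (Suc 0), 1:])"
      unfolding f_minus_line by (simp add: monom_Suc)
    finally have "(- line 0)^2 - 1^2 * f = smult (- (A * B)) (monom 1 (Suc 0) * [:- t 0, 1:] * [:- t (Suc 0), 1:])" .
    moreover have "degree (line 0) \<le> 1" by (simp add: line_def)
    moreover have "poly (- line 0) (t (Suc 0)) = poly 1 (t (Suc 0)) * y (Suc 0)"
      "poly (- line 0) (t 0) + poly 1 (t 0) * y 0 = 0" "poly (- line 0) 0 \<noteq> poly 1 0"
      using line_values[of 0] by simp_all
    ultimately have "chain_function (Suc 0) (- line 0) 1"
      unfolding chain_function_def by (intro conjI exI[of _ "- (A * B)"]) simp_all
    then show ?case by blast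
  next
    case (Suc i)
    then show ?case using chain_step distinct[of "Suc i"] by (meson Suc_le_lessD less_imp_le_nat zero_less_Suc)
  qed
  moreover obtain d' where "d = Suc d'" using d by (cases d) (auto simp: ret_def)
  ultimately obtain p q where "chain_function d p q" by blast
  then obtain c where
    norm: "p^2 - q^2 * f = smult c (monom 1 d * [:- t 0, 1:] * [:- t d, 1:])" and
    pd: "poly p (t d) = poly q (t d) * y d" and p0: "poly p (t 0) + poly q (t 0) * y 0 = 0" and
    neg: "poly p 0 \<noteq> poly q 0" and deg: "2 * degree p \<le> d + 2" "2 * degree q + 1 \<le> d"
    by (auto simp: chain_function_def)
  have "W d = W 0" using d by (simp add: W_def ret_def)
  then have td: "t d = t 0" "y d = y 0" using d by (simp_all add: t_def y_def U_def ret_def)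
  \<comment> \<open>Now P_d = P_0, so the function vanishes at both P_0 and - P_0, and t - t_0
    divides \<open>p\<close> and \<open>q\<close>.\<close>
  have "2 * (poly q (t 0) * y 0) = 0" using pd p0 unfolding td by Groebner_Basis.algebra
  then have q0: "poly q (t 0) = 0" using y_nonzero[of 0] by simp
  then have "poly p (t 0) = 0" using p0 by simp
  with q0 obtain r s where r: "p = [:- t 0, 1:] * r" "r \<noteq> 0 \<Longrightarrow> degree p = Suc (degree r)"
    and s: "q = [:- t 0, 1:] * s" "s \<noteq> 0 \<Longrightarrow> degree q = Suc (degree s)"
    by (metis divide_linear)
  define L where "L = [:- t 0, 1:]"
  have "L^2 * (r^2 - s^2 * f) = p^2 - q^2 * f" unfolding r(1) s(1) L_def by Groebner_Basis.algebra
  also have "\<dots> = L^2 * smult c (monom 1 d)" 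
    unfolding norm td L_def[symmetric] by (simp add: power2_eq_square mult_ac)
  finally have "L^2 * (r^2 - s^2 * f) = L^2 * smult c (monom 1 d)" .
  moreover have "L^2 \<noteq> 0" by (simp add: L_def)
  ultimately have "r^2 - s^2 * f = smult c (monom 1 d)" using mult_left_cancel by blast
  moreover have "poly r 0 \<noteq> poly s 0" using neg unfolding r(1) s(1) by auto
  moreover have "2 * degree r \<le> d" using r(2) deg(1) by (cases "r = 0") auto
  moreover have "s \<noteq> 0 \<Longrightarrow> 2 * degree s + 3 \<le> d" using s(2) deg(2) by auto
  ultimately have "pell f d r s" unfolding pell_def by blast
  moreover have "degree f \<le> 3" "poly f 0 = 1" unfolding f_def by (simp_all add: degree_mult_eq A B)
  moreover obtain e where "n = Suc e * d" using \<open>d dvd n\<close> n by (metis dvd_def mult.commute not0_implies_Suc mult_0 less_irrefl)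
  ultimately show ?thesis using pell_power by blast
qed

end

text \<open>Closing means that the coefficient of t^2 in sqrt f vanishes, that is e1^2 = 4 e2 for
  the elementary symmetric functions of 1, A and B.\<close>

lemma pell_three:
  fixes A B :: complex
  assumes "pell ([:1, 1:] * [:1, A:] * [:1, B:]) 3 p q"
  shows "(A - B)^2 = 2 * (A + B - 1) + 1"
proof -
  define e1 e2 e3 where "e1 = 1 + A + B" and "e2 = A + B + A * B" and "e3 = A * B"
  have f: "[:1, 1:] * [:1, A:] * [:1, B:] = [:1, e1, e2, e3:]" by (simp add: e1_def e2_def e3_def algebra_simps)
  obtain c where c: "p^2 - q^2 * [:1, e1, e2, e3:] = smult c (monom 1 3)" and ne: "poly p 0 \<noteq> poly q 0"
    using assms unfolding f by (auto simp: pell_def)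
  have "degree p \<le> 1" "degree q = 0" using assms by (auto simp: pell_def)
  then obtain p0 p1 q0 where p: "p = [:p0, p1:]" and q: "q = [:q0:]"
    by (metis degree1_coeffs degree_0_id degree_eq_zeroE le_neq_implies_less less_one pCons_0_0)
  have co: "coeff (p^2 - q^2 * [:1, e1, e2, e3:]) i = 0" if "i < 3" for i using that unfolding c by simp
  have 0: "p0 * p0 = q0 * q0" and 1: "2 * p0 * p1 = q0 * q0 * e1" and 2: "p1 * p1 = q0 * q0 * e2"
    using co[of 0] co[of 1] co[of 2] unfolding p q
    by (simp_all add: power2_eq_square numeral_2_eq_2 algebra_simps)
  have "q0 \<noteq> 0" using 0 ne p q by auto
  have "q0 * q0 * (q0 * q0) * e1^2 = (2 * p0 * p1)^2" unfolding 1 by (simp add: power2_eq_square)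
  also have "\<dots> = 4 * (p0 * p0) * (p1 * p1)" by (simp add: power2_eq_square)
  also have "\<dots> = q0 * q0 * (q0 * q0) * (4 * e2)" unfolding 0 2 by simp
  finally have "e1^2 = 4 * e2" using \<open>q0 \<noteq> 0\<close> by simp
  moreover have "(A - B)^2 - (2 * (A + B - 1) + 1) = e1^2 - 4 * e2"
    unfolding e1_def e2_def by (simp add: power2_eq_square algebra_simps)
  ultimately show ?thesis by simp
qed

text \<open>Here the coefficient of t^3 in sqrt f vanishes; sixteen times it is e1^3 - 4 e1 e2 + 8
  e3, which factors as stated.\<close>

lemma pell_four:
  fixes A B :: complex
  assumes "pell ([:1, 1:] * [:1, A:] * [:1, B:]) 4 p q"
  shows "(A + B - 1) * ((A - B)^2 - 1) = 0"
proof -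
  define e1 e2 e3 where "e1 = 1 + A + B" and "e2 = A + B + A * B" and "e3 = A * B"
  have f: "[:1, 1:] * [:1, A:] * [:1, B:] = [:1, e1, e2, e3:]" by (simp add: e1_def e2_def e3_def algebra_simps)
  obtain c where c: "p^2 - q^2 * [:1, e1, e2, e3:] = smult c (monom 1 4)" and ne: "poly p 0 \<noteq> poly q 0"
    using assms unfolding f by (auto simp: pell_def)
  have dp: "degree p \<le> 2" and "degree q = 0" using assms by (auto simp: pell_def)
  then obtain q0 where q: "q = [:q0:]" by (metis degree_eq_zeroE)
  define p0 p1 p2 where "p0 = coeff p 0" and "p1 = coeff p 1" and "p2 = coeff p 2"
  have p: "p = [:p0, p1, p2:]"
  proof (rule poly_eqI)
    fix i show "coeff p i = coeff [:p0, p1, p2:] i"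
      using dp coeff_eq_0[of p i] by (cases "i \<le> 2") (auto simp: p0_def p1_def p2_def le_Suc_eq numeral_2_eq_2 coeff_pCons split: nat.splits)
  qed
  have co: "coeff (p^2 - q^2 * [:1, e1, e2, e3:]) i = 0" if "i < 4" for i using that unfolding c by simp
  have 0: "p0 * p0 = q0 * q0" and 1: "2 * p0 * p1 = q0 * q0 * e1" and 2: "p1 * p1 + 2 * p0 * p2 = q0 * q0 * e2"
    and 3: "2 * p1 * p2 = q0 * q0 * e3"
    using co[of 0] co[of 1] co[of 2] co[of 3] unfolding p q
    by (simp_all add: power2_eq_square numeral_2_eq_2 numeral_3_eq_3 algebra_simps)
  have "q0 \<noteq> 0" using 0 ne p q by auto
  have "(2 * p0 * p1)^3 + 8 * (p0 * p0) * (p0 * p0) * (2 * p1 * p2) = 4 * (p0 * p0) * (2 * p0 * p1) * (p1 * p1 + 2 * p0 * p2)"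
    by (simp add: power3_eq_cube algebra_simps)
  then have "(q0 * q0)^3 * (e1^3 + 8 * e3 - 4 * e1 * e2) = 0"
    unfolding 0 1 2 3 by (simp add: power3_eq_cube algebra_simps)
  then have "e1^3 + 8 * e3 - 4 * e1 * e2 = 0" using \<open>q0 \<noteq> 0\<close> by simp
  moreover have "e1^3 + 8 * e3 - 4 * e1 * e2 = (A + B - 1) * ((A - B)^2 - 1)"
    unfolding e1_def e2_def e3_def by (simp add: power2_eq_square power3_eq_cube algebra_simps)
  ultimately show ?thesis by simp
qed

section \<open>Cayley's determinant\<close>


text \<open>Taylor coefficients of the square root of the series with coefficients \<open>e\<close>.
  They are polynomials in the conic parameter, and the value 1 at index 0 fixes the branch for
  \<open>e 0 = 1\<close>.\<close>

function sqrt_coeff :: "(nat \<Rightarrow> complex poly) \<Rightarrow> nat \<Rightarrow> complex poly" where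
  "sqrt_coeff e k = (if k = 0 then 1 else
    smult (1/2) (e k - (\<Sum>i\<in>{1..<k}. sqrt_coeff e i * sqrt_coeff e (k - i))))"
  by pat_completeness auto
termination by (relation "Wellfounded.measure snd") auto

declare sqrt_coeff.simps [simp del]

lemma sqrt_coeff_0 [simp]: "sqrt_coeff e 0 = 1"
  by (simp add: sqrt_coeff.simps)

lemma sqrt_coeff_Suc:
  "sqrt_coeff e (Suc k) = smult (1/2) (e (Suc k) - (\<Sum>i<k. sqrt_coeff e (Suc i) * sqrt_coeff e (k - i)))"
proof -
  have "(\<Sum>i\<in>{1..<Suc k}. sqrt_coeff e i * sqrt_coeff e (Suc k - i)) =
      (\<Sum>i<k. sqrt_coeff e (Suc i) * sqrt_coeff e (k - i))"
    unfolding One_nat_def by (subst sum.shift_bounds_Suc_ivl) (simp add: atLeast0LessThan)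
  then show ?thesis by (subst sqrt_coeff.simps) simp
qed

lemma sqrt_coeff_square:
  assumes "e 0 = 1"
  shows "(\<Sum>i\<le>k. sqrt_coeff e i * sqrt_coeff e (k - i)) = e k"
proof (cases k)
  case 0
  then show ?thesis using assms by simp
next
  case (Suc m)
  have "(\<Sum>i\<le>Suc m. sqrt_coeff e i * sqrt_coeff e (Suc m - i)) =
    sqrt_coeff e (Suc m) + (\<Sum>i\<le>m. sqrt_coeff e (Suc i) * sqrt_coeff e (m - i))"
    unfolding sum.atMost_Suc_shift by simp
  also have "(\<Sum>i\<le>m. sqrt_coeff e (Suc i) * sqrt_coeff e (m - i)) =
     (\<Sum>i<m. sqrt_coeff e (Suc i) * sqrt_coeff e (m - i)) + sqrt_coeff e (Suc m)"
    by (simp add: lessThan_Suc_atMost[symmetric])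
  also have "(\<Sum>i<m. sqrt_coeff e (Suc i) * sqrt_coeff e (m - i)) = e (Suc m) - smult 2 (sqrt_coeff e (Suc m))"
  proof -
    have "smult 2 (sqrt_coeff e (Suc m)) = e (Suc m) - (\<Sum>i<m. sqrt_coeff e (Suc i) * sqrt_coeff e (m - i))"
      by (subst sqrt_coeff_Suc) simp
    then show ?thesis by simp
  qed
  also have "sqrt_coeff e (Suc m) + (e (Suc m) - smult 2 (sqrt_coeff e (Suc m)) + sqrt_coeff e (Suc m)) = e (Suc m)"
    by (metis (no_types, lifting) add.commute diff_add_cancel add.assoc one_add_one smult_1_left smult_add_left)
  finally show ?thesis using Suc by simp
qed

text \<open>The recursion is compatible with the grading in which the degree in the parameter is
  bounded by the order in t; this grading later controls the degree of the determinant.\<close>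

lemma degree_sqrt_coeff:
  assumes "\<And>k. degree (e k) \<le> k"
  shows "degree (sqrt_coeff e k) \<le> k"
proof (induction k rule: less_induct)
  case (less k)
  show ?case
  proof (cases k)
    case (Suc m)
    have "degree (sqrt_coeff e (Suc i) * sqrt_coeff e (m - i)) \<le> Suc m" if "i < m" for i
      using degree_mult_le[of "sqrt_coeff e (Suc i)" "sqrt_coeff e (m - i)"] less[of "Suc i"] less[of "m - i"] that Suc
      by fastforce
    then have "degree (\<Sum>i<m. sqrt_coeff e (Suc i) * sqrt_coeff e (m - i)) \<le> Suc m"
      by (intro degree_sum_le) auto
    then show ?thesis unfolding Suc sqrt_coeff_Suc[of e m]
      using assms[of "Suc m"] by (intro order_trans[OF degree_smult_le] degree_diff_le)
  qed simp
qed

definition root_fps :: "(nat \<Rightarrow> complex poly) \<Rightarrow> complex \<Rightarrow> complex fps" where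
  "root_fps e l = Abs_fps (\<lambda>k. poly (sqrt_coeff e k) l)"

lemma root_fps_square:
  assumes "e 0 = 1"
  shows "root_fps e l * root_fps e l = Abs_fps (\<lambda>k. poly (e k) l)"
proof (rule fps_ext)
  fix k
  have "fps_nth (root_fps e l * root_fps e l) k = poly (\<Sum>i\<le>k. sqrt_coeff e i * sqrt_coeff e (k - i)) l"
    by (simp add: root_fps_def fps_mult_nth poly_sum atLeast0AtMost)
  then show "fps_nth (root_fps e l * root_fps e l) k = fps_nth (Abs_fps (\<lambda>k. poly (e k) l)) k"
    using sqrt_coeff_square[of e k] assms by simp
qed

text \<open>The conjugate factor p - q s has nonzero constant term, so it is a unit among power
  series and the other factor takes all of t^n.\<close>

lemma pell_vanishing:
  assumes "pell f n p q" and s: "s * s = fps_of_poly f" "fps_nth s 0 = 1" and "i < n"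
  shows "fps_nth (fps_of_poly p + fps_of_poly q * s) i = 0"
proof -
  let ?P = "fps_of_poly p" and ?Q = "fps_of_poly q"
  obtain c where c: "p^2 - q^2 * f = smult c (monom 1 n)" and neq: "poly p 0 \<noteq> poly q 0"
    using assms(1) by (auto simp: pell_def)
  have "(?P + ?Q * s) * (?P - ?Q * s) = ?P^2 - ?Q^2 * (s * s)"
    by (simp add: power2_eq_square algebra_simps)
  also have "\<dots> = fps_of_poly (p^2 - q^2 * f)" unfolding s(1)
    by (simp add: fps_of_poly_diff fps_of_poly_mult fps_of_poly_power)
  also have "\<dots> = fps_const c * fps_X ^ n"
    unfolding c by (simp add: fps_of_poly_smult fps_of_poly_monom)
  finally have eq: "(?P + ?Q * s) * (?P - ?Q * s) = fps_const c * fps_X ^ n" .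
  have "fps_nth (?P - ?Q * s) 0 \<noteq> 0" using neq s(2) by (simp add: fps_mult_nth poly_0_coeff_0)
  then have "(?P - ?Q * s) * inverse (?P - ?Q * s) = 1" by (metis inverse_mult_eq_1 mult.commute)
  then have "?P + ?Q * s = (?P + ?Q * s) * (?P - ?Q * s) * inverse (?P - ?Q * s)"
    by (simp add: mult.assoc)
  also have "\<dots> = fps_X ^ n * (fps_const c * inverse (?P - ?Q * s))" unfolding eq by (simp add: mult_ac)
  finally show ?thesis using assms(4) by (simp add: fps_X_power_mult_nth)
qed

text \<open>For a cubic with a triple zero the substitution \<open>x = 2 u + u\<^sup>2\<close> makes the square root
  polynomial, so that vanishing to order \<open>n\<close> becomes impossible.\<close>

lemma no_pell_triple_zero:
  fixes p q :: "complex poly"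
  assumes s: "s * s = fps_of_poly ([:1, 1:]^3)" "fps_nth s 0 = 1"
    and van: "\<And>i. i < n \<Longrightarrow> fps_nth (fps_of_poly p + fps_of_poly q * s) i = 0"
    and deg: "2 * degree p \<le> n" "2 * degree q + 3 \<le> n" and q: "q \<noteq> 0"
  shows False
proof -
  \<comment> \<open>Here 1 + T = (1 + u)^2, so the cubic becomes the square of \<open>C\<close> = (1
    + u)^3.\<close>
  define T where "T = [:0, 2, 1::complex:]"
  define C where "C = [:1, 1::complex:]^3"
  define TT where "TT = fps_of_poly T"
  have T0: "coeff T 0 = 0" "fps_nth TT 0 = 0" by (simp_all add: T_def TT_def)
  have sq: "pcompose ([:1, 1:]^3) T = C * C"
    by (simp add: C_def T_def pcompose_mult pcompose_pCons power3_eq_cube algebra_simps)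
  have "(fps_compose s TT)^2 = fps_of_poly (C * C)"
    unfolding power2_eq_square fps_compose_mult_distrib[OF T0(2), symmetric] s(1) sq[symmetric]
    unfolding TT_def by (rule fps_of_poly_pcompose[OF T0(1), symmetric])
  then have "(fps_compose s TT - fps_of_poly C) * (fps_compose s TT + fps_of_poly C) = 0"
    by (simp add: fps_of_poly_mult algebra_simps power2_eq_square)
  moreover have "fps_compose s TT + fps_of_poly C \<noteq> 0"
  proof -
    have "coeff C 0 = 1" by (simp add: C_def coeff_0_power)
    then have "fps_nth (fps_compose s TT + fps_of_poly C) 0 = 2" using s(2) by simp
    then show ?thesis by (metis fps_zero_nth zero_neq_numeral)
  qed
  ultimately have sT: "fps_compose s TT = fps_of_poly C" by simp
  define R where "R = fps_shift n (fps_of_poly p + fps_of_poly q * s)"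
  have R: "fps_of_poly p + fps_of_poly q * s = R * fps_X ^ n"
    by (rule fps_ext) (use van in \<open>auto simp: R_def fps_X_power_mult_right_nth\<close>)
  define G where "G = pcompose p T + pcompose q T * C"
  have "fps_of_poly G = fps_compose (fps_of_poly p + fps_of_poly q * s) TT"
    unfolding G_def fps_of_poly_add fps_of_poly_mult fps_compose_add_distrib
      fps_compose_mult_distrib[OF T0(2)] sT unfolding TT_def fps_of_poly_pcompose[OF T0(1)] ..
  also have "\<dots> = fps_compose R TT * TT ^ n"
  proof -
    have "fps_compose (fps_X ^ n) TT = TT ^ n"
      using fps_compose_power[OF T0(2), of fps_X n] T0(2) by simp
    then show ?thesis unfolding R fps_compose_mult_distrib[OF T0(2)] by simp
  qed
  \<comment> \<open>\<open>T\<close> has a zero at u = 0, so the order of vanishing \<open>n\<close>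
    carries over to \<open>G\<close>. Together with the degree bound this leaves only a multiple of
    u^n.\<close>
  also have "TT ^ n = (2 + fps_X) ^ n * fps_X ^ n"
  proof -
    have "TT = (2 + fps_X) * fps_X"
      by (simp add: TT_def T_def fps_of_poly_pCons algebra_simps numeral_fps_const)
    then show ?thesis by (simp add: power_mult_distrib)
  qed
  finally have "fps_of_poly G = (fps_compose R TT * (2 + fps_X)^n) * fps_X ^ n"
    by (simp add: mult.assoc)
  then have low: "coeff G i = 0" if "i < n" for i
    using that by (metis fps_of_poly_nth fps_X_power_mult_right_nth)
  have dT: "degree (pcompose r T) = 2 * degree r" for r by (simp add: degree_pcompose T_def)
  have dC: "degree C = 3" by (simp add: C_def degree_power_eq)
  have dqC: "degree (pcompose q T * C) \<le> 2 * degree q + 3"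
    using degree_mult_le[of "pcompose q T" C] dT[of q] dC by simp
  have "degree G \<le> n" unfolding G_def
    using deg dqC dT[of p] by (intro degree_add_le) simp_all
  then have G: "G = monom (coeff G n) n"
    using low by (intro poly_eqI) (metis coeff_eq_0 coeff_monom le_less_linear le_less_trans nat_neq_iff)
  \<comment> \<open>At u = -1 the derivative of \<open>T\<close> vanishes and \<open>C\<close> has a
    triple zero, so \<open>G\<close> is critical there. A nonzero multiple of u^n is not.\<close>
  have T1: "poly (pderiv T) (- 1) = 0" by (simp add: T_def pderiv_pCons)
  have C1: "poly C (- 1) = 0" "poly (pderiv C) (- 1) = 0"
    by (simp_all add: C_def power3_eq_cube pderiv_pCons)
  have "poly (pderiv G) (- 1) = 0"
    unfolding G_def by (simp add: pderiv_add pderiv_mult pderiv_pcompose T1 C1)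
  moreover have "poly (pderiv G) (- 1) = of_nat n * coeff G n * (- 1) ^ (n - 1)"
    by (subst G) (simp add: pderiv_monom poly_monom)
  ultimately have "coeff G n = 0" using deg(2) by simp
  then have "G = 0" using G by simp
  then have "pcompose p T = - (pcompose q T * C)" by (simp add: G_def eq_neg_iff_add_eq_0)
  then have "degree (pcompose p T) = degree (pcompose q T * C)" by simp
  also have "\<dots> = 2 * degree q + 3"
  proof -
    have "pcompose q T \<noteq> 0" using q by (simp add: T_def pcompose_eq_0_iff)
    moreover have "C \<noteq> 0" by (simp add: C_def)
    ultimately show ?thesis using dT[of q] dC by (simp add: degree_mult_eq)
  qed
  finally have "2 * degree p = 2 * degree q + 3" unfolding dT .
  \<comment> \<open>Composition with \<open>T\<close> doubles degrees while \<open>C\<close> has odd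
    degree, so the two sides differ in parity.\<close>
  then show False by presburger
qed

text \<open>Applied to the coefficient vector of \<open>q\<close>, row i yields the coefficient of
  t^(m + 1 + i) in q sqrt f. For k <= m the subtraction is never truncated.\<close>

definition toeplitz :: "(nat \<Rightarrow> complex poly) \<Rightarrow> nat \<Rightarrow> nat \<Rightarrow> complex poly mat" where
  "toeplitz e m k = mat k k (\<lambda>(i, j). sqrt_coeff e (Suc m + i - j))"

lemma toeplitz_singular_iff:
  assumes "k \<le> m"
  shows "poly (det (toeplitz e m k)) l = 0 \<longleftrightarrow>
    (\<exists>q. q \<noteq> 0 \<and> degree q < k \<and> (\<forall>i<k. fps_nth (fps_of_poly q * root_fps e l) (Suc m + i) = 0))"
proof -
  let ?h = "\<lambda>p. poly p l"
  let ?M = "map_mat ?h (toeplitz e m k)"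
  interpret h: comm_ring_hom ?h by unfold_locales simp_all
  have M: "?M \<in> carrier_mat k k" by (simp add: toeplitz_def)
  have det: "poly (det (toeplitz e m k)) l = det ?M" by (rule h.hom_det[symmetric])
  have row: "vec_index (?M *\<^sub>v v) i = (\<Sum>j<k. vec_index v j * poly (sqrt_coeff e (Suc m + i - j)) l)"
    if "i < k" "v \<in> carrier_vec k" for i v
    using that by (simp add: toeplitz_def scalar_prod_def atLeast0LessThan mult.commute)
  have conv: "fps_nth (fps_of_poly q * root_fps e l) (Suc m + i) =
      (\<Sum>j<k. coeff q j * poly (sqrt_coeff e (Suc m + i - j)) l)" if "degree q < k" for q i
  proof -
    have "fps_nth (fps_of_poly q * root_fps e l) (Suc m + i) =
      (\<Sum>j\<in>{0..Suc m + i}. coeff q j * poly (sqrt_coeff e (Suc m + i - j)) l)"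
      by (simp add: fps_mult_nth root_fps_def)
    also have "\<dots> = (\<Sum>j<k. coeff q j * poly (sqrt_coeff e (Suc m + i - j)) l)"
      using that assms by (intro sum.mono_neutral_right) (auto intro: coeff_eq_0)
    finally show ?thesis .
  qed
  show ?thesis unfolding det det_0_iff_vec_prod_zero[OF M]
  proof
    assume "\<exists>v. v \<in> carrier_vec k \<and> v \<noteq> 0\<^sub>v k \<and> ?M *\<^sub>v v = 0\<^sub>v k"
    then obtain v where v: "v \<in> carrier_vec k" "v \<noteq> 0\<^sub>v k" "?M *\<^sub>v v = 0\<^sub>v k" by blast
    define q where "q = (\<Sum>j<k. monom (vec_index v j) j)"
    have cq: "coeff q j = (if j < k then vec_index v j else 0)" for j
      by (simp add: q_def coeff_sum)
    obtain j where j: "j < k" "vec_index v j \<noteq> 0" using v(1,2) by (metis eq_vecI carrier_vecD index_zero_vec)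
    then have "q \<noteq> 0" using cq by (metis coeff_0)
    moreover have "degree q < k" using j cq
      by (metis \<open>q \<noteq> 0\<close> leading_coeff_0_iff)
    moreover have "fps_nth (fps_of_poly q * root_fps e l) (Suc m + i) = 0" if "i < k" for i
    proof -
      have "(\<Sum>j<k. coeff q j * poly (sqrt_coeff e (Suc m + i - j)) l) = vec_index (?M *\<^sub>v v) i"
        unfolding row[OF that v(1)] by (intro sum.cong) (simp_all add: cq)
      then show ?thesis using conv[OF \<open>degree q < k\<close>, of i] v(3) that by simp
    qed
    ultimately show "\<exists>q. q \<noteq> 0 \<and> degree q < k \<and> (\<forall>i<k. fps_nth (fps_of_poly q * root_fps e l) (Suc m + i) = 0)"
      by blast
  next
    assume "\<exists>q. q \<noteq> 0 \<and> degree q < k \<and> (\<forall>i<k. fps_nth (fps_of_poly q * root_fps e l) (Suc m + i) = 0)"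
    then obtain q where q: "q \<noteq> 0" "degree q < k"
      "\<And>i. i < k \<Longrightarrow> fps_nth (fps_of_poly q * root_fps e l) (Suc m + i) = 0" by blast
    define v where "v = vec k (coeff q)"
    have v: "v \<in> carrier_vec k" by (simp add: v_def)
    have "vec_index v (degree q) \<noteq> 0" using q(1,2) by (simp add: v_def)
    then have "v \<noteq> 0\<^sub>v k" using q(2) by auto
    moreover have "?M *\<^sub>v v = 0\<^sub>v k"
    proof (rule eq_vecI)
      fix i assume "i < dim_vec (0\<^sub>v k)"
      then have i: "i < k" by simp
      have "vec_index (?M *\<^sub>v v) i = (\<Sum>j<k. coeff q j * poly (sqrt_coeff e (Suc m + i - j)) l)"
        unfolding row[OF i v] by (intro sum.cong) (simp_all add: v_def)
      then show "vec_index (?M *\<^sub>v v) i = vec_index (0\<^sub>v k) i" using conv[OF q(2), of i] q(3)[OF i] i by simp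
    qed (simp add: toeplitz_def)
    ultimately show "\<exists>v. v \<in> carrier_vec k \<and> v \<noteq> 0\<^sub>v k \<and> ?M *\<^sub>v v = 0\<^sub>v k" using v by blast
  qed
qed

text \<open>All terms of the Leibniz expansion obey the same bound, because the row indices and the
  permuted column indices have equal sums.\<close>

lemma degree_det_toeplitz:
  assumes "\<And>k. degree (e k) \<le> k" and k: "k \<le> m"
  shows "degree (det (toeplitz e m k)) \<le> k * Suc m"
proof -
  have M: "toeplitz e m k \<in> carrier_mat k k" by (simp add: toeplitz_def)
  have "degree (signof \<pi> * (\<Prod>i = 0..<k. toeplitz e m k $$ (i, \<pi> i))) \<le> k * Suc m"
    if \<pi>: "\<pi> permutes {0..<k}" for \<pi>
  proof -
    have lt: "\<pi> i < k" if "i < k" for i using permutes_in_image[OF \<pi>, of i] that by simp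
    have "degree (signof \<pi> * (\<Prod>i = 0..<k. toeplitz e m k $$ (i, \<pi> i))) \<le>
      degree (\<Prod>i = 0..<k. toeplitz e m k $$ (i, \<pi> i))"
      by (cases "sign \<pi> = 1") (auto simp: sign_def)
    also have "\<dots> \<le> (\<Sum>i = 0..<k. degree (toeplitz e m k $$ (i, \<pi> i)))"
      using degree_prod_sum_le[of "{0..<k}" "\<lambda>i. toeplitz e m k $$ (i, \<pi> i)"] by (simp add: o_def)
    also have "\<dots> \<le> (\<Sum>i = 0..<k. Suc m + i - \<pi> i)"
      using lt degree_sqrt_coeff[of e, OF assms(1)] by (intro sum_mono) (simp add: toeplitz_def del: add_Suc)
    also have "\<dots> = k * Suc m"
    proof -
      have "(\<Sum>i = 0..<k. Suc m + i - \<pi> i) + (\<Sum>i = 0..<k. \<pi> i) = (\<Sum>i = 0..<k. Suc m + i)"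
        unfolding sum.distrib[symmetric] using lt k by (intro sum.cong) fastforce+
      moreover have "(\<Sum>i = 0..<k. \<pi> i) = (\<Sum>i = 0..<k. i)"
        using sum.permute[OF \<pi>, of "\<lambda>i. i"] by (simp add: o_def)
      moreover have "(\<Sum>i = 0..<k. Suc m + i) = k * Suc m + (\<Sum>i = 0..<k. i)"
        by (simp only: sum.distrib) simp
      ultimately show ?thesis by linarith
    qed
    finally show ?thesis .
  qed
  then show ?thesis unfolding det_def'[OF M]
    by (intro degree_sum_le) (auto simp: finite_permutations)
qed

text \<open>Since \<open>p\<close> has degree at most m, the coefficients of q sqrt f at t^(m+1),
  ..., t^(n-1) must vanish. These are k = n - m - 1 conditions on the k coefficients of
  \<open>q\<close>, hence a square system.\<close>

lemma pell_polynomial: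
  fixes \<alpha> \<beta> :: complex
  assumes "3 \<le> n"
  shows "\<exists>\<Delta>. \<Delta> \<noteq> 0 \<and> degree \<Delta> \<le> (if even n then (n div 2)^2 - 1 else (n div 2) * Suc (n div 2)) \<and>
    (\<forall>l p q. pell ([:1, 1:] * [:1, 1 + l * \<alpha>:] * [:1, 1 + l * \<beta>:]) n p q \<longrightarrow> poly \<Delta> l = 0)"
proof -
  define A B where "A = [:1, \<alpha>:]" and "B = [:1, \<beta>:]"
  define e where "e = (\<lambda>k::nat. if k = 0 then 1 else if k = 1 then 1 + A + B
    else if k = 2 then A + B + A * B else if k = 3 then A * B else 0)"
  define m where "m = n div 2"
  define k where "k = (if even n then m - 1 else m)"
  have k: "k \<le> m" by (simp add: k_def)
  have n: "n = Suc m + k" "1 \<le> m" using assms by (auto simp: m_def k_def elim!: evenE oddE)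
  have AB: "degree A \<le> 1" "degree B \<le> 1" "degree (A * B) \<le> 2"
    using degree_mult_le[of A B] by (simp_all add: A_def B_def)
  have e: "degree (e i) \<le> i" for i
    using AB by (auto simp: e_def intro!: degree_add_le)
  have e0: "e 0 = 1" by (simp add: e_def)
  have f: "root_fps e l * root_fps e l = fps_of_poly ([:1, 1:] * [:1, 1 + l * \<alpha>:] * [:1, 1 + l * \<beta>:])" for l
  proof -
    have "Abs_fps (\<lambda>k. poly (e k) l) = fps_of_poly ([:1, 1:] * [:1, 1 + l * \<alpha>:] * [:1, 1 + l * \<beta>:])"
    proof (rule fps_ext)
      fix i :: nat
      have "i = 0 \<or> i = 1 \<or> i = 2 \<or> i = 3 \<or> 3 < i" by auto
      then show "fps_nth (Abs_fps (\<lambda>k. poly (e k) l)) i =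
          fps_nth (fps_of_poly ([:1, 1:] * [:1, 1 + l * \<alpha>:] * [:1, 1 + l * \<beta>:])) i"
        by (elim disjE) (auto simp: e_def A_def B_def algebra_simps coeff_eq_0 numeral_2_eq_2 numeral_3_eq_3
            coeff_pCons split: nat.splits)
    qed
    then show ?thesis using root_fps_square[of e l] e0 by (simp only:)
  qed
  have s0: "fps_nth (root_fps e l) 0 = 1" for l by (simp add: root_fps_def)
  define \<Delta> where "\<Delta> = det (toeplitz e m k)"
  have deg: "degree \<Delta> \<le> (if even n then (n div 2)^2 - 1 else (n div 2) * Suc (n div 2))"
  proof -
    have "k * Suc m = (if even n then m^2 - 1 else m * Suc m)"
      using n(2) by (auto simp: k_def power2_eq_square algebra_simps diff_mult_distrib)
    then show ?thesis using degree_det_toeplitz[OF e k] unfolding \<Delta>_def m_def by simp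
  qed
  have roots: "poly \<Delta> l = 0" if pell: "pell ([:1, 1:] * [:1, 1 + l * \<alpha>:] * [:1, 1 + l * \<beta>:]) n p q" for l p q
  proof -
    have "q \<noteq> 0"
    proof
      assume "q = 0"
      then obtain c where "p^2 = smult c (monom 1 n)" "poly p 0 \<noteq> 0" using pell by (auto simp: pell_def)
      then have "poly p 0 ^ 2 = c * 0 ^ n" by (metis poly_power poly_smult poly_monom mult_1)
      then show False using \<open>poly p 0 \<noteq> 0\<close> assms by (simp add: power_0_left)
    qed
    then have dq: "2 * degree q + 3 \<le> n" and dp: "2 * degree p \<le> n" using pell by (auto simp: pell_def)
    have "degree q < k" using dq unfolding k_def m_def by (cases "even n") (auto elim!: evenE oddE)
    moreover have "fps_nth (fps_of_poly q * root_fps e l) (Suc m + i) = 0" if "i < k" for i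
    proof -
      have "fps_nth (fps_of_poly p + fps_of_poly q * root_fps e l) (Suc m + i) = 0"
        using pell_vanishing[OF pell f s0] that n by simp
      moreover have "coeff p (Suc m + i) = 0" using dp by (intro coeff_eq_0) (simp add: m_def)
      ultimately show ?thesis by simp
    qed
    ultimately show ?thesis unfolding \<Delta>_def toeplitz_singular_iff[OF k] using \<open>q \<noteq> 0\<close> by blast
  qed
  have "poly \<Delta> 0 \<noteq> 0"
  proof
    assume "poly \<Delta> 0 = 0"
    then obtain q where q: "q \<noteq> 0" "degree q < k"
      "\<And>i. i < k \<Longrightarrow> fps_nth (fps_of_poly q * root_fps e 0) (Suc m + i) = 0"
      unfolding \<Delta>_def toeplitz_singular_iff[OF k] by blast
    \<comment> \<open>Minus the truncation of q sqrt f at degree \<open>m\<close>, so that a kernel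
      vector yields p + q sqrt f vanishing to order \<open>n\<close>.\<close>
    define p where "p = - (\<Sum>i\<le>m. monom (fps_nth (fps_of_poly q * root_fps e 0) i) i)"
    have cp: "coeff p i = (if i \<le> m then - fps_nth (fps_of_poly q * root_fps e 0) i else 0)" for i
      by (simp add: p_def coeff_sum)
    have "degree p \<le> m" by (rule degree_le) (simp add: cp)
    then have "2 * degree p \<le> n" by (simp add: m_def)
    moreover have "2 * degree q + 3 \<le> n" using q(2) unfolding k_def m_def by (cases "even n") (auto elim!: evenE oddE)
    moreover have "fps_nth (fps_of_poly p + fps_of_poly q * root_fps e 0) i = 0" if "i < n" for i
    proof (cases "i \<le> m")
      case True
      then show ?thesis by (simp add: cp)
    next
      case False
      then have "i = Suc m + (i - Suc m)" "i - Suc m < k" using that n by auto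
      then show ?thesis using q(3)[of "i - Suc m"] False by (simp add: cp)
    qed
    moreover have "root_fps e 0 * root_fps e 0 = fps_of_poly ([:1, 1:]^3)"
      unfolding f by (simp add: power3_eq_cube)
    ultimately show False using no_pell_triple_zero[OF _ s0] q(1) by blast
  qed
  then have "\<Delta> \<noteq> 0" by auto
  with deg roots show ?thesis by blast
qed

section \<open>Projective coordinates\<close>

lemma dot3: "dot u v = u$1 * v$1 + u$2 * v$2 + u$3 * v$3" for u v :: "complex^3"
  by (simp add: dot_def sum_3)

lemma dot2: "dot u v = u$1 * v$1 + u$2 * v$2" for u v :: "complex^2"
  by (simp add: dot_def sum_2)

lemma dot_scale: "dot u (k *s v) = k * dot u v" "dot (k *s u) v = k * dot u v" for u v :: "complex^3"
  by (simp_all add: dot3 algebra_simps)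

lemma proportional_refl: "proportional v v \<longleftrightarrow> v \<noteq> 0"
  by (auto simp: proportional_def intro!: exI[of _ 1])

lemma abs_rep_cp2 [simp]: "abs_cp2 (rep_cp2 P) = P"
  by (rule Quotient3_abs_rep[OF Quotient3_cp2])

lemma rep_cp2_nonzero [simp]: "rep_cp2 P \<noteq> 0"
  using Quotient3_rep_reflp[OF Quotient3_cp2, of P] by (simp add: proportional_refl)

lemma abs_cp2_eq_iff:
  assumes "v \<noteq> 0" "w \<noteq> 0"
  shows "abs_cp2 v = abs_cp2 w \<longleftrightarrow> (\<exists>k. k \<noteq> 0 \<and> v = k *s w)"
  using Quotient3_rel[OF Quotient3_cp2, of v w] assms
  by (auto simp: proportional_refl) (auto simp: proportional_def)

lemma rep_abs_cp2:
  assumes "v \<noteq> 0"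
  shows "\<exists>k. k \<noteq> 0 \<and> rep_cp2 (abs_cp2 v) = k *s v"
  using abs_cp2_eq_iff[OF rep_cp2_nonzero assms, of "abs_cp2 v"] by simp

lemma abs_cp2_in_line:
  assumes "v \<noteq> 0"
  shows "abs_cp2 v \<in> proj_line u \<longleftrightarrow> dot u v = 0"
  using rep_abs_cp2[OF assms] by (auto simp: proj_line_def dot_scale)

lemma abs_cp2_in_conic:
  assumes "v \<noteq> 0"
  shows "abs_cp2 v \<in> conic_curve A \<longleftrightarrow> dot v (A *v v) = 0"
  using rep_abs_cp2[OF assms] by (auto simp: conic_curve_def dot_scale vector_scalar_commute)

lemma proj_line_scale:
  assumes "k \<noteq> 0"
  shows "proj_line (k *s u) = proj_line u"
  using assms by (auto simp: proj_line_def dot_scale)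

lemma vec3_eq_iff: "u = v \<longleftrightarrow> u$1 = v$1 \<and> u$2 = v$2 \<and> u$3 = v$3" for u v :: "complex^3"
  by (simp add: Finite_Cartesian_Product.vec_eq_iff forall_3)

lemma vec2_eq_iff: "u = v \<longleftrightarrow> u$1 = v$1 \<and> u$2 = v$2" for u v :: "complex^2"
  by (simp add: Finite_Cartesian_Product.vec_eq_iff forall_2)

lemma diag3_mult: "diag3 x y z *v v = vector [x * v$1, y * v$2, z * v$3]"
  by (simp add: vec3_eq_iff matrix_vector_mult_def sum_3 diag3_def)

section \<open>Reflections\<close>

definition axis_norm :: "complex^3 \<Rightarrow> complex" where
  "axis_norm u = u$1 ^ 2 + u$2 ^ 2"

definition reflection_linear :: "complex^3 \<Rightarrow> complex^2^2" where
  "reflection_linear u = vector [vector [1 - 2 * u$1 ^ 2 / axis_norm u, - 2 * u$1 * u$2 / axis_norm u],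
     vector [- 2 * u$1 * u$2 / axis_norm u, 1 - 2 * u$2 ^ 2 / axis_norm u]]"

definition reflection_shift :: "complex^3 \<Rightarrow> complex^2" where
  "reflection_shift u = vector [- 2 * u$1 * u$3 / axis_norm u, - 2 * u$2 * u$3 / axis_norm u]"

text \<open>Covectors transform by the inverse transpose, which for an involution is the transpose.
  The inner product involves only the normal vectors, that is the first two coordinates.\<close>

definition reflect_line :: "complex^3 \<Rightarrow> complex^3 \<Rightarrow> complex^3" where
  "reflect_line u w = w - (2 * (u$1 * w$1 + u$2 * w$2) / axis_norm u) *s u"

lemma isotropic_iff: "isotropic (proj_line u) \<longleftrightarrow> axis_norm u = 0"
proof -
  have nz: "vector [1, \<i>, 0] \<noteq> (0::complex^3)" "vector [1, - \<i>, 0] \<noteq> (0::complex^3)"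
    by (simp_all add: vec3_eq_iff)
  have "axis_norm u = (u$1 + u$2 * \<i>) * (u$1 + u$2 * (- \<i>))"
    by (simp add: axis_norm_def algebra_simps power2_eq_square)
  then show ?thesis
    unfolding isotropic_def hpoint_def abs_cp2_in_line[OF nz(1)] abs_cp2_in_line[OF nz(2)]
    by (simp add: dot3)
qed

lemma affine_point_in_line: "affine_point v \<in> proj_line u \<longleftrightarrow> u$1 * v$1 + u$2 * v$2 + u$3 = 0"
proof -
  have "vector [v$1, v$2, 1] \<noteq> (0::complex^3)" by (simp add: vec3_eq_iff)
  then show ?thesis unfolding affine_point_def hpoint_def by (simp add: abs_cp2_in_line dot3)
qed

lemma matrix2_mult: "(B::complex^2^2) *v v = vector [B$1$1 * v$1 + B$1$2 * v$2, B$2$1 * v$1 + B$2$2 * v$2]"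
  by (simp add: vec2_eq_iff matrix_vector_mult_def sum_2)

text \<open>The linear part fixes the direction of the line and preserves the quadratic form, so it
  multiplies the non-isotropic normal by some s with s^2 = 1. The value s = 1 would give the
  identity.\<close>

lemma symmetry_unique:
  assumes N: "axis_norm u \<noteq> 0" and invol: "f \<circ> f = id" "f \<noteq> id"
    and iso: "\<And>v w. dot (f v - f w) (f v - f w) = dot (v - w) (v - w)"
    and fix_line: "\<And>v. affine_point v \<in> proj_line u \<Longrightarrow> f v = v"
    and f: "f = (\<lambda>v. B *v v + t)"
  shows "B = reflection_linear u \<and> t = reflection_shift u"
proof -
  define n where "n = axis_norm u"
  have n: "n = u$1 ^ 2 + u$2 ^ 2" "n \<noteq> 0" using N by (simp_all add: n_def axis_norm_def)
  define a b c d where "a = B$1$1" and "b = B$1$2" and "c = B$2$1" and "d = B$2$2"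
  define p q r where "p = u$1" and "q = u$2" and "r = u$3"
  note abc = a_def[symmetric] b_def[symmetric] c_def[symmetric] d_def[symmetric]
  have npq: "n = p^2 + q^2" using n by (simp add: p_def q_def)
  have f1: "f v $ 1 = a * v$1 + b * v$2 + t$1" "f v $ 2 = c * v$1 + d * v$2 + t$2" for v
    unfolding f by (simp_all add: matrix2_mult abc)
  define e where "e = r / n"
  have e: "e * n = r" using n(2) by (simp add: e_def)
  \<comment> \<open>\<open>v0\<close> is the foot of the perpendicular from the origin, and
    \<open>v1 - v0\<close> is the direction of the line.\<close>
  define v0 where "v0 = (vector [- p * e, - q * e] :: complex^2)"
  define v1 where "v1 = (vector [- p * e - q, - q * e + p] :: complex^2)"
  have v: "v0$1 = - p * e" "v0$2 = - q * e" "v1$1 = - p * e - q" "v1$2 = - q * e + p"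
    by (simp_all add: v0_def v1_def)
  have "u$1 * v0$1 + u$2 * v0$2 + u$3 = 0" "u$1 * v1$1 + u$2 * v1$2 + u$3 = 0"
  proof -
    have "p * (- p * e) + q * (- q * e) + r = r - e * (p^2 + q^2)"
      "p * (- p * e - q) + q * (- q * e + p) + r = r - e * (p^2 + q^2)"
      by (simp_all add: power2_eq_square algebra_simps)
    moreover have "r - e * (p^2 + q^2) = 0" using npq e by simp
    ultimately show "u$1 * v0$1 + u$2 * v0$2 + u$3 = 0" "u$1 * v1$1 + u$2 * v1$2 + u$3 = 0"
      unfolding v p_def[symmetric] q_def[symmetric] r_def[symmetric] by simp_all
  qed
  then have fix0: "f v0 = v0" "f v1 = v1" using fix_line affine_point_in_line by blast+
  have "f v1 $ 1 - f v0 $ 1 = v1$1 - v0$1" "f v1 $ 2 - f v0 $ 2 = v1$2 - v0$2"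
    using fix0 by simp_all
  then have dir: "- a * q + b * p = - q" "- c * q + d * p = p"
    unfolding f1 v by (simp_all add: algebra_simps)
  have isoB: "(a * x + b * y)^2 + (c * x + d * y)^2 = x^2 + y^2" for x y
    using iso[of "vector [x, y]" 0] by (simp add: dot2 f1 power2_eq_square)
  have o1: "a^2 + c^2 = 1" "b^2 + d^2 = 1" using isoB[of 1 0] isoB[of 0 1] by simp_all
  have "2 * (a * b + c * d) = ((a * 1 + b * 1)^2 + (c * 1 + d * 1)^2) - (a^2 + c^2) - (b^2 + d^2)"
    by (simp add: power2_eq_square algebra_simps)
  also have "\<dots> = 0" unfolding isoB o1 by simp
  finally have o2: "a * b + c * d = 0" by (simp only: mult_eq_0_iff) simp
  have ne: "\<not> (a = 1 \<and> b = 0 \<and> c = 0 \<and> d = 1)"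
  proof
    assume id: "a = 1 \<and> b = 0 \<and> c = 0 \<and> d = 1"
    have "f v0 $ 1 = v0$1" "f v0 $ 2 = v0$2" using fix0 by simp_all
    then have "t$1 = 0" "t$2 = 0" using id by (simp_all add: f1)
    then have "f v = v" for v using id by (simp add: vec2_eq_iff f1)
    then show False using invol(2) by auto
  qed
  define s where "s = ((a * p + b * q) * p + (c * p + d * q) * q) / n"
  have s: "s * n = (a * p + b * q) * p + (c * p + d * q) * q" using n(2) by (simp add: s_def)
  have perp: "(a * p + b * q) * q = (c * p + d * q) * p"
  proof -
    have "(c * p + d * q) * p - (a * p + b * q) * q =
        (a * p + b * q) * (- a * q + b * p) + (c * p + d * q) * (- c * q + d * p)"
      unfolding dir by simp
    also have "\<dots> = p * q * ((b^2 + d^2) - (a^2 + c^2)) + (p^2 - q^2) * (a * b + c * d)"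
      by (simp add: power2_eq_square algebra_simps)
    also have "\<dots> = 0" unfolding o1 o2 by simp
    finally show ?thesis by simp
  qed
  have "n * (a * p + b * q - s * p) = 0" "n * (c * p + d * q - s * q) = 0"
  proof -
    have "n * (a * p + b * q - s * p) = (p^2 + q^2) * (a * p + b * q) - (s * n) * p"
      "n * (c * p + d * q - s * q) = (p^2 + q^2) * (c * p + d * q) - (s * n) * q"
      unfolding npq[symmetric] by (simp_all add: algebra_simps)
    moreover have "(p^2 + q^2) * (a * p + b * q) - (s * n) * p = q * ((a * p + b * q) * q - (c * p + d * q) * p)"
      "(p^2 + q^2) * (c * p + d * q) - (s * n) * q = p * ((c * p + d * q) * p - (a * p + b * q) * q)"
      unfolding s by (simp_all add: power2_eq_square algebra_simps)
    ultimately show "n * (a * p + b * q - s * p) = 0" "n * (c * p + d * q - s * q) = 0"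
      unfolding perp by simp_all
  qed
  then have x: "a * p + b * q = s * p" "c * p + d * q = s * q" using n(2) by simp_all
  have "(s * p)^2 + (s * q)^2 = p^2 + q^2" using isoB[of p q] unfolding x .
  then have "n * (s^2 - 1) = 0" unfolding npq by (simp add: power2_eq_square algebra_simps)
  then have "s = 1 \<or> s = - 1" using n(2) by (simp add: power2_eq_1_iff)
  moreover have entries: "n * a = s * p^2 + q^2" "n * b = (s - 1) * p * q" "n * c = (s - 1) * p * q" "n * d = s * q^2 + p^2"
  proof -
    have "n * a = p * (a * p + b * q) - q * (- a * q + b * p)" "n * b = q * (a * p + b * q) + p * (- a * q + b * p)"
      "n * c = p * (c * p + d * q) - q * (- c * q + d * p)" "n * d = q * (c * p + d * q) + p * (- c * q + d * p)"
      unfolding npq by (simp_all add: power2_eq_square algebra_simps)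
    then show "n * a = s * p^2 + q^2" "n * b = (s - 1) * p * q" "n * c = (s - 1) * p * q" "n * d = s * q^2 + p^2"
      unfolding x dir by (simp_all add: power2_eq_square algebra_simps)
  qed
  moreover have "s \<noteq> 1"
  proof
    assume "s = 1"
    then have "n * a = n * 1" "n * b = 0" "n * c = 0" "n * d = n * 1" using entries npq by simp_all
    then show False using ne n(2) by (metis mult_eq_0_iff mult_left_cancel)
  qed
  ultimately have "s = - 1" by blast
  have abcd: "a = 1 - 2 * p^2 / n" "b = - 2 * p * q / n" "c = - 2 * p * q / n" "d = 1 - 2 * q^2 / n"
  proof -
    have "n * a = n - 2 * p^2" "n * b = - 2 * p * q" "n * c = - 2 * p * q" "n * d = n - 2 * q^2"
      unfolding entries unfolding npq \<open>s = - 1\<close> by (simp_all add: algebra_simps)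
    then show "a = 1 - 2 * p^2 / n" "b = - 2 * p * q / n" "c = - 2 * p * q / n" "d = 1 - 2 * q^2 / n"
      using n(2) by (simp_all add: field_simps)
  qed
  then have B: "B = reflection_linear u"
    by (simp add: Finite_Cartesian_Product.vec_eq_iff forall_2 reflection_linear_def n_def[symmetric]
        a_def b_def c_def d_def p_def q_def)
  have "a * v0$1 + b * v0$2 + t$1 = v0$1" "c * v0$1 + d * v0$2 + t$2 = v0$2"
    using f1[of v0] fix0 by simp_all
  then have "t$1 = e * (a * p + b * q) - p * e" "t$2 = e * (c * p + d * q) - q * e"
    unfolding v by (simp_all add: algebra_simps)
  then have "t$1 = - 2 * p * e" "t$2 = - 2 * q * e"
    unfolding x \<open>s = - 1\<close> by simp_all
  then have "t = reflection_shift u"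
    by (simp add: vec2_eq_iff reflection_shift_def n_def[symmetric] p_def q_def r_def e_def)
  with B show ?thesis by simp
qed


lemma reflection_components:
  fixes v :: "complex^2"
  shows "(reflection_linear u *v v + reflection_shift u) $ 1 =
      v$1 - 2 * (u$1 * v$1 + u$2 * v$2 + u$3) / axis_norm u * u$1"
    and "(reflection_linear u *v v + reflection_shift u) $ 2 =
      v$2 - 2 * (u$1 * v$1 + u$2 * v$2 + u$3) / axis_norm u * u$2"
proof -
  define n where "n = inverse (axis_norm u)"
  have d: "x / axis_norm u = x * n" for x by (simp add: n_def divide_inverse)
  show "(reflection_linear u *v v + reflection_shift u) $ 1 =
      v$1 - 2 * (u$1 * v$1 + u$2 * v$2 + u$3) / axis_norm u * u$1"
    "(reflection_linear u *v v + reflection_shift u) $ 2 =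
      v$2 - 2 * (u$1 * v$1 + u$2 * v$2 + u$3) / axis_norm u * u$2"
    unfolding reflection_linear_def reflection_shift_def d
    by (simp_all add: matrix2_mult power2_eq_square algebra_simps)
qed

lemma symmetry_exists:
  assumes N: "axis_norm u \<noteq> 0"
  defines "f \<equiv> (\<lambda>v. reflection_linear u *v v + reflection_shift u)"
  shows "f \<circ> f = id" "f \<noteq> id" "dot (f v - f w) (f v - f w) = dot (v - w) (v - w)"
    "affine_point v \<in> proj_line u \<Longrightarrow> f v = v"
proof -
  define p q r n where "p = u$1" and "q = u$2" and "r = u$3" and "n = inverse (axis_norm u)"
  have n: "(p * p + q * q) * n = 1" using N by (simp add: n_def p_def q_def axis_norm_def power2_eq_square)
  have f: "f v $ 1 = v$1 - 2 * (p * v$1 + q * v$2 + r) * n * p" "f v $ 2 = v$2 - 2 * (p * v$1 + q * v$2 + r) * n * q" for v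
    unfolding f_def reflection_components by (simp_all add: p_def q_def r_def n_def divide_inverse)
  have val: "p * f v $ 1 + q * f v $ 2 + r = - (p * v$1 + q * v$2 + r)" for v
  proof -
    have "p * f v $ 1 + q * f v $ 2 + r = (p * v$1 + q * v$2 + r) * (1 - 2 * ((p * p + q * q) * n))"
      unfolding f by (simp add: algebra_simps)
    then show ?thesis unfolding n by simp
  qed
  have "f (f v) = v" for v
    unfolding vec2_eq_iff f(1)[of "f v"] f(2)[of "f v"] val unfolding f by (simp add: algebra_simps)
  then show "f \<circ> f = id" by auto
  show "dot (f v - f w) (f v - f w) = dot (v - w) (v - w)" for v w
  proof -
    define x y where "x = v$1 - w$1" and "y = v$2 - w$2"
    have xy: "f v $ 1 - f w $ 1 = x - 2 * (p * x + q * y) * n * p" "f v $ 2 - f w $ 2 = y - 2 * (p * x + q * y) * n * q"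
      unfolding f x_def y_def by (simp_all add: algebra_simps)
    have "dot (f v - f w) (f v - f w) = x * x + y * y + 4 * (p * x + q * y)^2 * n * ((p * p + q * q) * n - 1)"
      unfolding dot2 vector_minus_component xy by (simp add: power2_eq_square algebra_simps)
    then show ?thesis unfolding n by (simp add: dot2 x_def y_def)
  qed
  show "affine_point v \<in> proj_line u \<Longrightarrow> f v = v" for v
    unfolding affine_point_in_line vec2_eq_iff f p_def[symmetric] q_def[symmetric] r_def[symmetric] by simp
  show "f \<noteq> id"
  proof
    assume id: "f = id"
    have *: "p * v$1 + q * v$2 + r = 0" for v :: "complex^2"
    proof -
      have "p * v$1 + q * v$2 + r = - (p * v$1 + q * v$2 + r)" using val[of v] unfolding id by simp
      then have "2 * (p * v$1 + q * v$2 + r) = 0" by (metis mult_2 right_minus)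
      then show ?thesis by (simp only: mult_eq_0_iff) simp
    qed
    have "r = 0" using *[of 0] by simp
    moreover have "p = 0" using *[of "vector [1, 0]"] \<open>r = 0\<close> by simp
    moreover have "q = 0" using *[of "vector [0, 1]"] \<open>r = 0\<close> by simp
    ultimately show False using n by simp
  qed
qed

lemma line_symmetry_eq:
  assumes N: "axis_norm u \<noteq> 0"
  shows "line_symmetry (proj_line u) = projective_map (affine_matrix (reflection_linear u) (reflection_shift u))"
  unfolding line_symmetry_def
proof (rule the_equality)
  show "symmetry_wrt (proj_line u) (projective_map (affine_matrix (reflection_linear u) (reflection_shift u)))"
    unfolding symmetry_wrt_def Let_def using symmetry_exists[OF N] by blast
next
  fix s assume "symmetry_wrt (proj_line u) s"
  then obtain B t where "(\<lambda>v. B *v v + t) \<circ> (\<lambda>v. B *v v + t) = id" "(\<lambda>v. B *v v + t) \<noteq> id"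
    "\<forall>v w. dot (B *v v + t - (B *v w + t)) (B *v v + t - (B *v w + t)) = dot (v - w) (v - w)"
    "\<forall>v. affine_point v \<in> proj_line u \<longrightarrow> B *v v + t = v" and s: "s = projective_map (affine_matrix B t)"
    unfolding symmetry_wrt_def Let_def by blast
  then have "B = reflection_linear u \<and> t = reflection_shift u"
    by (intro symmetry_unique[OF N, of "\<lambda>v. B *v v + t"]) blast+
  with s show "s = projective_map (affine_matrix (reflection_linear u) (reflection_shift u))" by simp
qed

lemma image_line_symmetry:
  assumes N: "axis_norm u \<noteq> 0"
  shows "line_symmetry (proj_line u) ` proj_line w = proj_line (reflect_line u w)"
proof -
  define H where "H = affine_matrix (reflection_linear u) (reflection_shift u)"
  define n where "n = inverse (axis_norm u)"
  have n: "(u$1 * u$1 + u$2 * u$2) * n = 1" using N by (simp add: n_def axis_norm_def power2_eq_square)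
  have H: "(H *v x)$1 = x$1 - 2 * dot u x * n * u$1" "(H *v x)$2 = x$2 - 2 * dot u x * n * u$2" "(H *v x)$3 = x$3" for x
    unfolding H_def affine_matrix_def reflection_linear_def reflection_shift_def
    by (simp_all add: matrix_vector_mult_def sum_3 dot3 n_def divide_inverse power2_eq_square algebra_simps)
  have uH: "dot u (H *v x) = - dot u x" for x
  proof -
    have "dot u (H *v x) = dot u x * (1 - 2 * ((u$1 * u$1 + u$2 * u$2) * n))"
      unfolding dot3[of u "H *v x"] H by (simp add: dot3 algebra_simps)
    then show ?thesis unfolding n by simp
  qed
  have HH: "H *v (H *v x) = x" for x
    unfolding vec3_eq_iff H(1)[of "H *v x"] H(2)[of "H *v x"] H(3)[of "H *v x"] uH unfolding H by simp
  have wH: "dot (reflect_line u w) x = dot w (H *v x)" for x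
    unfolding dot3[of w "H *v x"] H reflect_line_def divide_inverse n_def[symmetric]
    by (simp add: dot3 algebra_simps)
  have Hnz: "H *v x \<noteq> 0" if "x \<noteq> 0" for x
    using HH[of x] that by (metis matrix_vector_mult_0_right)
  have "line_symmetry (proj_line u) = (\<lambda>P. abs_cp2 (H *v rep_cp2 P))"
    unfolding line_symmetry_eq[OF N] H_def projective_map_def ..
  moreover have "(\<lambda>P. abs_cp2 (H *v rep_cp2 P)) ` proj_line w = proj_line (reflect_line u w)"
  proof (intro equalityI subsetI)
    fix P assume "P \<in> (\<lambda>P. abs_cp2 (H *v rep_cp2 P)) ` proj_line w"
    then obtain Q where Q: "dot w (rep_cp2 Q) = 0" "P = abs_cp2 (H *v rep_cp2 Q)"
      by (auto simp: proj_line_def)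
    then show "P \<in> proj_line (reflect_line u w)"
      using abs_cp2_in_line[OF Hnz[OF rep_cp2_nonzero]] by (simp add: wH HH)
  next
    fix P assume P: "P \<in> proj_line (reflect_line u w)"
    define Q where "Q = abs_cp2 (H *v rep_cp2 P)"
    obtain k where k: "k \<noteq> 0" "rep_cp2 Q = k *s (H *v rep_cp2 P)"
      using rep_abs_cp2[OF Hnz[OF rep_cp2_nonzero[of P]]] by (auto simp: Q_def)
    have "H *v rep_cp2 Q = k *s rep_cp2 P" unfolding k(2) vector_scalar_commute[symmetric] HH ..
    moreover have "k *s rep_cp2 P \<noteq> 0" using k(1) by simp
    ultimately have "abs_cp2 (H *v rep_cp2 Q) = abs_cp2 (rep_cp2 P)"
      using k(1) by (subst abs_cp2_eq_iff) auto
    then have "P = abs_cp2 (H *v rep_cp2 Q)" by simp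
    moreover have "Q \<in> proj_line w" using P k by (simp add: proj_line_def wH dot_scale)
    ultimately show "P \<in> (\<lambda>P. abs_cp2 (H *v rep_cp2 P)) ` proj_line w" by blast
  qed
  ultimately show ?thesis by simp
qed


section \<open>Points and chords of the ellipse\<close>

locale ellipse_plane =
  fixes a b :: real
  assumes b_pos: "0 < b" and b_less_a: "b < a"
begin

text \<open>With \<open>fst v / snd v = exp (\<i> * \<phi>)\<close> this is the point \<open>(a cos \<phi>, b sin \<phi>)\<close>; the values \<open>0\<close> and
  \<open>\<infinity>\<close> of the quotient give the two points at infinity.\<close>

definition ellipse_vec :: "complex \<times> complex \<Rightarrow> complex^3" where
  "ellipse_vec v = vector [of_real a * (fst v ^ 2 + snd v ^ 2),
     - \<i> * of_real b * (fst v ^ 2 - snd v ^ 2), 2 * fst v * snd v]"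

definition ellipse_pt :: "complex \<times> complex \<Rightarrow> cp2" where
  "ellipse_pt v = abs_cp2 (ellipse_vec v)"

text \<open>Normalized to be symmetric and bilinear in the two parameters, so that
  \<open>chord v v\<close> is the tangent and every line through the point of \<open>v\<close> is
  \<open>chord v y\<close> for some \<open>y\<close>.\<close>

definition chord :: "complex \<times> complex \<Rightarrow> complex \<times> complex \<Rightarrow> complex^3" where
  "chord v w = vector [(fst v * fst w + snd v * snd w) / of_real a,
     - \<i> * (fst v * fst w - snd v * snd w) / of_real b, - (fst v * snd w + snd v * fst w)]"

lemma a_pos: "0 < a" using b_pos b_less_a by simp

lemma ab_nonzero [simp]: "a \<noteq> 0" "b \<noteq> 0"
  using a_pos b_pos by simp_all

lemma chord_commute: "chord v w = chord w v"
  by (simp add: chord_def algebra_simps)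

lemma ellipse_vec_nonzero:
  assumes "v \<noteq> 0"
  shows "ellipse_vec v \<noteq> 0"
proof
  assume 0: "ellipse_vec v = 0"
  have "ellipse_vec v $ 1 = 0" "ellipse_vec v $ 2 = 0" unfolding 0 by simp_all
  then have 1: "fst v ^ 2 + snd v ^ 2 = 0" "fst v ^ 2 = snd v ^ 2" by (simp_all add: ellipse_vec_def)
  then have "2 * snd v ^ 2 = 0" by simp
  then have "snd v ^ 2 = 0" by (simp only: mult_eq_0_iff) simp
  then have "fst v = 0" "snd v = 0" using 1 by simp_all
  then show False using assms by (simp add: prod_eq_iff)
qed

lemma dot_chord: "dot (chord v w) (ellipse_vec y) = 2 * br v y * br w y"
proof -
  have "chord v w $ 1 * ellipse_vec y $ 1 = (fst v * fst w + snd v * snd w) * (fst y ^ 2 + snd y ^ 2)"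
    "chord v w $ 2 * ellipse_vec y $ 2 = - (fst v * fst w - snd v * snd w) * (fst y ^ 2 - snd y ^ 2)"
    "chord v w $ 3 * ellipse_vec y $ 3 = - 2 * (fst v * snd w + snd v * fst w) * fst y * snd y"
    by (simp_all add: chord_def ellipse_vec_def) (simp add: algebra_simps)
  then show ?thesis unfolding dot3 br_def by (simp add: power2_eq_square algebra_simps)
qed

lemma ellipse_pt_in_chord:
  assumes "y \<noteq> 0"
  shows "ellipse_pt y \<in> proj_line (chord v w) \<longleftrightarrow> br v y = 0 \<or> br w y = 0"
  unfolding ellipse_pt_def abs_cp2_in_line[OF ellipse_vec_nonzero[OF assms]] dot_chord by simp

text \<open>Three points of the ellipse already give linearly independent vectors, so a covector is
  determined by its values on the ellipse.\<close>

lemma chord_eqI: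
  assumes "\<And>y. dot u (ellipse_vec y) = dot u' (ellipse_vec y)"
  shows "u = u'"
proof -
  have 1: "of_real a * u$1 - \<i> * of_real b * u$2 = of_real a * u'$1 - \<i> * of_real b * u'$2"
    using assms[of "(1, 0)"] by (simp add: dot3 ellipse_vec_def algebra_simps)
  have 2: "of_real a * u$1 + \<i> * of_real b * u$2 = of_real a * u'$1 + \<i> * of_real b * u'$2"
    using assms[of "(0, 1)"] by (simp add: dot3 ellipse_vec_def algebra_simps)
  have "2 * of_real a * u$1 = 2 * of_real a * u'$1" using arg_cong2[OF 1 2, of "(+)"] by (simp add: algebra_simps)
  then have u1: "u$1 = u'$1" by simp
  then have u2: "u$2 = u'$2" using 1 by simp
  have "u$3 = u'$3" using assms[of "(1, 1)"] u1 by (simp add: dot3 ellipse_vec_def)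
  with u1 u2 show ?thesis by (simp add: vec3_eq_iff)
qed

lemma chord_nonzero:
  assumes "v \<noteq> 0" "w \<noteq> 0"
  shows "chord v w \<noteq> 0"
proof
  assume "chord v w = 0"
  then have 0: "br v y * br w y = 0" for y using dot_chord[of v w y] by (simp add: dot3)
  show False
  proof (cases "br v w = 0")
    case True
    have "br v y = 0" for y
      using 0[of y] br_zero_trans[OF assms(2) True, of y] by auto
    from this[of "(1, 0)"] this[of "(0, 1)"] assms(1) show False by (simp add: br_def prod_eq_iff)
  next
    case False
    have "br v y \<noteq> 0 \<and> br w y \<noteq> 0" if "y = (fst v + fst w, snd v + snd w)" for y
      using False unfolding that br_def by (simp add: algebra_simps)
    then show False using 0 by (metis mult_eq_0_iff)
  qed
qed

lemma ellipse_qform: "qform (\<lambda>z. dot u (ellipse_vec z))"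
  unfolding qform_def
  by (intro exI[of _ "of_real a * u$1 - \<i> * of_real b * u$2"] exI[of _ "2 * u$3"]
      exI[of _ "of_real a * u$1 + \<i> * of_real b * u$2"])
    (simp add: dot3 ellipse_vec_def algebra_simps)

lemma line_through_ellipse_pt:
  assumes "v \<noteq> 0" "u \<noteq> 0" "dot u (ellipse_vec v) = 0"
  shows "\<exists>y. y \<noteq> 0 \<and> u = chord v y"
proof -
  from qform_factor[OF ellipse_qform assms(1,3)] obtain m where m: "\<And>z. dot u (ellipse_vec z) = br v z * br m z"
    by blast
  define y where "y = (fst m / 2, snd m / 2)"
  have "2 * br y z = br m z" for z by (simp add: y_def br_def field_simps)
  then have "u = chord v y" by (intro chord_eqI) (simp add: m dot_chord)
  moreover have "y \<noteq> 0"
  proof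
    assume "y = 0"
    then have "u = 0" unfolding \<open>u = chord v y\<close> by (simp add: chord_def vec3_eq_iff)
    then show False using assms(2) by simp
  qed
  ultimately show ?thesis by blast
qed

lemma chord_scale: "chord v (c * fst y, c * snd y) = c *s chord v y"
  by (simp add: chord_def vec3_eq_iff algebra_simps add_divide_distrib diff_divide_distrib)

lemma chord_line_eqI:
  assumes "y \<noteq> 0" "z \<noteq> 0" "br y z = 0"
  shows "proj_line (chord v y) = proj_line (chord v z)"
  using br_zero_iff[OF assms(1,2)] assms(3) by (auto simp: chord_scale proj_line_scale)

lemma chord_prop_imp:
  assumes "v \<noteq> 0" "y \<noteq> 0" "z \<noteq> 0" "proj_line (chord v y) = proj_line (chord v z)"
  shows "br y z = 0"
proof -
  have 1: "br v z = 0 \<or> br y z = 0" using assms(3,4) ellipse_pt_in_chord[of z v y] ellipse_pt_in_chord[of z v z] by auto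
  have 2: "br v y = 0 \<or> br z y = 0" using assms(2,4) ellipse_pt_in_chord[of y v y] ellipse_pt_in_chord[of y v z] by auto
  show ?thesis
  proof (rule ccontr)
    assume "br y z \<noteq> 0"
    then have "br v z = 0" "br v y = 0" using 1 2 br_swap[of y z] by auto
    then show False using br_zero_trans[OF assms(1), of y z] br_swap[of y v] \<open>br y z \<noteq> 0\<close> by simp
  qed
qed

lemma ellipse_pt_eq_iff:
  assumes "v \<noteq> 0" "w \<noteq> 0"
  shows "ellipse_pt v = ellipse_pt w \<longleftrightarrow> br v w = 0"
proof
  assume "ellipse_pt v = ellipse_pt w"
  then show "br v w = 0" using ellipse_pt_in_chord[OF assms(1), of v v] ellipse_pt_in_chord[OF assms(2), of v v] by simp
next
  assume "br v w = 0"
  then obtain c where c: "c \<noteq> 0" "w = (c * fst v, c * snd v)" using br_zero_iff[OF assms] by blast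
  have "ellipse_vec w = c^2 *s ellipse_vec v"
    unfolding c(2) by (simp add: ellipse_vec_def vec3_eq_iff power2_eq_square algebra_simps)
  then show "ellipse_pt v = ellipse_pt w"
    unfolding ellipse_pt_def using c(1) by (subst eq_commute, subst abs_cp2_eq_iff) (auto simp: ellipse_vec_nonzero assms)
qed

lemma ellipse_mult: "ellipse a b *v x = vector [x$1 / of_real a ^ 2, x$2 / of_real b ^ 2, - x$3]"
  unfolding ellipse_def diag3_mult by simp

lemma ellipse_tangent_vec: "ellipse a b *v ellipse_vec v = chord v v"
  unfolding ellipse_mult by (simp add: ellipse_vec_def chord_def vec3_eq_iff power2_eq_square)

lemma ellipse_pt_in_ellipse:
  assumes "v \<noteq> 0"
  shows "ellipse_pt v \<in> conic_curve (ellipse a b)"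
  unfolding ellipse_pt_def abs_cp2_in_conic[OF ellipse_vec_nonzero[OF assms]] ellipse_tangent_vec
  using dot_chord[of v v v] by (simp add: dot3 mult.commute)

lemma ellipse_pt_cases:
  assumes "P \<in> conic_curve (ellipse a b)"
  shows "\<exists>v. v \<noteq> 0 \<and> P = ellipse_pt v"
proof -
  define x y z where "x = rep_cp2 P $ 1 / of_real a" and "y = rep_cp2 P $ 2 / of_real b" and "z = rep_cp2 P $ 3"
  have xyz: "x^2 + y^2 = z^2"
    using assms unfolding conic_curve_def
    by (simp add: ellipse_mult dot3 x_def y_def z_def power2_eq_square)
  \<comment> \<open>Inverts \<open>ellipse_vec\<close>: x + i y = 2 p^2 and x - i y = 2 q^2, with
    the sign of q dictated by 2 p q = z.\<close>
  define p q0 where "p = csqrt ((x + \<i> * y) / 2)" and "q0 = csqrt ((x - \<i> * y) / 2)"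
  have p: "2 * p^2 = x + \<i> * y" "2 * q0^2 = x - \<i> * y" by (simp_all add: p_def q0_def)
  have "(2 * p * q0)^2 = (2 * p^2) * (2 * q0^2)" by (simp add: power2_eq_square)
  also have "\<dots> = z^2" unfolding p xyz[symmetric] by (simp add: power2_eq_square algebra_simps)
  finally have "2 * p * q0 = z \<or> 2 * p * q0 = - z" by (simp only: power2_eq_iff)
  then obtain q where q: "2 * p * q = z" "q^2 = q0^2"
    by (metis minus_mult_right minus_minus power2_minus)
  have "2 * (p^2 + q^2) = 2 * x" "2 * (p^2 - q^2) = 2 * \<i> * y" using p unfolding q(2) by (simp_all add: algebra_simps)
  then have "p^2 + q^2 = x" "p^2 - q^2 = \<i> * y"
    by (metis mult_left_cancel zero_neq_numeral, metis mult.assoc mult_left_cancel zero_neq_numeral)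
  then have v: "rep_cp2 P = ellipse_vec (p, q)"
    using q(1) by (simp add: vec3_eq_iff ellipse_vec_def x_def y_def z_def)
  have "(p, q) \<noteq> 0"
  proof
    assume 0: "(p, q) = 0"
    have "ellipse_vec (p, q) = 0" unfolding 0 by (simp add: ellipse_vec_def vec3_eq_iff)
    then show False using v rep_cp2_nonzero by metis
  qed
  moreover have "P = ellipse_pt (p, q)" unfolding ellipse_pt_def v[symmetric] by simp
  ultimately show ?thesis by blast
qed

lemma tangent_line_ellipse_pt:
  assumes "v \<noteq> 0"
  shows "tangent_line (ellipse a b) (ellipse_pt v) = proj_line (chord v v)"
  using rep_abs_cp2[OF ellipse_vec_nonzero[OF assms]] unfolding tangent_line_def ellipse_pt_def
  by (auto simp: vector_scalar_commute ellipse_tangent_vec proj_line_scale)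

lemma line_through_ellipse_pts:
  assumes "v \<noteq> 0" "w \<noteq> 0" "br v w \<noteq> 0" "L \<in> lines" "ellipse_pt v \<in> L" "ellipse_pt w \<in> L"
  shows "L = proj_line (chord v w)"
proof -
  obtain u where u: "u \<noteq> 0" "L = proj_line u" using assms(4) by (auto simp: lines_def)
  have "dot u (ellipse_vec v) = 0"
    using assms(5) abs_cp2_in_line[OF ellipse_vec_nonzero[OF assms(1)]] by (simp add: u(2) ellipse_pt_def)
  then obtain y where y: "y \<noteq> 0" "u = chord v y" using line_through_ellipse_pt[OF assms(1) u(1)] by blast
  then have "br y w = 0" using assms(3,6) ellipse_pt_in_chord[OF assms(2), of v y] u(2) by simp
  then show ?thesis using chord_line_eqI[OF y(1) assms(2)] y(2) u(2) by simp
qed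

lemma side_chord:
  assumes "v \<noteq> 0" "w \<noteq> 0" "br v w \<noteq> 0"
  shows "line_through (ellipse_pt v) (ellipse_pt w) = proj_line (chord v w)"
  unfolding line_through_def
proof (rule the_equality)
  show "proj_line (chord v w) \<in> lines \<and> ellipse_pt v \<in> proj_line (chord v w) \<and> ellipse_pt w \<in> proj_line (chord v w)"
    using chord_nonzero[OF assms(1,2)] by (auto simp: lines_def ellipse_pt_in_chord assms(1,2))
qed (use line_through_ellipse_pts[OF assms] in blast)

text \<open>Every line meets the ellipse, so both covectors are chords from a common point and can
  be compared by their other end points.\<close>

lemma proj_line_inject:
  assumes "u \<noteq> 0" "w \<noteq> 0" "proj_line u = proj_line w"
  shows "\<exists>k. k \<noteq> 0 \<and> u = k *s w"
proof -
  obtain v where v: "v \<noteq> 0" "dot u (ellipse_vec v) = 0" using qform_has_root[OF ellipse_qform] by blast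
  then have "dot w (ellipse_vec v) = 0"
    using assms(3) abs_cp2_in_line[OF ellipse_vec_nonzero[OF v(1)]] by metis
  with v obtain y z where y: "y \<noteq> 0" "u = chord v y" and z: "z \<noteq> 0" "w = chord v z"
    using line_through_ellipse_pt assms(1,2) by metis
  have "br z y = 0" using chord_prop_imp[OF v(1) z(1) y(1)] assms(3) y z by simp
  then obtain c where "c \<noteq> 0" "y = (c * fst z, c * snd z)" using br_zero_iff[OF z(1) y(1)] by blast
  then show ?thesis using y(2) z(2) chord_scale by metis
qed


section \<open>Confocal conics\<close>

text \<open>The dual conic, whose zeros are the tangent lines. Unlike the equation of the conic it
  is affine in \<open>l\<close>, and it remains defined at the excluded parameters.\<close>

definition dual_form :: "complex \<Rightarrow> complex^3 \<Rightarrow> complex^3 \<Rightarrow> complex" where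
  "dual_form l u w = (of_real a ^ 2 + l) * u$1 * w$1 + (of_real b ^ 2 + l) * u$2 * w$2 - u$3 * w$3"

definition chord_form :: "complex \<Rightarrow> complex \<times> complex \<Rightarrow> complex \<times> complex \<Rightarrow> complex" where
  "chord_form l v w = dual_form l (chord v w) (chord v w)"

text \<open>\<open>A\<close> and \<open>B\<close> are the squared semiaxes relative to those of the
  ellipse: both are 1 at the parameter 0, and their zeros are the other two excluded
  parameters.\<close>

definition A :: "complex \<Rightarrow> complex" where "A l = 1 + l * (1 / of_real a ^ 2)"
definition B :: "complex \<Rightarrow> complex" where "B l = 1 + l * (1 / of_real b ^ 2)"
definition k :: "complex \<Rightarrow> complex" where "k l = A l - B l"
definition h :: "complex \<Rightarrow> complex" where "h l = A l + B l - 1"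

definition admissible :: "complex \<Rightarrow> bool" where
  "admissible l \<longleftrightarrow> l \<notin> {0, - (of_real a ^ 2), - (of_real b ^ 2)}"

lemma A_eq: "of_real a ^ 2 + l = of_real a ^ 2 * A l" and B_eq: "of_real b ^ 2 + l = of_real b ^ 2 * B l"
  by (simp_all add: A_def B_def algebra_simps)

lemma chord_form_eq:
  "chord_form l v w = k l * (fst v ^ 2 * fst w ^ 2 + snd v ^ 2 * snd w ^ 2)
     - fst v ^ 2 * snd w ^ 2 - snd v ^ 2 * fst w ^ 2 + 2 * h l * fst v * snd v * fst w * snd w"
proof -
  have 1: "of_real a * chord v w $ 1 = fst v * fst w + snd v * snd w"
    and 2: "of_real b * chord v w $ 2 = - \<i> * (fst v * fst w - snd v * snd w)"
    and 3: "chord v w $ 3 = - (fst v * snd w + snd v * fst w)"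
    by (simp_all add: chord_def)
  have "chord_form l v w = A l * (of_real a * chord v w $ 1)^2 + B l * (of_real b * chord v w $ 2)^2 - chord v w $ 3 ^ 2"
    unfolding chord_form_def dual_form_def A_eq B_eq by (simp add: power2_eq_square mult_ac)
  also have "\<dots> = A l * (fst v * fst w + snd v * snd w)^2 - B l * (fst v * fst w - snd v * snd w)^2
      - (fst v * snd w + snd v * fst w)^2"
  proof -
    have "(- \<i> * x)^2 = - (x^2)" for x by (simp add: power_mult_distrib)
    then show ?thesis unfolding 1 2 3 by (simp only: power2_minus) simp
  qed
  finally show ?thesis unfolding k_def h_def by (simp add: power2_eq_square algebra_simps)
qed

lemma AB_distinct: "l \<noteq> 0 \<Longrightarrow> A l \<noteq> B l" "l \<noteq> 0 \<Longrightarrow> A l \<noteq> 1" "l \<noteq> 0 \<Longrightarrow> B l \<noteq> 1"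
proof -
  have "a^2 \<noteq> b^2" using b_pos b_less_a by (simp add: power2_eq_iff)
  then have "complex_of_real (a^2) \<noteq> of_real (b^2)" by (simp only: of_real_eq_iff) simp
  then show "l \<noteq> 0 \<Longrightarrow> A l \<noteq> B l" by (simp add: A_def B_def)
  show "l \<noteq> 0 \<Longrightarrow> A l \<noteq> 1" "l \<noteq> 0 \<Longrightarrow> B l \<noteq> 1" by (simp_all add: A_def B_def)
qed

lemma A_zero_iff: "A l = 0 \<longleftrightarrow> l = - (of_real a ^ 2)" and B_zero_iff: "B l = 0 \<longleftrightarrow> l = - (of_real b ^ 2)"
proof -
  have "of_real a ^ 2 * A l = 0 \<longleftrightarrow> of_real a ^ 2 + l = 0" "of_real b ^ 2 * B l = 0 \<longleftrightarrow> of_real b ^ 2 + l = 0"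
    using A_eq B_eq by simp_all
  then show "A l = 0 \<longleftrightarrow> l = - (of_real a ^ 2)" "B l = 0 \<longleftrightarrow> l = - (of_real b ^ 2)"
    by (simp_all add: add_eq_0_iff)
qed

lemma admissibleD:
  assumes "admissible l"
  shows "l \<noteq> 0" "A l \<noteq> 0" "B l \<noteq> 0" "A l \<noteq> B l" "A l \<noteq> 1" "B l \<noteq> 1" "k l \<noteq> 0"
    "of_real a ^ 2 + l \<noteq> 0" "of_real b ^ 2 + l \<noteq> 0"
  using assms AB_distinct[of l] unfolding A_eq B_eq by (auto simp: admissible_def A_zero_iff B_zero_iff k_def)

lemma chord_form_qform: "qform (chord_form l v)"
  unfolding qform_def
  by (intro exI[of _ "k l * fst v ^ 2 - snd v ^ 2"] exI[of _ "2 * h l * fst v * snd v"]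
      exI[of _ "k l * snd v ^ 2 - fst v ^ 2"]) (simp add: chord_form_eq algebra_simps)

text \<open>A point related to every other one would force h = 0 and k = 1 or k = -1, that is A = 0
  or B = 0.\<close>

lemma biquadratic_chord_form:
  assumes "admissible l"
  shows "biquadratic (chord_form l)"
proof
  show "chord_form l x y = chord_form l y x" for x y by (simp add: chord_form_eq algebra_simps)
  show "qform (chord_form l x)" for x by (rule chord_form_qform)
  show "\<exists>y. chord_form l x y \<noteq> 0" if "x \<noteq> 0" for x
  proof (rule ccontr)
    assume "\<not> (\<exists>y. chord_form l x y \<noteq> 0)"
    then have 0: "chord_form l x y = 0" for y by blast
    have 1: "k l * fst x ^ 2 = snd x ^ 2" "k l * snd x ^ 2 = fst x ^ 2"
      using 0[of "(1, 0)"] 0[of "(0, 1)"] by (simp_all add: chord_form_eq)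
    have "2 * (h l * fst x * snd x) = 0" using 0[of "(1, 1)"] 1 by (simp add: chord_form_eq algebra_simps)
    then have 2: "h l * fst x * snd x = 0" by (simp only: mult_eq_0_iff) simp
    have x: "fst x \<noteq> 0" "snd x \<noteq> 0" using 1 that admissibleD(7)[OF assms] by (auto simp: prod_eq_iff)
    have "k l * k l * fst x ^ 2 = fst x ^ 2" using 1 by (simp add: mult.assoc)
    then have "k l ^ 2 = 1" using x by (simp add: power2_eq_square)
    then have "k l = 1 \<or> k l = - 1" by (simp add: power2_eq_1_iff)
    moreover have "A l + B l = 1" using 2 x by (simp add: h_def)
    moreover have "2 * A l = (A l + B l) + k l" "2 * B l = (A l + B l) - k l" by (simp_all add: k_def)
    ultimately have "2 * A l = 0 \<or> 2 * B l = 0" by auto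
    then show False using admissibleD(2,3)[OF assms] by simp
  qed
qed

lemma confocal_mult:
  "confocal a b l *v x = vector [x$1 / (of_real a ^ 2 + l), x$2 / (of_real b ^ 2 + l), - x$3]"
  unfolding confocal_def diag3_mult by simp

lemma tangent_lines_iff:
  assumes l: "admissible l" and u: "u \<noteq> 0"
  shows "proj_line u \<in> tangent_lines (confocal a b l) \<longleftrightarrow> dual_form l u u = 0"
proof
  assume "proj_line u \<in> tangent_lines (confocal a b l)"
  then obtain P where P: "P \<in> conic_curve (confocal a b l)" "proj_line u = proj_line (confocal a b l *v rep_cp2 P)"
    by (auto simp: tangent_lines_def tangent_line_def)
  define x where "x = rep_cp2 P"
  have "x \<noteq> 0" by (simp add: x_def)
  then have "confocal a b l *v x \<noteq> 0" using admissibleD(8,9)[OF l] by (simp add: confocal_mult vec3_eq_iff)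
  then obtain c where c: "u = c *s (confocal a b l *v x)" using proj_line_inject[OF u] P(2) by (auto simp: x_def)
  have "dual_form l u u = c^2 * dot x (confocal a b l *v x)"
  proof -
    have "s * (c * (y / s)) * (c * (y / s)) = c^2 * (y * (y / s))" if "s \<noteq> 0" for s y
      using that by (simp add: power2_eq_square)
    note e = this[OF admissibleD(8)[OF l]] this[OF admissibleD(9)[OF l]]
    show ?thesis
      unfolding c dual_form_def dot3 confocal_mult vector_smult_component vector_3 e
      by (simp only: power2_eq_square) (simp add: algebra_simps)
  qed
  then show "dual_form l u u = 0" using P(1) by (simp add: conic_curve_def x_def)
next
  assume 0: "dual_form l u u = 0"
  \<comment> \<open>The point of contact, obtained by applying the inverse of the matrix of the
    conic to \<open>u\<close>.\<close>
  define x :: "complex^3" where "x = vector [(of_real a ^ 2 + l) * u$1, (of_real b ^ 2 + l) * u$2, - u$3]"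
  have x: "x \<noteq> 0" using u admissibleD(8,9)[OF l] by (simp add: x_def vec3_eq_iff)
  have u': "confocal a b l *v x = u" using admissibleD(8,9)[OF l] by (simp add: confocal_mult x_def vec3_eq_iff)
  have "abs_cp2 x \<in> conic_curve (confocal a b l)"
    unfolding abs_cp2_in_conic[OF x] u' using 0 by (simp add: dot3 x_def dual_form_def)
  moreover obtain c where "c \<noteq> 0" "rep_cp2 (abs_cp2 x) = c *s x" using rep_abs_cp2[OF x] by blast
  then have "tangent_line (confocal a b l) (abs_cp2 x) = proj_line u"
    by (simp add: tangent_line_def vector_scalar_commute u' proj_line_scale)
  ultimately show "proj_line u \<in> tangent_lines (confocal a b l)" unfolding tangent_lines_def by blast
qed

lemma chord_tangent_iff:
  assumes "admissible l" "v \<noteq> 0" "w \<noteq> 0"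
  shows "proj_line (chord v w) \<in> tangent_lines (confocal a b l) \<longleftrightarrow> chord_form l v w = 0"
  using tangent_lines_iff[OF assms(1) chord_nonzero[OF assms(2,3)]] by (simp add: chord_form_def)

text \<open>The discriminant of \<open>chord_form l v\<close> computed in two ways: from the zeros
  it is the square of \<kappa> br x y, from the coefficients it is -4 A B times the equation of the
  conic at the point.\<close>

lemma ellipse_pt_in_confocal_iff:
  assumes l: "admissible l" and v: "v \<noteq> 0" and F: "\<And>z. chord_form l v z = \<kappa> * br x z * br y z" and \<kappa>: "\<kappa> \<noteq> 0"
  shows "ellipse_pt v \<in> conic_curve (confocal a b l) \<longleftrightarrow> br x y = 0"
proof -
  define p q where "p = fst v" and "q = snd v"
  have c1: "k l * p^2 - q^2 = \<kappa> * snd x * snd y" and c3: "k l * q^2 - p^2 = \<kappa> * fst x * fst y"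
    using F[of "(1, 0)"] F[of "(0, 1)"] by (simp_all add: chord_form_eq br_def p_def q_def)
  have c2: "2 * h l * p * q = - \<kappa> * (fst x * snd y + snd x * fst y)"
  proof -
    have "2 * h l * p * q = \<kappa> * br x (1, 1) * br y (1, 1) - (k l * p^2 - q^2) - (k l * q^2 - p^2)"
      using F[of "(1, 1)"] by (simp add: chord_form_eq p_def q_def algebra_simps)
    then show ?thesis unfolding c1 c3 by (simp add: br_def algebra_simps)
  qed
  have "(2 * h l * p * q)^2 - 4 * (k l * p^2 - q^2) * (k l * q^2 - p^2) = \<kappa>^2 * br x y ^ 2"
    unfolding c1 c2 c3 br_def by (simp add: power2_eq_square algebra_simps)
  moreover have "(2 * h l * p * q)^2 - 4 * (k l * p^2 - q^2) * (k l * q^2 - p^2) =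
     4 * (A l * (p^2 - q^2)^2 - B l * (p^2 + q^2)^2 + 4 * A l * B l * p^2 * q^2)"
    unfolding h_def k_def by (simp add: power2_eq_square algebra_simps)
  moreover have "A l * B l * dot (ellipse_vec v) (confocal a b l *v ellipse_vec v) =
     - (A l * (p^2 - q^2)^2 - B l * (p^2 + q^2)^2 + 4 * A l * B l * p^2 * q^2)"
  proof -
    have "dot (ellipse_vec v) (confocal a b l *v ellipse_vec v) =
      (p^2 + q^2)^2 / A l - (p^2 - q^2)^2 / B l - 4 * p^2 * q^2"
    proof -
      have "ellipse_vec v $ 2 * ellipse_vec v $ 2 = - (of_real b ^ 2 * (p^2 - q^2)^2)"
        by (simp add: ellipse_vec_def p_def[symmetric] q_def[symmetric] power2_eq_square algebra_simps)
      then have "ellipse_vec v $ 2 * (ellipse_vec v $ 2 / (of_real b ^ 2 * B l)) = - ((p^2 - q^2)^2 / B l)" by simp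
      moreover have "ellipse_vec v $ 1 * (ellipse_vec v $ 1 / (of_real a ^ 2 * A l)) = (p^2 + q^2)^2 / A l"
        "ellipse_vec v $ 3 * (- ellipse_vec v $ 3) = - (4 * p^2 * q^2)"
        by (simp_all add: ellipse_vec_def p_def[symmetric] q_def[symmetric] power2_eq_square)
      ultimately show ?thesis unfolding dot3 confocal_mult A_eq B_eq by simp
    qed
    moreover have "x * y * (s / x - d / y - e) = y * s - x * d - x * y * e" if "x \<noteq> 0" "y \<noteq> 0" for x y s d e :: complex
      using that by (simp add: field_simps)
    ultimately show ?thesis using admissibleD(2,3)[OF l] by (simp add: mult.assoc)
  qed
  ultimately have "4 * (A l * B l * dot (ellipse_vec v) (confocal a b l *v ellipse_vec v)) = - (\<kappa>^2 * br x y ^ 2)"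
    by simp
  then show ?thesis
    unfolding ellipse_pt_def abs_cp2_in_conic[OF ellipse_vec_nonzero[OF v]]
    using admissibleD(2,3)[OF l] \<kappa> by auto
qed

text \<open>Multiplicities of tangent lines agree with multiplicities of zeros of
  \<open>chord_form l v\<close>, because a double zero occurs exactly when the point lies on the
  conic.\<close>

lemma tangent_mult_iff:
  assumes l: "admissible l" and v: "v \<noteq> 0" and xy: "x \<noteq> 0" "y \<noteq> 0"
  shows "(\<forall>t. tangent_mult (confocal a b l) (ellipse_pt v) t =
      count {# proj_line (chord v x), proj_line (chord v y) #} t) \<longleftrightarrow>
    (\<exists>\<kappa>. \<kappa> \<noteq> 0 \<and> (\<forall>z. chord_form l v z = \<kappa> * br y z * br x z))" (is "?L \<longleftrightarrow> ?R")
proof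
  let ?D = "confocal a b l"
  assume ?L
  then have 0: "tangent_mult ?D (ellipse_pt v) (proj_line (chord v x)) \<noteq> 0"
    "tangent_mult ?D (ellipse_pt v) (proj_line (chord v y)) \<noteq> 0" by simp_all
  then have Fx: "chord_form l v x = 0" and Fy: "chord_form l v y = 0"
    using chord_tangent_iff[OF l v] xy by (auto simp: tangent_mult_def split: if_splits)
  interpret biquadratic "chord_form l" by (rule biquadratic_chord_form[OF l])
  obtain m where m: "m \<noteq> 0" "\<And>z. chord_form l v z = br m z * br x z"
    using factor_at_root[OF v xy(1) Fx] by blast
  have "br m y = 0"
  proof (cases "br x y = 0")
    case True
    then have "proj_line (chord v x) = proj_line (chord v y)" using chord_line_eqI xy by blast
    then have "tangent_mult ?D (ellipse_pt v) (proj_line (chord v x)) = 2" using \<open>?L\<close> by simp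
    then have "ellipse_pt v \<in> conic_curve ?D" by (simp add: tangent_mult_def split: if_splits)
    then have "br m x = 0" using ellipse_pt_in_confocal_iff[OF l v, of 1 m x] m(2) by simp
    then show ?thesis using br_zero_trans[OF xy(1) _ True] by blast
  next
    case False
    then show ?thesis using Fy m(2) by simp
  qed
  then obtain c where "c \<noteq> 0" "m = (c * fst y, c * snd y)"
    using br_zero_iff[OF xy(2) m(1)] br_swap[of m y] by auto
  then show ?R using m(2) by (intro exI[of _ c]) (simp add: br_def algebra_simps)
next
  let ?D = "confocal a b l"
  assume ?R
  then obtain \<kappa> where \<kappa>: "\<kappa> \<noteq> 0" "\<And>z. chord_form l v z = \<kappa> * br y z * br x z" by blast
  have conic: "ellipse_pt v \<in> conic_curve ?D \<longleftrightarrow> br y x = 0"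
    by (rule ellipse_pt_in_confocal_iff[OF l v \<kappa>(2,1)])
  have same: "proj_line (chord v x) = proj_line (chord v y) \<longleftrightarrow> br y x = 0"
    using chord_line_eqI[OF xy] chord_prop_imp[OF v xy] br_swap[of x y] by (metis neg_equal_0_iff_equal)
  have tl: "t \<in> tangent_lines ?D \<and> ellipse_pt v \<in> t \<longleftrightarrow> t = proj_line (chord v x) \<or> t = proj_line (chord v y)" for t
  proof
    assume t: "t \<in> tangent_lines ?D \<and> ellipse_pt v \<in> t"
    then obtain P where P: "t = proj_line (confocal a b l *v rep_cp2 P)"
      by (auto simp: tangent_lines_def tangent_line_def)
    have "confocal a b l *v rep_cp2 P \<noteq> 0"
    proof
      assume "confocal a b l *v rep_cp2 P = 0"
      then have "rep_cp2 P = 0" using admissibleD(8,9)[OF l] by (simp add: confocal_mult vec3_eq_iff)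
      then show False by simp
    qed
    moreover have "dot (confocal a b l *v rep_cp2 P) (ellipse_vec v) = 0"
      using t abs_cp2_in_line[OF ellipse_vec_nonzero[OF v]] by (simp add: P ellipse_pt_def)
    ultimately obtain z where z: "z \<noteq> 0" "t = proj_line (chord v z)"
      using line_through_ellipse_pt[OF v] P by metis
    then have "br y z = 0 \<or> br x z = 0" using t chord_tangent_iff[OF l v z(1)] \<kappa> by simp
    then show "t = proj_line (chord v x) \<or> t = proj_line (chord v y)"
      using chord_line_eqI xy z by metis
  next
    assume "t = proj_line (chord v x) \<or> t = proj_line (chord v y)"
    then show "t \<in> tangent_lines ?D \<and> ellipse_pt v \<in> t"
      using chord_tangent_iff[OF l v xy(1)] chord_tangent_iff[OF l v xy(2)] \<kappa>(2)
      by (auto simp: ellipse_pt_in_chord[OF v])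
  qed
  show ?L unfolding tangent_mult_def tl conic using same by auto
qed


section \<open>Polygons and billiard orbits\<close>

text \<open>\<open>chord v w\<close> is linear in \<open>w\<close>, so a point on two different
  lines through the point of \<open>v\<close> lies on all lines through it.\<close>

lemma common_point_of_chords:
  assumes v: "v \<noteq> 0" and x: "x \<noteq> 0" and yz: "br y z \<noteq> 0"
    and 0: "dot (chord v y) x = 0" "dot (chord v z) x = 0"
  shows "abs_cp2 x = ellipse_pt v"
proof -
  have lin: "br y z * dot (chord v w) x = br w z * dot (chord v y) x + br y w * dot (chord v z) x" for w
    unfolding dot3 chord_def br_def by (simp add: add_divide_distrib diff_divide_distrib algebra_simps)
  have all: "dot (chord v w) x = 0" for w using lin[of w] 0 yz by simp
  define p q where "p = fst v" and "q = snd v"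
  define X Y Z where "X = x$1 / of_real a" and "Y = - \<i> * x$2 / of_real b" and "Z = x$3"
  have 1: "p * (X + Y) = q * Z" using all[of "(1, 0)"]
    by (simp add: dot3 chord_def X_def Y_def Z_def p_def q_def algebra_simps)
  have 2: "q * (X - Y) = p * Z" using all[of "(0, 1)"]
    by (simp add: dot3 chord_def X_def Y_def Z_def p_def q_def algebra_simps)
  have "\<exists>c. X + Y = 2 * q^2 * c \<and> X - Y = 2 * p^2 * c \<and> Z = 2 * p * q * c"
  proof (cases "p = 0")
    case True
    then have "q \<noteq> 0" using v by (simp add: p_def q_def prod_eq_iff)
    then have "Z = 0" "X - Y = 0" using 1 2 True by simp_all
    then show ?thesis using True \<open>q \<noteq> 0\<close> by (intro exI[of _ "(X + Y) / (2 * q^2)"]) simp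
  next
    case False
    have Z: "Z = q * (X - Y) / p" using 2 False by (simp add: field_simps)
    have "X + Y = q * Z / p" using 1 False by (simp add: field_simps)
    then show ?thesis using False Z
      by (intro exI[of _ "(X - Y) / (2 * p^2)"]) (simp add: power2_eq_square)
  qed
  then obtain c where c: "X + Y = 2 * q^2 * c" "X - Y = 2 * p^2 * c" "Z = 2 * p * q * c" by blast
  have "2 * X = 2 * ((p^2 + q^2) * c)" using arg_cong2[OF c(1,2), of "(+)"] by (simp add: algebra_simps)
  then have X: "X = (p^2 + q^2) * c" by (metis mult_left_cancel zero_neq_numeral)
  have Y: "Y = - (p^2 - q^2) * c" using c(1) unfolding X by (simp add: algebra_simps)
  have x1: "x$1 = of_real a * X" and x2: "x$2 = \<i> * of_real b * Y" and x3: "x$3 = Z"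
    by (simp_all add: X_def Y_def Z_def)
  have "x = c *s ellipse_vec v"
    unfolding vec3_eq_iff x1 x2 x3 X Y c(3) by (simp add: ellipse_vec_def p_def q_def algebra_simps)
  moreover from this have "c \<noteq> 0" using x by auto
  ultimately show ?thesis unfolding ellipse_pt_def
    using abs_cp2_eq_iff[OF x ellipse_vec_nonzero[OF v]] by blast
qed

lemma order_pCons_0:
  assumes "p \<noteq> (0 :: complex poly)"
  shows "Polynomial.order 0 (pCons 0 p) = Suc (Polynomial.order 0 p)"
proof -
  have "pCons 0 p = [:- 0, 1:] ^ 1 * p" by simp
  moreover have "Polynomial.order 0 ([:- 0, 1:] ^ 1 :: complex poly) = 1" by (rule order_power_n_n)
  ultimately show ?thesis using assms by (metis order_mult mult_eq_0_iff one_neq_zero pCons_eq_0_iff plus_1_eq_Suc power_one_right)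
qed

lemma ellipse_symmetric: "dot x (ellipse a b *v y) = dot (ellipse a b *v x) y"
  unfolding dot3 ellipse_mult by simp

lemma other_point_on_chord:
  assumes v: "v \<noteq> 0" and w: "w \<noteq> 0"
  shows "\<exists>R. R \<in> proj_line (chord v w) \<and> R \<noteq> ellipse_pt v"
proof (cases "br v w = 0")
  case False
  then show ?thesis using ellipse_pt_eq_iff[OF v w] ellipse_pt_in_chord[OF w, of v w] by (metis br_self)
next
  case True
  obtain y where y: "br v y \<noteq> 0"
  proof (cases "fst v = 0")
    case True
    then show ?thesis using that[of "(1, 0)"] v by (simp add: br_def prod_eq_iff)
  next
    case False
    then show ?thesis using that[of "(0, 1)"] by (simp add: br_def)
  qed
  \<comment> \<open>In the tangent case, the intersection of the tangents at \<open>v\<close> and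
    \<open>y\<close>, found by polarizing \<open>ellipse_vec\<close>. It lies off the
    ellipse.\<close>
  define x :: "complex^3" where "x = vector [of_real a * (fst v * fst y + snd v * snd y),
    - \<i> * of_real b * (fst v * fst y - snd v * snd y), fst v * snd y + snd v * fst y]"
  have "2 * dot (chord v w) x = dot (chord v w) (ellipse_vec (fst v + fst y, snd v + snd y))
     - dot (chord v w) (ellipse_vec v) - dot (chord v w) (ellipse_vec y)"
    unfolding dot3 x_def ellipse_vec_def by (simp add: power2_eq_square algebra_simps)
  also have "\<dots> = 2 * (br v y * br w v + br v v * br w y)"
    unfolding dot_chord br_def by (simp add: algebra_simps)
  also have "\<dots> = 0" using True br_swap[of v w] by simp
  finally have dx: "dot (chord v w) x = 0" by simp
  have "dot x (ellipse a b *v x) = - ((br v y)^2)"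
  proof -
    have "x$1 * (x$1 / of_real a ^ 2) = (fst v * fst y + snd v * snd y)^2"
      "x$2 * (x$2 / of_real b ^ 2) = - ((fst v * fst y - snd v * snd y)^2)"
      by (simp_all add: x_def power2_eq_square) (simp add: algebra_simps)
    then show ?thesis unfolding dot3 ellipse_mult br_def by (simp add: x_def power2_eq_square algebra_simps)
  qed
  then have ne: "dot x (ellipse a b *v x) \<noteq> 0" using y by simp
  then have x0: "x \<noteq> 0" by (auto simp: dot3)
  show ?thesis
  proof (intro exI conjI)
    show "abs_cp2 x \<in> proj_line (chord v w)" using abs_cp2_in_line[OF x0] dx by simp
    show "abs_cp2 x \<noteq> ellipse_pt v"
      using abs_cp2_in_conic[OF x0] ne ellipse_pt_in_ellipse[OF v] by metis
  qed
qed

text \<open>The linear coefficient is the tangent at \<open>v\<close> evaluated at the second point,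
  so it vanishes only for the tangent line. The quadratic coefficient is then nonzero because a
  tangent meets the ellipse only once.\<close>

lemma intersection_mult_vertex:
  assumes v: "v \<noteq> 0" and w: "w \<noteq> 0"
  shows "intersection_mult (ellipse a b) (proj_line (chord v w)) (ellipse_pt v) = (if br v w = 0 then 2 else 1)"
proof -
  let ?L = "proj_line (chord v w)"
  define R where "R = (SOME R. R \<in> ?L \<and> R \<noteq> ellipse_pt v)"
  have R: "R \<in> ?L" "R \<noteq> ellipse_pt v"
    using someI_ex[OF other_point_on_chord[OF v w]] by (simp_all add: R_def)
  define p r where "p = rep_cp2 (ellipse_pt v)" and "r = rep_cp2 R"
  obtain c where c: "c \<noteq> 0" "p = c *s ellipse_vec v"
    using rep_abs_cp2[OF ellipse_vec_nonzero[OF v]] by (auto simp: p_def ellipse_pt_def)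
  have Lr: "dot (chord v w) r = 0" using R(1) by (simp add: proj_line_def r_def)
  have Ep: "ellipse a b *v p = c *s chord v v" by (simp add: c(2) vector_scalar_commute ellipse_tangent_vec)
  have pp: "dot p (ellipse a b *v p) = 0"
  proof -
    have "dot p (ellipse a b *v p) = dot (c *s chord v v) p" using ellipse_symmetric[of p p] unfolding Ep .
    then show ?thesis using dot_chord[of v v v] by (simp add: c(2) dot_scale)
  qed
  have pr: "dot p (ellipse a b *v r) + dot r (ellipse a b *v p) = 2 * c * dot (chord v v) r"
    unfolding ellipse_symmetric[of p r] Ep by (simp add: dot3 algebra_simps)
  have mem: "ellipse_pt v \<in> ?L" by (simp add: ellipse_pt_in_chord v)
  have im: "intersection_mult (ellipse a b) ?L (ellipse_pt v) =
      Polynomial.order 0 [:0, 2 * c * dot (chord v v) r, dot r (ellipse a b *v r):]"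
    unfolding intersection_mult_def Let_def R_def[symmetric] p_def[symmetric] r_def[symmetric] pp pr using mem by simp
  show ?thesis
  proof (cases "br v w = 0")
    case True
    then have "?L = proj_line (chord v v)" using chord_line_eqI[OF w v] br_swap[of v w] by simp
    then have t: "dot (chord v v) r = 0" using R(1) by (simp add: proj_line_def r_def)
    have "R \<notin> conic_curve (ellipse a b)"
    proof
      assume "R \<in> conic_curve (ellipse a b)"
      then obtain z where z: "z \<noteq> 0" "R = ellipse_pt z" using ellipse_pt_cases by blast
      then have "br v z = 0" using R(1) \<open>?L = proj_line (chord v v)\<close> ellipse_pt_in_chord[OF z(1), of v v] by simp
      then show False using R(2) z ellipse_pt_eq_iff[OF v z(1)] by simp
    qed
    then have d: "dot r (ellipse a b *v r) \<noteq> 0" by (simp add: conic_curve_def r_def)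
    then show ?thesis unfolding im t using True by (simp add: order_pCons_0 order_0I)
  next
    case False
    have "dot (chord v v) r \<noteq> 0"
    proof
      assume "dot (chord v v) r = 0"
      moreover have "r \<noteq> 0" by (simp add: r_def)
      ultimately have "abs_cp2 r = ellipse_pt v" using common_point_of_chords[OF v _ False] Lr by blast
      then show False using R(2) by (simp add: r_def)
    qed
    then show ?thesis unfolding im using False c(1) by (simp add: order_pCons_0 order_0I)
  qed
qed

lemma intersection_mult_chord:
  assumes v: "v \<noteq> 0" and w: "w \<noteq> 0"
  shows "intersection_mult (ellipse a b) (proj_line (chord v w)) P = count {# ellipse_pt v, ellipse_pt w #} P"
proof -
  let ?L = "proj_line (chord v w)"
  have vw: "ellipse_pt v \<in> ?L" "ellipse_pt w \<in> ?L" by (simp_all add: ellipse_pt_in_chord v w)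
  consider "P \<notin> ?L" | "P \<in> ?L" "P \<notin> conic_curve (ellipse a b)" | "P = ellipse_pt v" | "P = ellipse_pt w"
  proof (cases "P \<in> ?L \<and> P \<in> conic_curve (ellipse a b)")
    case True
    then obtain z where z: "z \<noteq> 0" "P = ellipse_pt z" using ellipse_pt_cases by blast
    then have "br v z = 0 \<or> br w z = 0" using True ellipse_pt_in_chord by blast
    then show ?thesis using that(3,4) z ellipse_pt_eq_iff v w by metis
  qed (use that(1,2) in blast)
  then show ?thesis
  proof cases
    case 1
    then have "P \<noteq> ellipse_pt v" "P \<noteq> ellipse_pt w" using vw by auto
    then show ?thesis using 1 by (auto simp: intersection_mult_def)
  next
    case 2
    then have ne: "P \<noteq> ellipse_pt v" "P \<noteq> ellipse_pt w" using ellipse_pt_in_ellipse v w by metis+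
    have "dot (rep_cp2 P) (ellipse a b *v rep_cp2 P) \<noteq> 0" using 2(2) by (simp add: conic_curve_def)
    then have "intersection_mult (ellipse a b) ?L P = 0"
      unfolding intersection_mult_def Let_def by (simp add: order_0I)
    then show ?thesis using ne by simp
  next
    case 3
    then show ?thesis using intersection_mult_vertex[OF v w] ellipse_pt_eq_iff[OF v w] by auto
  next
    case 4
    then show ?thesis using intersection_mult_vertex[OF w v] ellipse_pt_eq_iff[OF v w]
      by (auto simp: chord_commute[of w v] br_swap[of v w])
  qed
qed

lemma chord_linear: "chord v (fst x - c * fst y, snd x - c * snd y) = chord v x - c *s chord v y"
  by (simp add: chord_def vec3_eq_iff add_divide_distrib diff_divide_distrib algebra_simps)

lemma dual_form_split: "dual_form l u w = dual_form 0 u w + l * (u$1 * w$1 + u$2 * w$2)"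
  by (simp add: dual_form_def algebra_simps)

text \<open>With respect to the ellipse, a tangent is conjugate to every line through its point of
  contact. By \<open>dual_form_split\<close>, for such lines conjugacy to the tangent in any other
  confocal conic is therefore perpendicularity.\<close>

lemma dual_form_tangent: "dual_form 0 (chord v v) (chord v y) = 0"
proof -
  have "of_real a * chord v w $ 1 = fst v * fst w + snd v * snd w"
    "of_real b * chord v w $ 2 = - \<i> * (fst v * fst w - snd v * snd w)"
    "chord v w $ 3 = - (fst v * snd w + snd v * fst w)" for w
    by (simp_all add: chord_def)
  note 1 = this
  have "dual_form 0 (chord v v) (chord v y) = (of_real a * chord v v $ 1) * (of_real a * chord v y $ 1)
      + (of_real b * chord v v $ 2) * (of_real b * chord v y $ 2) - chord v v $ 3 * chord v y $ 3"
    unfolding dual_form_def by (simp add: power2_eq_square)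
  also have "\<dots> = 0" unfolding 1 by (simp add: power2_eq_square algebra_simps)
  finally show ?thesis .
qed

lemma chord_form_tangent: "chord_form l v v = l * axis_norm (chord v v)"
  unfolding chord_form_def dual_form_split[of l] dual_form_tangent by (simp add: axis_norm_def power2_eq_square)

lemma dual_form_polar:
  assumes "\<And>z. chord_form l v z = \<kappa> * br x z * br y z"
  shows "2 * dual_form l (chord v w) (chord v z) = \<kappa> * (br x w * br y z + br x z * br y w)"
proof -
  have lin: "chord v (fst z + fst w, snd z + snd w) = chord v z + chord v w"
    by (simp add: chord_def vec3_eq_iff add_divide_distrib diff_divide_distrib algebra_simps)
  have "2 * dual_form l (chord v w) (chord v z) =
     chord_form l v (fst z + fst w, snd z + snd w) - chord_form l v z - chord_form l v w"
    unfolding chord_form_def lin unfolding dual_form_def by (simp add: algebra_simps)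
  then show ?thesis unfolding assms by (simp add: br_def algebra_simps)
qed

text \<open>On the lines through \<open>v\<close>, the Euclidean reflection in the tangent is also
  the reflection with respect to \<open>dual_form l\<close>, since products with the tangent agree
  up to the factor \<open>l\<close>. It therefore exchanges the two zeros of that form.\<close>

lemma reflection_swaps_tangents:
  assumes l: "admissible l" and nz: "v \<noteq> 0" "x \<noteq> 0" "y \<noteq> 0" and \<kappa>: "\<kappa> \<noteq> 0"
    and F: "\<And>z. chord_form l v z = \<kappa> * br x z * br y z" and N: "axis_norm (chord v v) \<noteq> 0"
  shows "line_symmetry (proj_line (chord v v)) ` proj_line (chord v x) = proj_line (chord v y)"
proof -
  define t where "t = 2 * (chord v v $ 1 * chord v x $ 1 + chord v v $ 2 * chord v x $ 2) / axis_norm (chord v v)"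
  define x' where "x' = (fst x - t * fst v, snd x - t * snd v)"
  have "reflect_line (chord v v) (chord v x) = chord v x'"
    unfolding reflect_line_def x'_def chord_linear t_def ..
  have l0: "l \<noteq> 0" using admissibleD(1)[OF l] .
  have vv: "\<kappa> * br x v * br y v = l * axis_norm (chord v v)" using F chord_form_tangent by metis
  then have xv: "br x v \<noteq> 0" "br y v \<noteq> 0" using N l0 by auto
  have "2 * dual_form l (chord v v) (chord v x) = \<kappa> * br x v * br y x"
    using dual_form_polar[OF F, of v x] by simp
  then have "l * (2 * (chord v v $ 1 * chord v x $ 1 + chord v v $ 2 * chord v x $ 2)) = \<kappa> * br x v * br y x"
    unfolding dual_form_split[of l] dual_form_tangent by (simp add: algebra_simps)
  moreover have "l * (2 * (chord v v $ 1 * chord v x $ 1 + chord v v $ 2 * chord v x $ 2)) =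
      l * axis_norm (chord v v) * t" using N by (simp add: t_def)
  ultimately have "\<kappa> * br x v * br y x = \<kappa> * br x v * br y v * t" unfolding vv by simp
  then have t: "br y x = br y v * t" using \<kappa> xv by simp
  have "br y x' = br y x - t * br y v" by (simp add: x'_def br_def algebra_simps)
  then have yx': "br y x' = 0" using t by simp
  have "x' \<noteq> 0"
  proof
    assume "x' = 0"
    then have "fst x = t * fst v" "snd x = t * snd v" by (simp_all add: x'_def prod_eq_iff)
    then have "br x v = 0" by (simp add: br_def)
    then show False using xv by simp
  qed
  then show ?thesis
    unfolding image_line_symmetry[OF N] \<open>reflect_line (chord v v) (chord v x) = chord v x'\<close>
    using chord_line_eqI[OF nz(3) _ yx', of v] by simp
qed

text \<open>The converse direction: the reflected line has to be the second tangent, which yields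
  the whole factorization even if both tangents coincide.\<close>

lemma reflection_form:
  assumes l: "admissible l" and nz: "v \<noteq> 0" "x \<noteq> 0" "y \<noteq> 0"
    and F: "chord_form l v x = 0" and N: "axis_norm (chord v v) \<noteq> 0"
    and R: "line_symmetry (proj_line (chord v v)) ` proj_line (chord v x) = proj_line (chord v y)"
  shows "\<exists>\<kappa>. \<kappa> \<noteq> 0 \<and> (\<forall>z. chord_form l v z = \<kappa> * br y z * br x z)"
proof -
  interpret biquadratic "chord_form l" by (rule biquadratic_chord_form[OF l])
  obtain m where m: "m \<noteq> 0" "\<And>z. chord_form l v z = br m z * br x z"
    using factor_at_root[OF nz(1,2) F] by blast
  then have "\<And>z. chord_form l v z = 1 * br x z * br m z" by (simp add: mult.commute)
  from reflection_swaps_tangents[OF l nz(1,2) m(1) _ this N] R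
  have "proj_line (chord v m) = proj_line (chord v y)" by simp
  then have "br y m = 0" using chord_prop_imp[OF nz(1) m(1) nz(3)] br_swap[of m y] by simp
  then obtain c where c: "c \<noteq> 0" "m = (c * fst y, c * snd y)" using br_zero_iff[OF nz(3) m(1)] by blast
  have "br m z = c * br y z" for z unfolding c(2) br_def by (simp add: algebra_simps)
  then show ?thesis using m(2) c(1) by (intro exI[of _ c]) simp
qed

text \<open>A double zero w of F(v, .) makes the line vw conjugate to all lines through v, so it
  touches the conic at v. Likewise it touches at w, but the point of contact is unique.\<close>

lemma no_two_cycle:
  assumes l: "admissible l" and v: "v \<noteq> 0" and w: "w \<noteq> 0" and vw: "br v w \<noteq> 0"
    and Fv: "\<And>z. chord_form l v z = \<kappa> * br w z * br w z"
    and Fw: "\<And>z. chord_form l w z = \<mu> * br v z * br v z"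
  shows False
proof -
  define c where "c = chord v w"
  define x :: "complex^3" where "x = vector [(of_real a ^ 2 + l) * c$1, (of_real b ^ 2 + l) * c$2, - c$3]"
  have "c \<noteq> 0" using chord_nonzero[OF v w] by (simp add: c_def)
  then have x: "x \<noteq> 0" using admissibleD(8,9)[OF l] by (auto simp: x_def vec3_eq_iff)
  have d: "dual_form l c u = dot u x" for u by (simp add: dual_form_def dot3 x_def)
  have "2 * dot (chord v z) x = 0" for z using dual_form_polar[OF Fv, of w z] d c_def by simp
  then have 1: "dot (chord v z) x = 0" for z by simp
  have "2 * dot (chord w z) x = 0" for z
    using dual_form_polar[OF Fw, of v z] d c_def by (simp add: chord_commute[of w v])
  then have 2: "dot (chord w z) x = 0" for z by simp
  have "ellipse_pt v = ellipse_pt w"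
    using common_point_of_chords[OF v x vw 1 1] common_point_of_chords[OF w x vw 2 2] by simp
  then show False using ellipse_pt_eq_iff[OF v w] vw by simp
qed


section \<open>Circumscribed polygons as orbits of the chord form\<close>

lemma circumscribed_iff:
  assumes l: "admissible l" and v: "\<And>j. v j \<noteq> 0" and M: "\<And>j. M j = ellipse_pt (v j)"
    and L: "\<And>j. L j = proj_line (chord (v j) (v (j + 1)))"
  shows "circumscribed (confocal a b l) M L \<longleftrightarrow> orbit (chord_form l) v"
proof -
  have "L (j - 1) = proj_line (chord (v j) (v (j - 1)))" for j unfolding L by (simp add: chord_commute)
  then have "circumscribed (confocal a b l) M L \<longleftrightarrow> (\<forall>j t. tangent_mult (confocal a b l) (ellipse_pt (v j)) t =
      count {# proj_line (chord (v j) (v (j - 1))), proj_line (chord (v j) (v (j + 1))) #} t)"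
    unfolding circumscribed_def M L[of "_ :: int"] by (simp add: L)
  then show ?thesis unfolding orbit_def using tangent_mult_iff[OF l v v v] v by blast
qed

lemma poncelet_polygon_of_orbit:
  assumes l: "admissible l" and cyc: "cyclic n v" and orb: "orbit (chord_form l) v"
  shows "poncelet_polygon (ellipse a b) (confocal a b l) n (\<lambda>j. ellipse_pt (v j))
    (\<lambda>j. proj_line (chord (v j) (v (j + 1))))"
proof -
  have v: "v j \<noteq> 0" for j using orb by (simp add: orbit_def)
  have sh: "v (j + int n + 1) = v (j + 1)" "v (j + int n) = v j" for j
    using cyc unfolding cyclic_def by (metis add.assoc add.commute, simp)
  have "circumscribed (confocal a b l) (\<lambda>j. ellipse_pt (v j)) (\<lambda>j. proj_line (chord (v j) (v (j + 1))))"
    using circumscribed_iff[of l v "\<lambda>j. ellipse_pt (v j)" "\<lambda>j. proj_line (chord (v j) (v (j + 1)))"] l v orb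
    by blast
  then show ?thesis
    unfolding poncelet_polygon_def using chord_nonzero[OF v v]
    by (auto simp: cyclic_def sh ellipse_pt_in_ellipse v intersection_mult_chord lines_def)
qed

text \<open>On an isotropic line the dual form does not depend on \<open>l\<close>, so such a
  tangent of the confocal conic is tangent to the ellipse as well.\<close>

lemma isotropic_tangent_chord:
  assumes "axis_norm (chord v w) = 0" "chord_form l v w = 0"
  shows "br v w = 0"
proof -
  have "chord_form 0 v w = chord_form l v w - l * axis_norm (chord v w)"
    unfolding chord_form_def dual_form_split[of l] by (simp add: axis_norm_def power2_eq_square)
  then have "chord_form 0 v w = 0" using assms by simp
  moreover have "chord_form 0 v w = - ((br v w)^2)"
    unfolding chord_form_eq by (simp add: k_def h_def A_def B_def br_def power2_eq_square algebra_simps)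
  ultimately show ?thesis by simp
qed

section \<open>Foci and foci lines\<close>

lemma foci_in_line:
  shows "hpoint x 0 1 \<in> proj_line u \<longleftrightarrow> u$1 * x + u$3 = 0" "hpoint 0 x 1 \<in> proj_line u \<longleftrightarrow> u$2 * x + u$3 = 0"
proof -
  have "vector [x, 0, 1] \<noteq> (0::complex^3)" "vector [0, x, 1] \<noteq> (0::complex^3)" by (simp_all add: vec3_eq_iff)
  then show "hpoint x 0 1 \<in> proj_line u \<longleftrightarrow> u$1 * x + u$3 = 0" "hpoint 0 x 1 \<in> proj_line u \<longleftrightarrow> u$2 * x + u$3 = 0"
    unfolding hpoint_def by (simp_all add: abs_cp2_in_line dot3)
qed

lemma focal_distance_square: "focal_distance a b ^ 2 = of_real a ^ 2 - of_real b ^ 2"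
proof -
  have "0 \<le> a^2 - b^2" using b_pos b_less_a by (simp add: power_mono)
  then have "complex_of_real (sqrt (a^2 - b^2) ^ 2) = of_real (a^2 - b^2)" by simp
  then show ?thesis by (simp add: focal_distance_def)
qed

lemma focal_distance_nonzero: "focal_distance a b \<noteq> 0"
proof -
  have "a^2 \<noteq> b^2" using b_pos b_less_a by (simp add: power2_eq_iff)
  then have "complex_of_real (a^2) \<noteq> of_real (b^2)" by (simp only: of_real_eq_iff) simp
  then show ?thesis using focal_distance_square by auto
qed

lemma focal_line:
  assumes "L \<in> foci_lines a b"
  shows "\<exists>u. u \<noteq> 0 \<and> L = proj_line u \<and> u$3 = 0 \<and> (u$1 = 0 \<or> u$2 = 0)"
proof -
  obtain u where u: "u \<noteq> 0" "L = proj_line u" and L: "real_foci a b \<subseteq> L \<or> complex_foci a b \<subseteq> L"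
    using assms by (auto simp: foci_lines_def lines_def)
  have *: "z = 0 \<and> x = 0" if "x * c + z = 0" "x * - c + z = 0" "c \<noteq> 0" for x z c :: complex
  proof -
    have "2 * z = 0" using arg_cong2[OF that(1,2), of "(+)"] by simp
    then show ?thesis using that by simp
  qed
  from L have "u$3 = 0 \<and> (u$1 = 0 \<or> u$2 = 0)"
  proof
    assume "real_foci a b \<subseteq> L"
    then have "u$1 * focal_distance a b + u$3 = 0" "u$1 * - focal_distance a b + u$3 = 0"
      by (simp_all only: real_foci_def u(2) insert_subset foci_in_line)
    from *[OF this focal_distance_nonzero] show ?thesis by blast
  next
    assume "complex_foci a b \<subseteq> L"
    then have "u$2 * (\<i> * focal_distance a b) + u$3 = 0" "u$2 * (- \<i> * focal_distance a b) + u$3 = 0"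
      by (simp_all only: complex_foci_def u(2) insert_subset foci_in_line)
    then show ?thesis using *[of "u$2" "\<i> * focal_distance a b" "u$3"] focal_distance_nonzero by simp
  qed
  then show ?thesis using u by blast
qed

lemma polygon_is_billiard:
  assumes l: "admissible l" and poly: "poncelet_polygon (ellipse a b) (confocal a b l) n M L"
    and distinct: "\<And>i. M i \<noteq> M (i + 1)"
  shows "nondegenerate_orbit (ellipse a b) n M \<and> non_isotropic_orbit M \<and> \<not> flat_orbit a b M"
proof -
  have M: "M j \<in> conic_curve (ellipse a b)" for j using poly by (simp add: poncelet_polygon_def)
  then have "\<forall>j. \<exists>v. v \<noteq> 0 \<and> M j = ellipse_pt v" using ellipse_pt_cases by blast
  then obtain v where "\<forall>j. v j \<noteq> 0 \<and> M j = ellipse_pt (v j)"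
    using choice[of "\<lambda>j v. v \<noteq> 0 \<and> M j = ellipse_pt v"] by blast
  then have v: "\<And>j. v j \<noteq> 0" "\<And>j. M j = ellipse_pt (v j)" by blast+
  have vv: "br (v j) (v (j + 1)) \<noteq> 0" for j using distinct[of j] ellipse_pt_eq_iff v by auto
  have side: "side M j = proj_line (chord (v j) (v (j + 1)))" for j
    unfolding side_def v(2) using side_chord v(1) vv by blast
  have "L j = proj_line (chord (v j) (v (j + 1)))" for j
  proof (rule line_through_ellipse_pts[OF v(1) v(1) vv])
    have im: "intersection_mult (ellipse a b) (L j) P = count {# M j, M (j + 1) #} P" for P
      using poly by (simp add: poncelet_polygon_def)
    show "L j \<in> lines" using poly by (simp add: poncelet_polygon_def)
    show "ellipse_pt (v j) \<in> L j" "ellipse_pt (v (j + 1)) \<in> L j"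
      using im[of "M j"] im[of "M (j + 1)"] unfolding v(2) by (auto simp: intersection_mult_def split: if_splits)
  qed
  then have orb: "orbit (chord_form l) v"
    using circumscribed_iff[OF l v] poly by (simp add: poncelet_polygon_def)
  interpret biquadratic "chord_form l" by (rule biquadratic_chord_form[OF l])
  have adj: "chord_form l (v j) (v (j + 1)) = 0" for j using orbit_adjacent[OF orb] by blast
  \<comment> \<open>Otherwise \<open>v j\<close> would be a zero of its own form and so coincide
    with a neighbour.\<close>
  have N: "axis_norm (chord (v j) (v j)) \<noteq> 0" for j
  proof
    assume "axis_norm (chord (v j) (v j)) = 0"
    then have "chord_form l (v j) (v j) = 0" by (simp add: chord_form_tangent)
    then have "br (v (j + 1)) (v j) = 0 \<or> br (v (j - 1)) (v j) = 0" using orbit_root[OF orb] by blast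
    then show False using vv[of j] vv[of "j - 1"] br_swap[of "v j" "v (j + 1)"] by auto
  qed
  have N': "axis_norm (chord (v j) (v (j + 1))) \<noteq> 0" for j
    using isotropic_tangent_chord[OF _ adj] vv by blast
  have reflect: "line_symmetry (tangent_line (ellipse a b) (M j)) ` side M (j - 1) = side M j" for j
  proof -
    obtain \<kappa> where \<kappa>: "\<kappa> \<noteq> 0" "\<And>y. chord_form l (v j) y = \<kappa> * br (v (j + 1)) y * br (v (j - 1)) y"
      using orb unfolding orbit_def by blast
    then have "chord_form l (v j) y = \<kappa> * br (v (j - 1)) y * br (v (j + 1)) y" for y by (simp add: mult_ac)
    from reflection_swaps_tangents[OF l v(1) v(1) v(1) \<kappa>(1) this N]
    show ?thesis unfolding side v(2) tangent_line_ellipse_pt[OF v(1)] by (simp add: chord_commute)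
  qed
  have "\<not> flat_orbit a b M"
  proof
    assume "flat_orbit a b M"
    then obtain F where F: "F \<in> foci_lines a b" "side M 0 = F" by (auto simp: flat_orbit_def)
    then obtain u where u: "u \<noteq> 0" "proj_line (chord (v 0) (v (0 + 1))) = proj_line u" "u$3 = 0" "u$1 = 0 \<or> u$2 = 0"
      using focal_line side by metis
    \<comment> \<open>A foci line is a coordinate axis, where the dual form is a nonzero multiple of
      a^2 + l or b^2 + l.\<close>
    then have "dual_form l u u = 0"
      using tangent_lines_iff[OF l u(1)] chord_tangent_iff[OF l v(1) v(1)] adj[of 0] by metis
    then show False using u admissibleD(8,9)[OF l] by (auto simp: dual_form_def vec3_eq_iff)
  qed
  moreover have "non_isotropic_orbit M" unfolding non_isotropic_orbit_def side isotropic_iff using N' by blast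
  moreover have "nondegenerate_orbit (ellipse a b) n M"
    unfolding nondegenerate_orbit_def
  proof (intro conjI allI)
    show "cyclic n M" using poly by (simp add: poncelet_polygon_def)
    show "\<not> isotropic (tangent_line (ellipse a b) (M j))" for j
      unfolding v(2) tangent_line_ellipse_pt[OF v(1)] isotropic_iff by (rule N)
    show "M j \<in> conic_curve (ellipse a b)" for j by (rule M)
    show "M j \<noteq> M (j + 1)" for j by (rule distinct)
    show "line_symmetry (tangent_line (ellipse a b) (M j)) ` side M (j - 1) = side M j" for j by (rule reflect)
  qed
  ultimately show ?thesis by blast
qed

lemma billiard_is_orbit:
  assumes nd: "nondegenerate_orbit (ellipse a b) n M" and ni: "non_isotropic_orbit M"
    and foci: "\<And>i. side M i \<inter> (real_foci a b \<union> complex_foci a b) = {}"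
  shows "\<exists>l v. admissible l \<and> cyclic n v \<and> orbit (chord_form l) v \<and>
    circumscribed (confocal a b l) M (side M) \<and> (\<exists>i. br (v i) (v (i + 2)) \<noteq> 0)"
proof -
  \<comment> \<open>Choosing from the value \<open>M j\<close> rather than from the index transfers
    the period of \<open>M\<close> to \<open>v\<close>.\<close>
  define v where "v = (\<lambda>j. SOME v. v \<noteq> 0 \<and> M j = ellipse_pt v)"
  have M: "M j \<in> conic_curve (ellipse a b)" for j using nd by (simp add: nondegenerate_orbit_def)
  have "v j \<noteq> 0 \<and> M j = ellipse_pt (v j)" for j
    unfolding v_def by (rule someI_ex) (rule ellipse_pt_cases[OF M])
  then have v: "\<And>j. v j \<noteq> 0" "\<And>j. M j = ellipse_pt (v j)" by blast+
  have cyc: "cyclic n v" using nd by (simp add: nondegenerate_orbit_def cyclic_def v_def)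
  have vv: "br (v j) (v (j + 1)) \<noteq> 0" for j
    using nd ellipse_pt_eq_iff v unfolding nondegenerate_orbit_def by metis
  define c where "c = (\<lambda>j. chord (v j) (v (j + 1)))"
  have side: "side M j = proj_line (c j)" for j
    unfolding side_def v(2) c_def using side_chord v(1) vv by blast
  have Nc: "axis_norm (c j) \<noteq> 0" for j
    using ni unfolding non_isotropic_orbit_def side isotropic_iff by blast
  have N: "axis_norm (chord (v j) (v j)) \<noteq> 0" for j
    using nd unfolding nondegenerate_orbit_def v(2) tangent_line_ellipse_pt[OF v(1)] isotropic_iff by blast
  have R: "line_symmetry (proj_line (chord (v j) (v j))) ` proj_line (chord (v j) (v (j - 1))) = proj_line (chord (v j) (v (j + 1)))" for j
  proof -
    have "line_symmetry (tangent_line (ellipse a b) (M j)) ` side M (j - 1) = side M j"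
      using nd by (simp add: nondegenerate_orbit_def)
    then show ?thesis unfolding side v(2) tangent_line_ellipse_pt[OF v(1)] c_def by (simp add: chord_commute)
  qed
  \<comment> \<open>For a non-isotropic side the dual form is a nonconstant affine function of the
    parameter, so exactly one parameter makes the side tangent.\<close>
  define lam where "lam = (\<lambda>j. - dual_form 0 (c j) (c j) / axis_norm (c j))"
  have form: "chord_form l (v j) (v (j + 1)) = dual_form 0 (c j) (c j) + l * axis_norm (c j)" for l j
    unfolding chord_form_def dual_form_split[of l] c_def by (simp add: axis_norm_def power2_eq_square)
  have zero: "chord_form l (v j) (v (j + 1)) = 0 \<longleftrightarrow> l = lam j" for l j
  proof -
    have "x + l * y = 0 \<longleftrightarrow> l = - x / y" if "y \<noteq> 0" for x y :: complex
      using that by (auto simp: field_simps add_eq_0_iff)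
    then show ?thesis unfolding form lam_def using Nc[of j] by blast
  qed
  \<comment> \<open>The value 0 would mean coinciding end points, -b^2 a side through a real focus,
    -a^2 a side through a complex focus.\<close>
  have adm: "admissible (lam j)" for j
  proof -
    have "lam j \<noteq> 0"
    proof
      assume "lam j = 0"
      then have "chord_form 0 (v j) (v (j + 1)) = 0" using zero by simp
      moreover have "chord_form 0 (v j) (v (j + 1)) = - ((br (v j) (v (j + 1)))^2)"
        unfolding chord_form_eq by (simp add: k_def h_def A_def B_def br_def power2_eq_square algebra_simps)
      ultimately show False using vv[of j] by simp
    qed
    moreover have "lam j \<noteq> - (of_real b ^ 2)"
    proof
      assume eq: "lam j = - (of_real b ^ 2)"
      have "dual_form (lam j) (c j) (c j) = 0" using zero[of "lam j" j] by (simp add: chord_form_def c_def)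
      then have "(focal_distance a b * c j $ 1)^2 = c j $ 3 ^ 2"
        unfolding eq power_mult_distrib focal_distance_square by (simp add: dual_form_def power2_eq_square algebra_simps)
      then have "c j $ 1 * focal_distance a b + c j $ 3 = 0 \<or> c j $ 1 * - focal_distance a b + c j $ 3 = 0"
        by (auto simp: power2_eq_iff mult.commute)
      then have "hpoint (focal_distance a b) 0 1 \<in> side M j \<or> hpoint (- focal_distance a b) 0 1 \<in> side M j"
        unfolding side foci_in_line .
      then show False using foci[of j] by (auto simp: real_foci_def)
    qed
    moreover have "lam j \<noteq> - (of_real a ^ 2)"
    proof
      assume eq: "lam j = - (of_real a ^ 2)"
      have "dual_form (lam j) (c j) (c j) = 0" using zero[of "lam j" j] by (simp add: chord_form_def c_def)
      then have "(\<i> * focal_distance a b * c j $ 2)^2 = c j $ 3 ^ 2"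
        unfolding eq power_mult_distrib focal_distance_square by (simp add: dual_form_def power2_eq_square algebra_simps)
      then have "c j $ 2 * (\<i> * focal_distance a b) + c j $ 3 = 0 \<or> c j $ 2 * (- \<i> * focal_distance a b) + c j $ 3 = 0"
        by (auto simp: power2_eq_iff mult_ac)
      then have "hpoint 0 (\<i> * focal_distance a b) 1 \<in> side M j \<or> hpoint 0 (- \<i> * focal_distance a b) 1 \<in> side M j"
        unfolding side foci_in_line .
      then show False using foci[of j] by (auto simp: complex_foci_def)
    qed
    ultimately show ?thesis by (simp add: admissible_def)
  qed
  \<comment> \<open>The reflection sends the incoming side to the other tangent of the conic that
    the incoming side touches, so the parameter does not change at a vertex.\<close>
  have vertex: "\<exists>\<kappa>. \<kappa> \<noteq> 0 \<and> (\<forall>z. chord_form (lam (j - 1)) (v j) z = \<kappa> * br (v (j + 1)) z * br (v (j - 1)) z)" for j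
  proof (rule reflection_form[OF adm v(1) v(1) v(1) _ N R])
    show "chord_form (lam (j - 1)) (v j) (v (j - 1)) = 0"
      using zero[of "lam (j - 1)" "j - 1"] by (simp add: chord_form_def chord_commute)
  qed
  have "lam j = lam (j - 1)" for j
  proof -
    have "chord_form (lam (j - 1)) (v j) (v (j + 1)) = 0" using vertex[of j] by (metis br_self mult_zero_left mult_zero_right)
    then show ?thesis using zero by simp
  qed
  then have step: "lam (j + 1) = lam j" for j by (metis add_diff_cancel_right')
  have const: "lam j = lam 0" for j
  proof (induction j rule: int_induct[where k = 0])
    case base
    show ?case ..
  next
    case (step1 i)
    then show ?case using step by simp
  next
    case (step2 i)
    then show ?case using step[of "i - 1"] by simp
  qed
  have orb: "orbit (chord_form (lam 0)) v"
    unfolding orbit_def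
  proof (intro allI conjI v(1))
    show "\<exists>\<kappa>. \<kappa> \<noteq> 0 \<and> (\<forall>y. chord_form (lam 0) (v i) y = \<kappa> * br (v (i + 1)) y * br (v (i - 1)) y)" for i
      using vertex[of i] unfolding const[of "i - 1"] .
  qed
  then have "circumscribed (confocal a b (lam 0)) M (side M)"
    using circumscribed_iff[of "lam 0" v M "side M"] adm v side unfolding c_def by blast
  \<comment> \<open>If all these brackets vanished, each form would be a multiple of a square and
    the orbit would be a two-cycle.\<close>
  moreover have "\<exists>i. br (v i) (v (i + 2)) \<noteq> 0"
  proof (rule ccontr)
    assume "\<not> (\<exists>i. br (v i) (v (i + 2)) \<noteq> 0)"
    then have 0: "br (v i) (v (i + 2)) = 0" for i by blast
    have sq: "\<exists>\<mu>. \<forall>z. chord_form (lam 0) (v i) z = \<mu> * br (v (i + 1)) z * br (v (i + 1)) z" for i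
    proof -
      obtain \<kappa> where \<kappa>: "\<And>z. chord_form (lam 0) (v i) z = \<kappa> * br (v (i + 1)) z * br (v (i - 1)) z"
        using orb unfolding orbit_def by blast
      have "br (v (i - 1)) (v (i + 1)) = 0" using 0[of "i - 1"] by (simp add: add.commute)
      then obtain d where "v (i + 1) = (d * fst (v (i - 1)), d * snd (v (i - 1)))" "d \<noteq> 0"
        using br_zero_iff[OF v(1) v(1)] by blast
      then have "br (v (i - 1)) z = br (v (i + 1)) z / d" for z by (simp add: br_def diff_divide_distrib)
      then show ?thesis using \<kappa> by (intro exI[of _ "\<kappa> / d"]) simp
    qed
    obtain \<mu> where \<mu>: "\<And>z. chord_form (lam 0) (v 0) z = \<mu> * br (v 1) z * br (v 1) z" using sq[of 0] by auto
    obtain \<nu> where \<nu>: "\<And>z. chord_form (lam 0) (v 1) z = \<nu> * br (v 2) z * br (v 2) z" using sq[of 1] by auto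
    obtain d where d: "v 2 = (d * fst (v 0), d * snd (v 0))"
      using br_zero_iff[OF v(1) v(1), of 0 2] 0[of 0] by auto
    have "chord_form (lam 0) (v 1) z = (\<nu> * d^2) * br (v 0) z * br (v 0) z" for z
      unfolding \<nu> d by (simp add: br_def power2_eq_square algebra_simps)
    then show False using no_two_cycle[OF adm v(1) v(1) _ \<mu>] vv[of 0] by auto
  qed
  ultimately show ?thesis using adm cyc orb by blast
qed

lemma conic_curve_confocal_inject:
  assumes l: "admissible l" "admissible m" and eq: "conic_curve (confocal a b l) = conic_curve (confocal a b m)"
  shows "l = m"
proof -
  \<comment> \<open>The vertex (sqrt (a^2 + l), 0) of the conic distinguishes the parameter.\<close>
  define s where "s = csqrt (of_real a ^ 2 + l)"
  have s: "s * s = of_real a ^ 2 + l" unfolding power2_eq_square[symmetric] by (simp add: s_def)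
  define x :: "complex^3" where "x = vector [s, 0, 1]"
  have x: "x \<noteq> 0" by (simp add: x_def vec3_eq_iff)
  have mem: "abs_cp2 x \<in> conic_curve (confocal a b r) \<longleftrightarrow> of_real a ^ 2 + l = of_real a ^ 2 + r" if "admissible r" for r
  proof -
    have "dot x (confocal a b r *v x) = (s * s) / (of_real a ^ 2 + r) - 1"
      by (simp add: dot3 confocal_mult x_def)
    moreover have "y / z - 1 = 0 \<longleftrightarrow> y = z" if "z \<noteq> 0" for y z :: complex using that by auto
    ultimately show ?thesis unfolding abs_cp2_in_conic[OF x] s using admissibleD(8)[OF that] by simp
  qed
  show ?thesis using mem[OF l(1)] mem[OF l(2)] eq by simp
qed

section \<open>The parameters of closed polygons\<close>

text \<open>Quantifying over all points yields polygons through a prescribed vertex directly and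
  leaves the choice of a generic orbit open.\<close>

definition closes :: "nat \<Rightarrow> complex \<Rightarrow> bool" where
  "closes n l \<longleftrightarrow> (\<forall>p. p \<noteq> 0 \<longrightarrow> (\<exists>v. cyclic n v \<and> orbit (chord_form l) v \<and> (\<exists>i. br (v i) p = 0)))"

lemma closesI:
  assumes "admissible l" "0 < n" "cyclic n v" "orbit (chord_form l) v" "br (v i) (v (i + 2)) \<noteq> 0"
  shows "closes n l"
  unfolding closes_def using biquadratic.porism[OF biquadratic_chord_form[OF assms(1)] assms(3,4,2,5)] by blast

text \<open>With w = sqrt k \<omega>, the factors encode exclusions of
  \<open>poncelet_chain\<close>: \<omega> = 0, \<omega>^2 = 1, and consecutive values of \<omega>
  equal or opposite.\<close>

lemma finite_bad_ratios:
  assumes "admissible l"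
  shows "finite {w. w * (w^2 - k l) * chord_form l (w, 1) (w, 1) * chord_form l (w, 1) (- w, 1) = 0}"
proof -
  define P where "P = [:0, 1:] * [:- k l, 0, 1:] * [:k l, 0, 2 * h l - 2, 0, k l:] * [:k l, 0, - 2 * h l - 2, 0, k l:]"
  have "poly P w = w * (w^2 - k l) * chord_form l (w, 1) (w, 1) * chord_form l (w, 1) (- w, 1)" for w
  proof -
    have "poly [:k l, 0, 2 * h l - 2, 0, k l:] w = chord_form l (w, 1) (w, 1)"
      "poly [:k l, 0, - 2 * h l - 2, 0, k l:] w = chord_form l (w, 1) (- w, 1)"
      by (simp_all add: chord_form_eq power2_eq_square algebra_simps)
    then show ?thesis by (simp only: P_def poly_mult) (simp add: power2_eq_square)
  qed
  moreover have "P \<noteq> 0" using admissibleD(7)[OF assms] by (simp add: P_def)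
  ultimately show ?thesis using poly_roots_finite[of P] by simp
qed

text \<open>Closed orbits through the finitely many bad points cover only finitely many points. An
  orbit starting elsewhere cannot reach a bad point, since it would then lie inside the orbit chosen
  there.\<close>

lemma generic_closed_orbit:
  assumes l: "admissible l" and n: "0 < n" and cl: "closes n l"
  shows "\<exists>v. cyclic n v \<and> orbit (chord_form l) v \<and> (\<forall>j. fst (v j) \<noteq> 0 \<and> snd (v j) \<noteq> 0 \<and>
    fst (v j) ^ 2 \<noteq> k l * snd (v j) ^ 2 \<and> chord_form l (v j) (v j) \<noteq> 0 \<and> chord_form l (v j) (- fst (v j), snd (v j)) \<noteq> 0)"
proof -
  interpret biquadratic "chord_form l" by (rule biquadratic_chord_form[OF l])
  define bad where "bad = {w. w * (w^2 - k l) * chord_form l (w, 1) (w, 1) * chord_form l (w, 1) (- w, 1) = 0}"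
  define Bs where "Bs = insert (1, 0) ((\<lambda>w. (w, 1 :: complex)) ` bad)"
  have "finite Bs" using finite_bad_ratios[OF l] by (simp add: Bs_def bad_def)
  have Bs0: "x \<noteq> 0" if "x \<in> Bs" for x using that by (auto simp: Bs_def prod_eq_iff)
  have "\<forall>x\<in>Bs. \<exists>v. cyclic n v \<and> orbit (chord_form l) v \<and> (\<exists>i. br (v i) x = 0)"
    using cl Bs0 unfolding closes_def by blast
  then obtain V where V: "\<forall>x\<in>Bs. cyclic n (V x) \<and> orbit (chord_form l) (V x) \<and> (\<exists>i. br (V x i) x = 0)"
    using bchoice[of Bs "\<lambda>x v. cyclic n v \<and> orbit (chord_form l) v \<and> (\<exists>i. br (v i) x = 0)"] by blast
  have fin1: "finite {w. br x (w, 1) = 0}" if "x \<noteq> 0" for x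
  proof (rule finite_subset)
    show "{w. br x (w, 1) = 0} \<subseteq> {fst x / snd x}"
      using that by (auto simp: br_def prod_eq_iff field_simps)
  qed simp
  have per: "V x i = V x (i mod int n)" if "x \<in> Bs" for x i
  proof -
    have cyc: "V x (j + int n) = V x j" for j using V that by (simp add: cyclic_def)
    have "V x (j + int n * int m) = V x j" for j m
    proof (induction m)
      case (Suc m)
      then show ?case using cyc[of "j + int n * int m"] by (simp add: algebra_simps)
    qed simp
    then have *: "V x (j + int n * m) = V x j" if "0 \<le> m" for j m using that by (metis nonneg_int_cases)
    show ?thesis
    proof (cases "0 \<le> i div int n")
      case True
      then show ?thesis using *[of "i div int n" "i mod int n"] by (simp add: add.commute)
    next
      case False
      then have "0 \<le> - (i div int n)" by simp
      from *[OF this, of i] show ?thesis by (metis add.commute minus_mult_right minus_mult_div_eq_mod mult.commute uminus_add_conv_diff diff_conv_add_uminus)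
    qed
  qed
  define X where "X = (\<Union>x\<in>Bs. \<Union>i\<in>{0..<int n}. {w. br (V x i) (w, 1) = 0})"
  have "finite X" unfolding X_def
  proof (intro finite_UN_I fin1)
    show "finite Bs" by fact
    show "V x i \<noteq> 0" if "x \<in> Bs" for x i using V that by (auto simp: orbit_def)
  qed simp_all
  then obtain w where w: "w \<notin> X" using ex_new_if_finite[OF infinite_UNIV_char_0] by blast
  have out: "br (V x i) (w, 1) \<noteq> 0" if "x \<in> Bs" for x i
  proof -
    have "i mod int n \<in> {0..<int n}" using n by simp
    then show ?thesis using w that per[OF that, of i] unfolding X_def by auto
  qed
  have "(w, 1::complex) \<noteq> 0" by (simp add: prod_eq_iff)
  then obtain v i0 where v: "cyclic n v" "orbit (chord_form l) v" and i0: "br (v i0) (w, 1) = 0"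
    using cl unfolding closes_def by blast
  have v0: "v j \<noteq> 0" for j using v(2) by (simp add: orbit_def)
  have avoid: "br (v j) x \<noteq> 0" if x: "x \<in> Bs" for x j
  proof
    assume 0: "br (v j) x = 0"
    obtain i where i: "br (V x i) x = 0" using V x by blast
    have orbV: "orbit (chord_form l) (V x)" using V x by blast
    have "br x (v j) = 0" using 0 br_swap[of x "v j"] by simp
    then have "br (V x i) (v j) = 0" by (rule br_zero_trans[OF Bs0[OF x] i])
    then have base: "\<exists>i. br (V x i) (v j) = 0" by blast
    have up: "\<exists>i. br (V x i) (v (j + 1)) = 0" if "\<exists>i. br (V x i) (v j) = 0" for j
      using that orbit_closed_under_F[OF orbV v0 v0 orbit_adjacent(1)[OF v(2)]] by blast
    have down: "\<exists>i. br (V x i) (v (j - 1)) = 0" if "\<exists>i. br (V x i) (v j) = 0" for j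
      using that orbit_closed_under_F[OF orbV v0 v0] orbit_adjacent(2)[OF v(2), of "j - 1"] by fastforce
    have "\<exists>i. br (V x i) (v i0) = 0"
      by (induction i0 rule: int_induct[where k = j]) (use base up down in blast)+
    then obtain i' where "br (V x i') (v i0) = 0" by blast
    then have "br (V x i') (w, 1) = 0" using br_zero_trans[OF v0 _ i0] by blast
    then show False using out[OF x] by blast
  qed
  have "fst (v j) \<noteq> 0 \<and> snd (v j) \<noteq> 0 \<and> fst (v j) ^ 2 \<noteq> k l * snd (v j) ^ 2 \<and>
     chord_form l (v j) (v j) \<noteq> 0 \<and> chord_form l (v j) (- fst (v j), snd (v j)) \<noteq> 0" for j
  proof -
    define p q where "p = fst (v j)" and "q = snd (v j)"
    have q: "q \<noteq> 0" using avoid[of "(1, 0)" j] by (simp add: Bs_def br_def q_def)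
    define t where "t = p / q"
    have p: "p = q * t" using q by (simp add: t_def)
    have "br (v j) (t, 1) = 0" using q by (simp add: br_def t_def p_def[symmetric] q_def[symmetric])
    then have "t \<notin> bad" using avoid[of "(t, 1)" j] by (auto simp: Bs_def)
    then have t: "t \<noteq> 0" "t^2 \<noteq> k l" "chord_form l (t, 1) (t, 1) \<noteq> 0" "chord_form l (t, 1) (- t, 1) \<noteq> 0"
      by (auto simp: bad_def)
    have hom: "chord_form l (v j) (v j) = q^4 * chord_form l (t, 1) (t, 1)"
      "chord_form l (v j) (- fst (v j), snd (v j)) = q^4 * chord_form l (t, 1) (- t, 1)"
      unfolding chord_form_eq p_def[symmetric] q_def[symmetric] p
      by (simp_all add: power2_eq_square power4_eq_xxxx algebra_simps)
    have "chord_form l (v j) (v j) \<noteq> 0" "chord_form l (v j) (- fst (v j), snd (v j)) \<noteq> 0"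
      unfolding hom using t q by simp_all
    moreover have "fst (v j) \<noteq> 0 \<and> snd (v j) \<noteq> 0 \<and> fst (v j) ^ 2 \<noteq> k l * snd (v j) ^ 2"
      using t q unfolding p_def[symmetric] q_def[symmetric] p by (simp add: power_mult_distrib mult.commute)
    ultimately show ?thesis by blast
  qed
  then show ?thesis using v by blast
qed

lemma pell_of_closes:
  assumes l: "admissible l" and n: "0 < n" and cl: "closes n l"
  shows "\<exists>p q. pell ([:1, 1:] * [:1, A l:] * [:1, B l:]) n p q"
proof -
  obtain v where v: "cyclic n v" "orbit (chord_form l) v" and gen: "\<And>j. fst (v j) \<noteq> 0" "\<And>j. snd (v j) \<noteq> 0"
    "\<And>j. fst (v j) ^ 2 \<noteq> k l * snd (v j) ^ 2" "\<And>j. chord_form l (v j) (v j) \<noteq> 0"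
    "\<And>j. chord_form l (v j) (- fst (v j), snd (v j)) \<noteq> 0"
    using generic_closed_orbit[OF assms] by blast
  interpret biquadratic "chord_form l" by (rule biquadratic_chord_form[OF l])
  \<comment> \<open>Scaling the ratio by a square root of k turns the chord form into k times the
    left side of \<open>rel\<close>.\<close>
  define s where "s = csqrt (k l)"
  have s: "s * s = k l" unfolding power2_eq_square[symmetric] by (simp add: s_def)
  have s0: "s \<noteq> 0" using admissibleD(7)[OF l] s by auto
  define \<omega> where "\<omega> = (\<lambda>j. fst (v (int j)) / snd (v (int j)) / s)"
  have fst_v: "fst (v (int j)) = snd (v (int j)) * s * \<omega> j" for j
    using gen(2) s0 by (simp add: \<omega>_def)
  have idx: "v (int (Suc j)) = v (int j + 1)" for j by (simp add: add.commute)
  have coef: "\<exists>\<kappa>. \<kappa> \<noteq> 0 \<and> k l * fst (v j) ^ 2 - snd (v j) ^ 2 = \<kappa> * snd (v (j + 1)) * snd (v (j - 1)) \<and>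
     2 * h l * fst (v j) * snd (v j) = - \<kappa> * (fst (v (j + 1)) * snd (v (j - 1)) + snd (v (j + 1)) * fst (v (j - 1)))" for j
  proof -
    obtain \<kappa> where \<kappa>: "\<kappa> \<noteq> 0" "\<And>y. chord_form l (v j) y = \<kappa> * br (v (j + 1)) y * br (v (j - 1)) y"
      using v(2) unfolding orbit_def by blast
    have 1: "k l * fst (v j) ^ 2 - snd (v j) ^ 2 = \<kappa> * snd (v (j + 1)) * snd (v (j - 1))"
      using \<kappa>(2)[of "(1, 0)"] by (simp add: chord_form_eq br_def)
    have 2: "k l * snd (v j) ^ 2 - fst (v j) ^ 2 = \<kappa> * fst (v (j + 1)) * fst (v (j - 1))"
      using \<kappa>(2)[of "(0, 1)"] by (simp add: chord_form_eq br_def)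
    have "2 * h l * fst (v j) * snd (v j) = \<kappa> * br (v (j + 1)) (1, 1) * br (v (j - 1)) (1, 1)
      - (k l * fst (v j) ^ 2 - snd (v j) ^ 2) - (k l * snd (v j) ^ 2 - fst (v j) ^ 2)"
      using \<kappa>(2)[of "(1, 1)"] by (simp add: chord_form_eq algebra_simps)
    also have "\<dots> = - \<kappa> * (fst (v (j + 1)) * snd (v (j - 1)) + snd (v (j + 1)) * fst (v (j - 1)))"
      unfolding 1 2 by (simp add: br_def algebra_simps)
    finally show ?thesis using \<kappa>(1) 1 by blast
  qed
  have one_minus: "1 - k l ^ 2 * \<omega> j ^ 2 = - (k l * fst (v (int j)) ^ 2 - snd (v (int j)) ^ 2) / snd (v (int j)) ^ 2" for j
  proof -
    have "k l * fst (v (int j)) ^ 2 - snd (v (int j)) ^ 2 = snd (v (int j)) ^ 2 * (k l * (s * s) * \<omega> j ^ 2 - 1)"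
      unfolding fst_v by (simp add: power2_eq_square algebra_simps)
    then show ?thesis using gen(2)[of "int j"] unfolding s by (simp add: power2_eq_square)
  qed
  have ratio: "fst (v (int i)) / snd (v (int i)) = s * \<omega> i" for i using s0 by (simp add: \<omega>_def)
  have "poncelet_chain (A l) (B l) (h l) (k l) \<omega> n ([:1, 1:] * [:1, A l:] * [:1, B l:])"
  proof
    show "k l = A l - B l" "h l = A l + B l - 1" by (simp_all add: k_def h_def)
    show "A l \<noteq> 0" "A l \<noteq> 1" "B l \<noteq> 0" "B l \<noteq> 1" using admissibleD[OF l] by simp_all
    show "0 < n" by fact
    fix j
    show "1 - \<omega> j ^ 2 - \<omega> (Suc j) ^ 2 + 2 * h l * \<omega> j * \<omega> (Suc j) + k l ^ 2 * \<omega> j ^ 2 * \<omega> (Suc j) ^ 2 = 0"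
    proof -
      define q r where "q = snd (v (int j))" and "r = snd (v (int (Suc j)))"
      have "chord_form l (v (int j)) (v (int (Suc j))) = 0" unfolding idx by (rule orbit_adjacent(1)[OF v(2)])
      then have "k l * ((q * s * \<omega> j)^2 * (r * s * \<omega> (Suc j))^2 + q^2 * r^2) - (q * s * \<omega> j)^2 * r^2 - q^2 * (r * s * \<omega> (Suc j))^2
         + 2 * h l * (q * s * \<omega> j) * q * (r * s * \<omega> (Suc j)) * r = 0"
        unfolding chord_form_eq fst_v q_def r_def .
      moreover have "k l * ((q * s * \<omega> j)^2 * (r * s * \<omega> (Suc j))^2 + q^2 * r^2) - (q * s * \<omega> j)^2 * r^2 - q^2 * (r * s * \<omega> (Suc j))^2
         + 2 * h l * (q * s * \<omega> j) * q * (r * s * \<omega> (Suc j)) * r =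
        q^2 * r^2 * (k l * (s * s) * (s * s) * \<omega> j ^ 2 * \<omega> (Suc j) ^ 2 + k l - (s * s) * \<omega> j ^ 2 - (s * s) * \<omega> (Suc j) ^ 2
         + 2 * h l * (s * s) * \<omega> j * \<omega> (Suc j))"
        by (simp add: power2_eq_square algebra_simps)
      ultimately have "q^2 * r^2 * (k l * (1 - \<omega> j ^ 2 - \<omega> (Suc j) ^ 2 + 2 * h l * \<omega> j * \<omega> (Suc j) + k l ^ 2 * \<omega> j ^ 2 * \<omega> (Suc j) ^ 2)) = 0"
        unfolding s by (simp add: power2_eq_square algebra_simps)
      then show ?thesis using gen(2) admissibleD(7)[OF l] by (simp add: q_def r_def)
    qed
    show "(\<omega> (Suc (Suc j)) + \<omega> j) * (1 - k l ^ 2 * \<omega> (Suc j) ^ 2) = 2 * h l * \<omega> (Suc j)"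
    proof -
      define i where "i = int (Suc j)"
      have i: "i + 1 = int (Suc (Suc j))" "i - 1 = int j" by (simp_all add: i_def)
      obtain \<kappa> where \<kappa>: "k l * fst (v i) ^ 2 - snd (v i) ^ 2 = \<kappa> * snd (v (i + 1)) * snd (v (i - 1))"
        "2 * h l * fst (v i) * snd (v i) = - \<kappa> * (fst (v (i + 1)) * snd (v (i - 1)) + snd (v (i + 1)) * fst (v (i - 1)))"
        using coef[of i] by blast
      have "snd (v i) ^ 2 * s * ((\<omega> (Suc (Suc j)) + \<omega> j) * (1 - k l ^ 2 * \<omega> (Suc j) ^ 2)) =
        - \<kappa> * (snd (v (i + 1)) * snd (v (i - 1)) * (s * \<omega> (Suc (Suc j)) + s * \<omega> j))"
      proof -
        have "snd (v i) ^ 2 * (1 - k l ^ 2 * \<omega> (Suc j) ^ 2) = - (\<kappa> * snd (v (i + 1)) * snd (v (i - 1)))"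
          unfolding one_minus i_def[symmetric] \<kappa>(1) using gen(2)[of i] by simp
        moreover have "snd (v i) ^ 2 * s * ((\<omega> (Suc (Suc j)) + \<omega> j) * (1 - k l ^ 2 * \<omega> (Suc j) ^ 2)) =
          (s * \<omega> (Suc (Suc j)) + s * \<omega> j) * (snd (v i) ^ 2 * (1 - k l ^ 2 * \<omega> (Suc j) ^ 2))"
          by (simp add: algebra_simps)
        ultimately show ?thesis by (simp add: mult_ac)
      qed
      also have "snd (v (i + 1)) * snd (v (i - 1)) * (s * \<omega> (Suc (Suc j)) + s * \<omega> j) =
        fst (v (i + 1)) * snd (v (i - 1)) + snd (v (i + 1)) * fst (v (i - 1))"
        unfolding i fst_v by (simp add: algebra_simps)
      also have "- \<kappa> * \<dots> = 2 * h l * fst (v i) * snd (v i)" by (rule \<kappa>(2)[symmetric])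
      also have "\<dots> = snd (v i) ^ 2 * s * (2 * h l * \<omega> (Suc j))"
        unfolding i_def fst_v by (simp add: power2_eq_square)
      finally show ?thesis using gen(2)[of i] s0 by simp
    qed
    show "\<omega> j \<noteq> 0" using gen(1,2) s0 by (simp add: \<omega>_def)
    show "\<omega> j ^ 2 \<noteq> 1"
    proof
      assume 1: "\<omega> j ^ 2 = 1"
      have "fst (v (int j)) ^ 2 = snd (v (int j)) ^ 2 * (s * s) * \<omega> j ^ 2" unfolding fst_v by (simp add: power2_eq_square)
      then show False using gen(3)[of "int j"] unfolding 1 s by (simp add: mult.commute)
    qed
    show "1 - k l ^ 2 * \<omega> j ^ 2 \<noteq> 0" unfolding one_minus using coef[of "int j"] gen(2) by auto
    have adj: "chord_form l (v (int j)) (v (int (Suc j))) = 0" unfolding idx by (rule orbit_adjacent(1)[OF v(2)])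
    have same: "chord_form l (v (int j)) x = 0" if "br (v (int (Suc j))) x = 0" "x \<noteq> 0" for x
    proof -
      have "v (int (Suc j)) \<noteq> 0" using gen(1)[of "int (Suc j)"] by (auto simp: prod_eq_iff)
      then show ?thesis using F_zero_prop[OF _ that(2) that(1), of "v (int j)"] adj sym by metis
    qed
    show "\<omega> (Suc j) \<noteq> \<omega> j"
    proof
      assume eq: "\<omega> (Suc j) = \<omega> j"
      have "br (v (int (Suc j))) (v (int j)) = 0" unfolding br_def fst_v eq by (simp add: mult_ac)
      moreover have "v (int j) \<noteq> 0" using gen(1)[of "int j"] by (auto simp: prod_eq_iff)
      ultimately show False using same gen(4) by blast
    qed
    show "\<omega> (Suc j) \<noteq> - \<omega> j"
    proof
      assume eq: "\<omega> (Suc j) = - \<omega> j"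
      have "br (v (int (Suc j))) (- fst (v (int j)), snd (v (int j))) = 0"
        unfolding br_def fst_conv snd_conv fst_v eq by (simp add: mult_ac)
      moreover have "(- fst (v (int j)), snd (v (int j))) \<noteq> 0" using gen(1)[of "int j"] by (auto simp: prod_eq_iff)
      ultimately show False using same gen(5) by blast
    qed
    show "\<omega> (j + n) = \<omega> j" using v(1) by (simp add: \<omega>_def cyclic_def)
  qed simp
  then show ?thesis by (rule poncelet_chain.chain_pell)
qed


definition periodic_params :: "nat \<Rightarrow> complex set" where
  "periodic_params n = {l. admissible l \<and> closes n l}"

lemma periodic_params_finite:
  assumes "3 \<le> n"
  shows "finite (periodic_params n)"
    "card (periodic_params n) \<le> (if even n then (n div 2)^2 - 1 else (n div 2) * Suc (n div 2))"
proof -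
  obtain \<Delta> where \<Delta>: "\<Delta> \<noteq> 0" "degree \<Delta> \<le> (if even n then (n div 2)^2 - 1 else (n div 2) * Suc (n div 2))"
    and root: "\<And>l p q. pell ([:1, 1:] * [:1, 1 + l * (1 / of_real a ^ 2):] * [:1, 1 + l * (1 / of_real b ^ 2):]) n p q \<Longrightarrow> poly \<Delta> l = 0"
    using pell_polynomial[OF assms, of "1 / of_real a ^ 2" "1 / of_real b ^ 2"] by blast
  have sub: "periodic_params n \<subseteq> {l. poly \<Delta> l = 0}"
  proof
    fix l assume "l \<in> periodic_params n"
    then obtain p q where "pell ([:1, 1:] * [:1, A l:] * [:1, B l:]) n p q"
      using pell_of_closes[of l n] assms by (auto simp: periodic_params_def)
    then show "l \<in> {l. poly \<Delta> l = 0}" using root unfolding A_def B_def by blast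
  qed
  show "finite (periodic_params n)" using finite_subset[OF sub] poly_roots_finite[OF \<Delta>(1)] by blast
  have "card (periodic_params n) \<le> card {l. poly \<Delta> l = 0}" by (rule card_mono[OF poly_roots_finite[OF \<Delta>(1)] sub])
  also have "\<dots> \<le> degree \<Delta>" by (rule card_poly_roots_bound[OF \<Delta>(1)])
  finally show "card (periodic_params n) \<le> (if even n then (n div 2)^2 - 1 else (n div 2) * Suc (n div 2))"
    using \<Delta>(2) by linarith
qed

section \<open>Explicit closed triangles and quadrilaterals\<close>

lemma closes_threeI:
  assumes l: "admissible l" and nz: "x0 \<noteq> 0" "x1 \<noteq> 0" "x2 \<noteq> 0" and indep: "br x0 x2 \<noteq> 0"
    and \<kappa>: "c0 \<noteq> 0" "c1 \<noteq> 0" "c2 \<noteq> 0"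
    and F0: "\<And>y. chord_form l x0 y = c0 * br x1 y * br x2 y" and F1: "\<And>y. chord_form l x1 y = c1 * br x2 y * br x0 y"
    and F2: "\<And>y. chord_form l x2 y = c2 * br x0 y * br x1 y"
  shows "closes 3 l"
proof -
  define u where "u = (\<lambda>i::nat. if i = 0 then x0 else if i = 1 then x1 else x2)"
  have u: "u 0 = x0" "u 1 = x1" "u 2 = x2" by (simp_all add: u_def)
  have lt: "i < 3 \<longleftrightarrow> i = 0 \<or> i = 1 \<or> i = 2" for i :: nat by auto
  have mods: "Suc 0 mod 3 = 1" "(0 + 3 - 1) mod 3 = (2::nat)" "Suc 1 mod 3 = 2" "(1 + 3 - 1) mod 3 = (0::nat)"
    "Suc 2 mod 3 = 0" "(2 + 3 - 1) mod 3 = (1::nat)" by simp_all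
  have nz': "\<And>i. i < 3 \<Longrightarrow> u i \<noteq> 0" using nz u lt by metis
  have "\<exists>c. c \<noteq> 0 \<and> (\<forall>y. chord_form l (u i) y = c * br (u (Suc i mod 3)) y * br (u ((i + 3 - 1) mod 3)) y)"
    if "i < 3" for i
    using that unfolding lt by (elim disjE; simp only: mods u) (use \<kappa> F0 F1 F2 in blast)+
  from periodic_orbit_intro[OF _ nz' this] obtain v where
    v: "cyclic 3 v" "orbit (chord_form l) v" "\<forall>i<3. v (int i) = u i" by auto
  have "v 0 = x0" "v (0 + 2) = x2" using v(3)[rule_format, of 0] v(3)[rule_format, of 2] u by simp_all
  then show ?thesis using closesI[OF l _ v(1,2), of 0] indep by simp
qed

lemma degenerate_params: "admissible l \<Longrightarrow> h l = 0 \<Longrightarrow> k l \<noteq> 1 \<and> k l \<noteq> - 1"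
proof -
  assume l: "admissible l" and h: "h l = 0"
  have "2 * A l = 1 + k l" "2 * B l = 1 - k l" using h by (simp_all add: h_def k_def algebra_simps)
  then show ?thesis using admissibleD(2,3)[OF l] by auto
qed

text \<open>The triangle symmetric in the major axis: ratio 1 is the vertex (a, 0) of the ellipse,
  and t, 1/t are the zeros of w^2 + (K + 1) w + 1, to which the form at ratio 1 is
  proportional.\<close>

lemma closes_three:
  assumes l: "admissible l" and c: "k l ^ 2 = 2 * h l + 1"
  shows "closes 3 l"
proof -
  define K where "K = k l"
  have H: "2 * h l = K^2 - 1" using c by (simp add: K_def)
  have K1: "K \<noteq> 1" "K \<noteq> - 1" using H degenerate_params[OF l] by (auto simp: K_def)
  define t where "t = (csqrt ((K + 1)^2 - 4) - (K + 1)) / 2"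
  have "2 * ((x - y) / 2) + y = x" for x y :: complex by (simp add: field_simps)
  then have "2 * t + (K + 1) = csqrt ((K + 1)^2 - 4)" unfolding t_def .
  then have "(2 * t + (K + 1))^2 = (K + 1)^2 - 4" by simp
  then have "4 * (t^2 + (K + 1) * t + 1) = 0" by (simp add: power2_eq_square algebra_simps)
  then have zero: "t^2 + (K + 1) * t + 1 = 0" by (simp only: mult_eq_0_iff) simp
  then have t2: "t^2 = - (K + 1) * t - 1" by (simp add: algebra_simps eq_neg_iff_add_eq_0)
  have t0: "t \<noteq> 0" using t2 by auto
  have tm1: "t \<noteq> - 1" using t2 K1 by auto
  \<comment> \<open>t = 1 would give K = -3 and hence A = 1, the excluded parameter 0.\<close>
  have t1: "t \<noteq> 1"
  proof
    assume "t = 1"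
    then have K: "K = - 3" using t2 by (simp add: algebra_simps eq_neg_iff_add_eq_0)
    have "4 * A l = 2 * h l + 2 + 2 * k l" by (simp add: h_def k_def)
    then have "4 * A l = 4" unfolding H K_def[symmetric] K by simp
    then show False using admissibleD(5)[OF l] by simp
  qed
  have F: "chord_form l (p, q) (r, s) = (K * p^2 - q^2) * r^2 + 2 * h l * p * q * r * s + (K * q^2 - p^2) * s^2" for p q r s
    unfolding chord_form_eq K_def by (simp add: algebra_simps)
  have e1: "K - t^2 = (K + 1) * (1 + t)" unfolding t2 by (simp add: algebra_simps)
  have e2: "K * t^2 - 1 = t * ((K + 1) * (1 + t))"
  proof -
    have "K * t^2 - 1 - t * ((K + 1) * (1 + t)) = - (t^2 + (K + 1) * t + 1)" by (simp add: power2_eq_square algebra_simps)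
    then show ?thesis unfolding zero by simp
  qed
  have e3: "(K^2 - 1) * t = - ((K + 1) * (1 + t)) * (1 + t)"
  proof -
    have "(K^2 - 1) * t + (K + 1) * (1 + t) * (1 + t) = (K + 1) * (t^2 + (K + 1) * t + 1)"
      by (simp add: power2_eq_square algebra_simps)
    then show ?thesis unfolding t2 by (simp add: algebra_simps eq_neg_iff_add_eq_0)
  qed
  define \<kappa> where "\<kappa> = (K + 1) * (1 + t)"
  have \<kappa>: "\<kappa> \<noteq> 0" 
    using K1(2) tm1 by (simp add: \<kappa>_def eq_neg_iff_add_eq_0 add.commute)
  have v0: "chord_form l (1, 1) y = (K - 1) / t * br (t, 1) y * br (1, t) y" for y
  proof -
    obtain r s where y: "y = (r, s)" by (cases y)
    have "t * chord_form l (1, 1) y = (K - 1) * (t * r^2 + (K + 1) * t * r * s + t * s^2)"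
    proof -
      have c: "chord_form l (1, 1) y = (K - 1) * r^2 + (K^2 - 1) * r * s + (K - 1) * s^2"
        unfolding y F H[symmetric] by simp
      show ?thesis unfolding c by (simp add: power2_eq_square algebra_simps)
    qed
    also have "t * r^2 + (K + 1) * t * r * s + t * s^2 = t * r^2 - (t^2 + 1) * r * s + t * s^2"
      unfolding t2 by (simp add: algebra_simps)
    also have "\<dots> = br (t, 1) y * br (1, t) y" unfolding y br_def by (simp add: power2_eq_square algebra_simps)
    finally show ?thesis using t0 by (simp add: field_simps)
  qed
  have v1: "chord_form l (t, 1) y = \<kappa> * br (1, t) y * br (1, 1) y" for y
  proof -
    obtain r s where y: "y = (r, s)" by (cases y)
    have "chord_form l (t, 1) y = (K * t^2 - 1) * r^2 + (K^2 - 1) * t * r * s + (K - t^2) * s^2"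
      unfolding y F using H by simp
    also have "\<dots> = \<kappa> * br (1, t) y * br (1, 1) y"
      unfolding e1 e2 e3 \<kappa>_def[symmetric] y br_def by (simp add: power2_eq_square algebra_simps)
    finally show ?thesis .
  qed
  have v2: "chord_form l (1, t) y = \<kappa> * br (1, 1) y * br (t, 1) y" for y
  proof -
    obtain r s where y: "y = (r, s)" by (cases y)
    have "chord_form l (1, t) y = (K - t^2) * r^2 + (K^2 - 1) * t * r * s + (K * t^2 - 1) * s^2"
      unfolding y F using H by simp
    also have "\<dots> = \<kappa> * br (1, 1) y * br (t, 1) y"
      unfolding e1 e2 e3 \<kappa>_def[symmetric] y br_def by (simp add: power2_eq_square algebra_simps)
    finally show ?thesis .
  qed
  have nz: "(1, 1) \<noteq> (0 :: complex \<times> complex)" "(t, 1) \<noteq> (0 :: complex \<times> complex)"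
    "(1, t) \<noteq> (0 :: complex \<times> complex)" by (simp_all add: prod_eq_iff)
  have indep: "br (1, 1) (1, t) \<noteq> 0" using t1 by (simp add: br_def)
  have "(K - 1) / t \<noteq> 0" using K1 t0 by simp
  from closes_threeI[OF l nz indep this \<kappa> \<kappa> v0 v1 v2] show ?thesis .
qed

lemma closes_fourI:
  assumes l: "admissible l" and nz: "x0 \<noteq> 0" "x1 \<noteq> 0" "x2 \<noteq> 0" "x3 \<noteq> 0" and indep: "br x0 x2 \<noteq> 0"
    and \<kappa>: "c0 \<noteq> 0" "c1 \<noteq> 0" "c2 \<noteq> 0" "c3 \<noteq> 0"
    and F0: "\<And>y. chord_form l x0 y = c0 * br x1 y * br x3 y" and F1: "\<And>y. chord_form l x1 y = c1 * br x2 y * br x0 y"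
    and F2: "\<And>y. chord_form l x2 y = c2 * br x3 y * br x1 y" and F3: "\<And>y. chord_form l x3 y = c3 * br x0 y * br x2 y"
  shows "closes 4 l"
proof -
  define u where "u = (\<lambda>i::nat. if i = 0 then x0 else if i = 1 then x1 else if i = 2 then x2 else x3)"
  have u: "u 0 = x0" "u 1 = x1" "u 2 = x2" "u 3 = x3" by (simp_all add: u_def)
  have lt: "i < 4 \<longleftrightarrow> i = 0 \<or> i = 1 \<or> i = 2 \<or> i = 3" for i :: nat by auto
  have mods: "Suc 0 mod 4 = 1" "(0 + 4 - 1) mod 4 = (3::nat)" "Suc 1 mod 4 = 2" "(1 + 4 - 1) mod 4 = (0::nat)"
    "Suc 2 mod 4 = 3" "(2 + 4 - 1) mod 4 = (1::nat)" "Suc 3 mod 4 = 0" "(3 + 4 - 1) mod 4 = (2::nat)" by simp_all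
  have nz': "\<And>i. i < 4 \<Longrightarrow> u i \<noteq> 0" using nz u lt by metis
  have "\<exists>c. c \<noteq> 0 \<and> (\<forall>y. chord_form l (u i) y = c * br (u (Suc i mod 4)) y * br (u ((i + 4 - 1) mod 4)) y)"
    if "i < 4" for i
    using that unfolding lt by (elim disjE; simp only: mods u) (use \<kappa> F0 F1 F2 F3 in blast)+
  from periodic_orbit_intro[OF _ nz' this] obtain v where
    v: "cyclic 4 v" "orbit (chord_form l) v" "\<forall>i<4. v (int i) = u i" by auto
  have "v 0 = x0" "v (0 + 2) = x2" using v(3)[rule_format, of 0] v(3)[rule_format, of 2] u by simp_all
  then show ?thesis using closesI[OF l _ v(1,2), of 0] indep by simp
qed

text \<open>The ratios 1, i, -1, -i form the rhombus of the four vertices of the ellipse. For k = 1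
  and k = -1 the two vertices on the major or minor axis alternate with the two points at
  infinity.\<close>

lemma closes_four:
  assumes l: "admissible l" and c: "h l * (k l ^ 2 - 1) = 0"
  shows "closes 4 l"
proof -
  have F: "chord_form l (p, q) y = (k l * p^2 - q^2) * fst y ^ 2 + 2 * h l * p * q * fst y * snd y + (k l * q^2 - p^2) * snd y ^ 2" for p q y
    unfolding chord_form_eq by (simp add: algebra_simps)
  note simps = F br_def power2_eq_square algebra_simps
  consider "h l = 0" | "k l = 1" "h l \<noteq> 0" | "k l = - 1" "h l \<noteq> 0"
    using c by (auto simp: power2_eq_1_iff)
  then show ?thesis
  proof cases
    case 1
    have "k l - 1 \<noteq> 0" using degenerate_params[OF l 1] by simp
    moreover have "k l + 1 \<noteq> 0"
      using degenerate_params[OF l 1] by (simp only: eq_neg_iff_add_eq_0[symmetric]) simp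
    then have "- (k l + 1) \<noteq> 0" by (simp only: neg_equal_0_iff_equal) simp
    ultimately show ?thesis
      by (intro closes_fourI[OF l, of "(1, 1)" "(\<i>, 1)" "(- 1, 1)" "(- \<i>, 1)" "k l - 1" "- (k l + 1)" "k l - 1" "- (k l + 1)"])
        (simp_all add: 1 simps prod_eq_iff)
  next
    case 2
    then show ?thesis
      by (intro closes_fourI[OF l, of "(1, 1)" "(0, 1)" "(- 1, 1)" "(1, 0)" "- 2 * h l" "- 1" "2 * h l" 1])
        (simp_all add: simps prod_eq_iff)
  next
    case 3
    then show ?thesis
      by (intro closes_fourI[OF l, of "(\<i>, 1)" "(0, 1)" "(- \<i>, 1)" "(1, 0)" "- 2 * \<i> * h l" "- 1" "2 * \<i> * h l" "- 1"])
        (simp_all add: simps prod_eq_iff)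
  qed
qed

lemma periodic_params_three: "periodic_params 3 = {l. admissible l \<and> k l ^ 2 = 2 * h l + 1}"
  using closes_three pell_three pell_of_closes[of _ 3] unfolding periodic_params_def k_def h_def by fastforce

lemma periodic_params_four: "periodic_params 4 = {l. admissible l \<and> h l * (k l ^ 2 - 1) = 0}"
  using closes_four pell_four pell_of_closes[of _ 4] unfolding periodic_params_def k_def h_def by fastforce


section \<open>Counting the parameters for n = 3 and n = 4\<close>

lemma card_periodic_params_three: "card (periodic_params 3) = 2"
proof -
  define \<alpha> \<beta> where "\<alpha> = 1 / a^2" and "\<beta> = 1 / b^2"
  have pos: "0 < \<alpha>" "0 < \<beta>" using a_pos b_pos by (simp_all add: \<alpha>_def \<beta>_def)
  have ne: "\<alpha> \<noteq> \<beta>" using b_pos b_less_a by (simp add: \<alpha>_def \<beta>_def power2_eq_iff)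
  define D E s where "D = (\<alpha> - \<beta>)^2" and "E = \<alpha> + \<beta>" and "s = sqrt (E^2 + 3 * D)"
  have D: "0 < D" using ne by (simp add: D_def)
  have s2: "s^2 = E^2 + 3 * D" and s: "0 < s" using D by (simp_all add: s_def add_nonneg_pos)
  have AB: "A l = 1 + l * of_real \<alpha>" "B l = 1 + l * of_real \<beta>" for l
    by (simp_all add: A_def B_def \<alpha>_def \<beta>_def)
  have eq: "k l ^ 2 - (2 * h l + 1) = of_real D * l^2 - 2 * of_real E * l - 3" for l
    unfolding k_def h_def AB D_def E_def by (simp add: power2_eq_square algebra_simps)
  have roots: "k l ^ 2 = 2 * h l + 1 \<longleftrightarrow> l = of_real ((E + s) / D) \<or> l = of_real ((E - s) / D)" for l
  proof -
    have "of_real D * (of_real D * l^2 - 2 * of_real E * l - 3) = (of_real D * l - of_real E)^2 - of_real (E^2 + 3 * D)"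
      by (simp add: power2_eq_square algebra_simps)
    also have "\<dots> = (of_real D * l - of_real E - of_real s) * (of_real D * l - of_real E + of_real s)"
      unfolding s2[symmetric] by (simp add: power2_eq_square algebra_simps)
    finally have "of_real D * (k l ^ 2 - (2 * h l + 1)) = (of_real D * l - of_real E - of_real s) * (of_real D * l - of_real E + of_real s)"
      unfolding eq .
    then have "k l ^ 2 = 2 * h l + 1 \<longleftrightarrow> of_real D * l - of_real E - of_real s = 0 \<or> of_real D * l - of_real E + of_real s = 0"
      using D by (metis eq_iff_diff_eq_0 mult_eq_0_iff of_real_eq_0_iff less_irrefl)
    moreover have "of_real D * l - of_real E - of_real s = 0 \<longleftrightarrow> l = of_real ((E + s) / D)"
      "of_real D * l - of_real E + of_real s = 0 \<longleftrightarrow> l = of_real ((E - s) / D)"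
      using D by (auto simp: field_simps)
    ultimately show ?thesis by blast
  qed
  \<comment> \<open>If A = 0 the equation reduces to (B - 1)^2 = 0, and symmetrically, so neither
    root is lost to an excluded parameter.\<close>
  have adm: "admissible l" if c: "k l ^ 2 = 2 * h l + 1" for l
  proof -
    have "l \<noteq> 0" using eq[of l] c by auto
    moreover have "A l \<noteq> 0"
    proof
      assume "A l = 0"
      then have "(B l - 1)^2 = 0" using c by (simp add: k_def h_def power2_eq_square algebra_simps)
      then show False using AB_distinct(3)[OF \<open>l \<noteq> 0\<close>] by simp
    qed
    moreover have "B l \<noteq> 0"
    proof
      assume "B l = 0"
      then have "(A l - 1)^2 = 0" using c by (simp add: k_def h_def power2_eq_square algebra_simps)
      then show False using AB_distinct(2)[OF \<open>l \<noteq> 0\<close>] by simp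
    qed
    ultimately show ?thesis unfolding admissible_def by (simp add: A_zero_iff B_zero_iff)
  qed
  have "periodic_params 3 = {of_real ((E + s) / D), of_real ((E - s) / D)}"
    unfolding periodic_params_three using roots adm by auto
  moreover have "(E + s) / D \<noteq> (E - s) / D" using s D by (simp add: field_simps)
  then have "complex_of_real ((E + s) / D) \<noteq> of_real ((E - s) / D)" by (simp only: of_real_eq_iff) simp
  ultimately show ?thesis by simp
qed

lemma card_periodic_params_four: "card (periodic_params 4) = (if a = sqrt 2 * b then 2 else 3)"
proof -
  define \<alpha> \<beta> where "\<alpha> = 1 / a^2" and "\<beta> = 1 / b^2"
  have pos: "0 < \<alpha>" "0 < \<beta>" using a_pos b_pos by (simp_all add: \<alpha>_def \<beta>_def)
  have less: "\<alpha> < \<beta>" using b_pos b_less_a a_pos unfolding \<alpha>_def \<beta>_def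
    by (simp add: divide_strict_left_mono power_strict_mono)
  have AB: "A l = 1 + l * of_real \<alpha>" "B l = 1 + l * of_real \<beta>" for l
    by (simp_all add: A_def B_def \<alpha>_def \<beta>_def)
  \<comment> \<open>The zeros of h, k - 1 and k + 1, in this order.\<close>
  define l1 l2 l3 where "l1 = - 1 / (\<alpha> + \<beta>)" and "l2 = 1 / (\<alpha> - \<beta>)" and "l3 = - 1 / (\<alpha> - \<beta>)"
  have sol: "h l * (k l ^ 2 - 1) = 0 \<longleftrightarrow> l = of_real l1 \<or> l = of_real l2 \<or> l = of_real l3" for l
  proof -
    have solve: "l * of_real c = of_real x \<longleftrightarrow> l = of_real (x / c)" if "c \<noteq> 0" for c x :: real
      using that by (auto simp: eq_divide_eq)
    have "h l = 1 + l * of_real (\<alpha> + \<beta>)" "k l = l * of_real (\<alpha> - \<beta>)"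
      by (simp_all add: h_def k_def AB algebra_simps)
    moreover have "1 + l * of_real (\<alpha> + \<beta>) = 0 \<longleftrightarrow> l * of_real (\<alpha> + \<beta>) = of_real (- 1)"
      by (simp add: add_eq_0_iff)
    moreover have "l * of_real (\<alpha> + \<beta>) = of_real (- 1) \<longleftrightarrow> l = of_real l1"
      unfolding l1_def using pos by (intro solve) simp
    moreover have "l * of_real (\<alpha> - \<beta>) = 1 \<longleftrightarrow> l = of_real l2" "l * of_real (\<alpha> - \<beta>) = - 1 \<longleftrightarrow> l = of_real l3"
      using solve[of "\<alpha> - \<beta>" 1] solve[of "\<alpha> - \<beta>" "- 1"] less unfolding l2_def l3_def by simp_all
    ultimately show ?thesis by (simp add: power2_eq_1_iff)
  qed
  have adm: "admissible (of_real x) \<longleftrightarrow> x \<noteq> 0 \<and> 1 + x * \<alpha> \<noteq> 0 \<and> 1 + x * \<beta> \<noteq> 0" for x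
  proof -
    have "A (of_real x) = of_real (1 + x * \<alpha>)" "B (of_real x) = of_real (1 + x * \<beta>)" by (simp_all add: AB)
    then show ?thesis unfolding admissible_def
      using A_zero_iff[of "of_real x"] B_zero_iff[of "of_real x"] by (simp only: of_real_eq_0_iff insert_iff empty_iff de_Morgan_disj) auto
  qed
  have adm1: "admissible (of_real l1)" unfolding adm using pos by (auto simp: l1_def field_simps)
  have adm3: "admissible (of_real l3)" unfolding adm using pos less by (auto simp: l3_def field_simps)
  \<comment> \<open>\<open>l2\<close> meets the excluded value -a^2 exactly if \<beta> = 2 \<alpha>,
    that is a = sqrt 2 b; this is where the third conic disappears.\<close>
  have adm2: "admissible (of_real l2) \<longleftrightarrow> \<beta> \<noteq> 2 * \<alpha>" unfolding adm using pos less by (auto simp: l2_def field_simps)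
  have ab: "a = sqrt 2 * b \<longleftrightarrow> \<beta> = 2 * \<alpha>"
  proof -
    have "a = sqrt 2 * b \<longleftrightarrow> a^2 = (sqrt 2 * b)^2" using a_pos b_pos by (intro iffI) (auto simp: power2_eq_iff_nonneg)
    also have "\<dots> \<longleftrightarrow> \<beta> = 2 * \<alpha>" using a_pos b_pos by (auto simp: \<alpha>_def \<beta>_def power_mult_distrib field_simps)
    finally show ?thesis .
  qed
  have neq: "l1 \<noteq> l2" "l1 \<noteq> l3" "l2 \<noteq> l3" using pos less by (auto simp: l1_def l2_def l3_def field_simps)
  have eq: "periodic_params 4 = (if \<beta> = 2 * \<alpha> then of_real ` {l1, l3} else of_real ` {l1, l2, l3})"
    unfolding periodic_params_four sol using adm1 adm2 adm3 by auto
  have "card (complex_of_real ` {l1, l3}) = 2" "card (complex_of_real ` {l1, l2, l3}) = 3"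
    using neq by (subst card_image; simp add: inj_on_def)+
  then show ?thesis unfolding eq ab by simp
qed

end

theorem theorem1p3:
  fixes a b :: real and n :: nat
  assumes "0 < b" and "b < a" and "3 \<le> n"
  shows "\<exists>(N::nat) (lam :: nat \<Rightarrow> complex).
    (\<forall>j\<in>{1..N}. lam j \<notin> {0, - ((of_real a)^2), - ((of_real b)^2)}) \<and>
    inj_on (\<lambda>j. conic_curve (confocal a b (lam j))) {1..N} \<and>
    (\<forall>j\<in>{1..N}. \<forall>M l.
       poncelet_polygon (ellipse a b) (confocal a b (lam j)) n M l \<and> (\<forall>i. M i \<noteq> M (i + 1)) \<longrightarrow>
       nondegenerate_orbit (ellipse a b) n M \<and> non_isotropic_orbit M \<and> \<not> flat_orbit a b M) \<and>
    (\<forall>M. nondegenerate_orbit (ellipse a b) n M \<and> non_isotropic_orbit M \<and>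
       (\<forall>i. side M i \<inter> (real_foci a b \<union> complex_foci a b) = {}) \<longrightarrow>
       (\<exists>j\<in>{1..N}. circumscribed (confocal a b (lam j)) M (side M))) \<and>
    (\<forall>p\<in>conic_curve (ellipse a b). \<forall>j\<in>{1..N}. \<exists>M l.
       poncelet_polygon (ellipse a b) (confocal a b (lam j)) n M l \<and> (\<exists>i. M i = p)) \<and>
    (even n \<longrightarrow> real N \<le> (real n)^2 / 4) \<and>
    (odd n \<longrightarrow> real N \<le> ((real n)^2 - 1) / 4) \<and>
    (n = 3 \<longrightarrow> N = 2) \<and>
    (n = 4 \<and> a \<noteq> sqrt 2 * b \<longrightarrow> N = 3) \<and>
    (n = 4 \<and> a = sqrt 2 * b \<longrightarrow> N = 2)"
proof -
  interpret ellipse_plane a b by unfold_locales fact+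
  \<comment> \<open>All parameters whose polygons close are taken, so that circumscription of every
    billiard orbit is automatic and the bounds become statements about one finite set.\<close>
  define S where "S = periodic_params n"
  have fin: "finite S" unfolding S_def using periodic_params_finite(1)[OF assms(3)] .
  define N where "N = card S"
  obtain lam where bij: "bij_betw lam {1..N} S"
    using ex_bij_betw_nat_finite_1[OF fin] unfolding N_def by blast
  have adm: "admissible (lam j)" and cl: "closes n (lam j)" if "j \<in> {1..N}" for j
    using bij_betwE[OF bij] that unfolding S_def periodic_params_def by auto
  have n0: "0 < n" using assms(3) by simp
  have 1: "\<forall>j\<in>{1..N}. lam j \<notin> {0, - ((of_real a)^2), - ((of_real b)^2)}"
    using adm unfolding admissible_def by blast
  have 2: "inj_on (\<lambda>j. conic_curve (confocal a b (lam j))) {1..N}"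
  proof (rule inj_onI)
    fix i j assume ij: "i \<in> {1..N}" "j \<in> {1..N}"
      and "conic_curve (confocal a b (lam i)) = conic_curve (confocal a b (lam j))"
    then have "lam i = lam j" using conic_curve_confocal_inject adm by blast
    then show "i = j" using bij ij unfolding bij_betw_def inj_on_def by blast
  qed
  have 3: "\<forall>j\<in>{1..N}. \<forall>M l.
       poncelet_polygon (ellipse a b) (confocal a b (lam j)) n M l \<and> (\<forall>i. M i \<noteq> M (i + 1)) \<longrightarrow>
       nondegenerate_orbit (ellipse a b) n M \<and> non_isotropic_orbit M \<and> \<not> flat_orbit a b M"
    using polygon_is_billiard[OF adm] by blast
  have 4: "\<forall>M. nondegenerate_orbit (ellipse a b) n M \<and> non_isotropic_orbit M \<and>
       (\<forall>i. side M i \<inter> (real_foci a b \<union> complex_foci a b) = {}) \<longrightarrow>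
       (\<exists>j\<in>{1..N}. circumscribed (confocal a b (lam j)) M (side M))"
  proof (intro allI impI)
    fix M assume "nondegenerate_orbit (ellipse a b) n M \<and> non_isotropic_orbit M \<and>
       (\<forall>i. side M i \<inter> (real_foci a b \<union> complex_foci a b) = {})"
    then obtain l v i where l: "admissible l" "cyclic n v" "orbit (chord_form l) v" "br (v i) (v (i + 2)) \<noteq> 0"
      and circ: "circumscribed (confocal a b l) M (side M)"
      using billiard_is_orbit[of n M] by blast
    \<comment> \<open>The billiard orbit itself is the closed orbit from which the porism
      starts.\<close>
    have "l \<in> S" using closesI[OF l(1) n0 l(2-4)] l(1) by (simp add: S_def periodic_params_def)
    then obtain j where "j \<in> {1..N}" "lam j = l" using bij unfolding bij_betw_def by blast
    then show "\<exists>j\<in>{1..N}. circumscribed (confocal a b (lam j)) M (side M)" using circ by blast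
  qed
  have 5: "\<forall>p\<in>conic_curve (ellipse a b). \<forall>j\<in>{1..N}. \<exists>M l.
       poncelet_polygon (ellipse a b) (confocal a b (lam j)) n M l \<and> (\<exists>i. M i = p)"
  proof (intro ballI)
    fix p j assume "p \<in> conic_curve (ellipse a b)" and j: "j \<in> {1..N}"
    then obtain w where w: "w \<noteq> 0" "p = ellipse_pt w" using ellipse_pt_cases by blast
    then obtain v i where v: "cyclic n v" "orbit (chord_form (lam j)) v" "br (v i) w = 0"
      using cl[OF j] unfolding closes_def by blast
    have "ellipse_pt (v i) = p" using v(2,3) w ellipse_pt_eq_iff unfolding orbit_def by blast
    then show "\<exists>M l. poncelet_polygon (ellipse a b) (confocal a b (lam j)) n M l \<and> (\<exists>i. M i = p)"
      using poncelet_polygon_of_orbit[OF adm[OF j] v(1,2)] by blast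
  qed
  have card: "N \<le> (if even n then (n div 2)^2 - 1 else (n div 2) * Suc (n div 2))"
    unfolding N_def S_def by (rule periodic_params_finite(2)[OF assms(3)])
  have 6: "even n \<longrightarrow> real N \<le> (real n)^2 / 4"
  proof
    assume "even n"
    then obtain m where m: "n = 2 * m" by blast
    then have "N \<le> m^2" using card by simp
    then have "real N \<le> real m ^ 2" by (metis of_nat_le_iff of_nat_power)
    then show "real N \<le> (real n)^2 / 4" by (simp add: m power_mult_distrib)
  qed
  have 7: "odd n \<longrightarrow> real N \<le> ((real n)^2 - 1) / 4"
  proof
    assume "odd n"
    then obtain m where m: "n = 2 * m + 1" using oddE by blast
    then have "N \<le> m * Suc m" using card by simp
    then have "real N \<le> real m * (real m + 1)" by (metis of_nat_Suc of_nat_le_iff of_nat_mult add.commute)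
    then show "real N \<le> ((real n)^2 - 1) / 4" by (simp add: m power2_eq_square algebra_simps)
  qed
  have 8: "n = 3 \<longrightarrow> N = 2" unfolding N_def S_def using card_periodic_params_three by blast
  have 9: "n = 4 \<and> a \<noteq> sqrt 2 * b \<longrightarrow> N = 3" "n = 4 \<and> a = sqrt 2 * b \<longrightarrow> N = 2"
    unfolding N_def S_def using card_periodic_params_four by auto
  show ?thesis
    by (rule exI[of _ N], rule exI[of _ lam], intro conjI) (rule 1 2 3 4 5 6 7 8 9)+
qed

end
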